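(* Let $\Gamma$ be a tropical curve with a fixed model without loops or multiple edges, and $D$ a divisor with $r(D)\ge0$. Then every point $D_P$ in the image of $\mathrm{Red}$ is either a vertex of $|D|$ or a tropical convex combination of two vertices of $|D|$ which lie in the image of $\mathrm{Red}$, i.e. there exist $Q_1,Q_2\in\Gamma$ with $D_{Q_1},D_{Q_2}$ vertices of $|D|$ and $a,b\in\mathbb R$ such that $f_P=\max(a+f_{Q_1},\,b+f_{Q_2})$. Moreover, the tropical convex hull of the image of $\mathrm{Red}$ is finitely generated.
   Context: A tropical curve $\Gamma$ is a compact connected metric graph (finite connected graph with edges identified with closed intervals of positive lengths). A divisor is a finite formal integer combination of points. Rational functions are continuous piecewise linear $f:\Gamma\to\mathbb R$ with integer slopes and finitely many pieces per edge; $\mathrm{div}(f)=\sum_v\mathrm{ord}_v(f)(v)$ with $\mathrm{ord}_v(f)$ the sum of outgoing slopes at $v$; $D\sim D'$ if $D-D'=\mathrm{div}(f)$; $|D|=\{E\ge0:E\sim D\}$; $R(D)=\{f: D+\mathrm{div}(f)\ge0\}$; $r(D)=\min\{\deg(E):E\ge0,\ |D-E|=\emptyset\}-1$. For a closed connected $X\subseteq\Gamma$ and $v\in\partial X$, $\deg^{\mathrm{out}}_X(v)$ is the maximum number of internally disjoint segments in $\Gamma\setminus(X\setminus\{v\})$ with an endpoint at $v$. $D'$ is $P$-reduced if $D'(v)\ge0$ for $v\neq P$ and every closed connected $X$ with $P\notin X$ has a boundary point $v$ with $D'(v)<\deg^{\mathrm{out}}_X(v)$; $D_P$ is the unique $P$-reduced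 divisor equivalent to $D$, and $\mathrm{Red}(P)=D_P$. $f_P$ denotes the unique rational function with $D+\mathrm{div}(f_P)=D_P$ and $f_P(P)=0$; elements of $|D|$ are identified with elements of $R(D)$ modulo additive constants. Tropical operations on functions: $(f\oplus g)(x)=\max(f(x),g(x))$, $(c\odot f)(x)=c+f(x)$; the tropical convex hull of the image of $\mathrm{Red}$ is the tropical module (set of functions $\max_i (c_i+f_{P_i})$ over finite families) generated by $\{f_P: P\in\Gamma\}$, considered modulo additive constants. Cell structure of $|D|$: with respect to the fixed model $G=(V,E)$ with oriented edges, two effective divisors have the same combinatorial type if they have the same coefficient at each vertex and, for each edge, the points of their supports in the interior of that edge, listed in order, have the same multiplicity sequence; open cells of $|D|$ are the connected components (in $\Gamma^{(\deg D)}$) of the sets of elements of $|D|$ of fixed type, cells are their closures; vertices of $|D|$ are its $0$-dimensional cells. *)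

theory Defs
  imports "HOL-Analysis.Analysis"
begin

section \<open>Tropical curves\<close>

text \<open>
  A tropical curve with a fixed model without loops or multiple edges.  The vertex set of the model
  is the finite type \<open>'v\<close>; a pair \<open>(u, w)\<close> in \<open>edges\<close> is an edge oriented from \<open>u\<close> to \<open>w\<close>.
\<close>

record 'v model =
  edges :: "('v \<times> 'v) set"
  edge_length :: "'v \<times> 'v \<Rightarrow> real"

definition tropical_curve :: "('v::finite) model \<Rightarrow> bool" where
  "tropical_curve G \<longleftrightarrow>
     (\<forall>u. (u, u) \<notin> edges G) \<and>
     (\<forall>u w. (u, w) \<in> edges G \<longrightarrow> (w, u) \<notin> edges G) \<and>
     (\<forall>e\<in>edges G. 0 < edge_length G e) \<and>
     (\<forall>u w. (u, w) \<in> (edges G \<union> (edges G)\<inverse>)\<^sup>*)"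

text \<open>
  The points of the curve are taken in the geometric realization inside \<open>real^'v\<close>: the vertex \<open>v\<close> is
  the unit vector \<open>axis v 1\<close>, and the edge \<open>e\<close> is identified with the interval
  \<open>{0..edge_length G e}\<close> through the parametrization \<open>edge_point G e\<close>.  Since the graph is finite, the
  topology induced from \<open>real^'v\<close> is that of the metric graph; distances along edges are always
  measured with the parameter of \<open>edge_point\<close>, never with the Euclidean distance.
\<close>

definition edge_point :: "('v::finite) model \<Rightarrow> 'v \<times> 'v \<Rightarrow> real \<Rightarrow> real^'v" where
  "edge_point G e t =
     (1 - t / edge_length G e) *\<^sub>R axis (fst e) 1 + (t / edge_length G e) *\<^sub>R axis (snd e) 1"

definition curve :: "('v::finite) model \<Rightarrow> (real^'v) set" where
  "curve G = range (\<lambda>v. axis v 1) \<union> (\<Union>e\<in>edges G. edge_point G e ` {0..edge_length G e})"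


section \<open>Divisors and rational functions\<close>

text \<open>A divisor is represented by its coefficient function.\<close>

type_synonym 'v divisor = "real^'v \<Rightarrow> int"

definition is_divisor :: "('v::finite) model \<Rightarrow> 'v divisor \<Rightarrow> bool" where
  "is_divisor G D \<longleftrightarrow> finite {x. D x \<noteq> 0} \<and> {x. D x \<noteq> 0} \<subseteq> curve G"

definition effective :: "('v::finite) model \<Rightarrow> 'v divisor \<Rightarrow> bool" where
  "effective G D \<longleftrightarrow> is_divisor G D \<and> (\<forall>x. 0 \<le> D x)"

definition deg :: "('v::finite) divisor \<Rightarrow> int" where
  "deg D = (\<Sum>x | D x \<noteq> 0. D x)"

text \<open>
  Functions on the curve are extensional (\<open>undefined\<close> off the curve), so that equality of functions
  is equality on the curve.  The finite set \<open>B\<close> contains the break points on the edge \<open>e\<close>.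
\<close>

definition rational_fun :: "('v::finite) model \<Rightarrow> (real^'v \<Rightarrow> real) \<Rightarrow> bool" where
  "rational_fun G f \<longleftrightarrow>
     f \<in> extensional (curve G) \<and> continuous_on (curve G) f \<and>
     (\<forall>e\<in>edges G. \<exists>B. finite B \<and>
        (\<forall>a b. 0 \<le> a \<and> a < b \<and> b \<le> edge_length G e \<and> {a<..<b} \<inter> B = {} \<longrightarrow>
           (\<exists>(m::int) c. \<forall>t\<in>{a..b}. f (edge_point G e t) = of_int m * t + c)))"

text \<open>
  An outgoing direction at \<open>x\<close> is a triple \<open>(e, t, s)\<close>: the point \<open>x\<close> lies on the edge \<open>e\<close> at
  parameter \<open>t\<close>, and one leaves it along \<open>e\<close> with the orientation (\<open>s = 1\<close>) or against it (\<open>s = -1\<close>).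
\<close>

definition directions :: "('v::finite) model \<Rightarrow> real^'v \<Rightarrow> (('v \<times> 'v) \<times> real \<times> real) set" where
  "directions G x =
     {(e, t, s). e \<in> edges G \<and> t \<in> {0..edge_length G e} \<and> edge_point G e t = x \<and>
        (s = 1 \<and> t < edge_length G e \<or> s = -1 \<and> 0 < t)}"

definition outgoing_slope ::
    "('v::finite) model \<Rightarrow> (real^'v \<Rightarrow> real) \<Rightarrow> ('v \<times> 'v) \<times> real \<times> real \<Rightarrow> int" where
  "outgoing_slope G f = (\<lambda>(e, t, s). THE m::int.
     \<forall>\<^sub>F h in at_right 0.
       f (edge_point G e (t + s * h)) = f (edge_point G e t) + of_int m * h)"

definition ord :: "('v::finite) model \<Rightarrow> (real^'v \<Rightarrow> real) \<Rightarrow> real^'v \<Rightarrow> int" where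
  "ord G f x = (\<Sum>d\<in>directions G x. outgoing_slope G f d)"

text \<open>This is \<open>ord\<close> itself, since there are no directions at points off the curve.\<close>

definition div_fun :: "('v::finite) model \<Rightarrow> (real^'v \<Rightarrow> real) \<Rightarrow> 'v divisor" where
  "div_fun G f = (\<lambda>x. ord G f x)"

definition lin_equiv :: "('v::finite) model \<Rightarrow> 'v divisor \<Rightarrow> 'v divisor \<Rightarrow> bool" where
  "lin_equiv G D D' \<longleftrightarrow> (\<exists>f. rational_fun G f \<and> (\<lambda>x. D x - D' x) = div_fun G f)"

definition linear_system :: "('v::finite) model \<Rightarrow> 'v divisor \<Rightarrow> 'v divisor set" where
  "linear_system G D = {E. effective G E \<and> lin_equiv G E D}"

definition divisor_rank :: "('v::finite) model \<Rightarrow> 'v divisor \<Rightarrow> int" where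
  "divisor_rank G D =
     int (LEAST k. \<exists>E. effective G E \<and> deg E = int k \<and> linear_system G (\<lambda>x. D x - E x) = {}) - 1"


section \<open>Reduced divisors\<close>

text \<open>
  A segment with an endpoint at \<open>v\<close> is the image of an \<open>arc\<close> starting at \<open>v\<close>; its interior is the
  image of the open unit interval.
\<close>

definition out_degree :: "('v::finite) model \<Rightarrow> (real^'v) set \<Rightarrow> real^'v \<Rightarrow> nat" where
  "out_degree G X v = Max {card S | S. finite S \<and>
     (\<forall>g\<in>S. arc g \<and> pathstart g = v \<and> path_image g \<subseteq> curve G - (X - {v})) \<and>
     pairwise (\<lambda>g h. disjnt (g ` {0<..<1}) (h ` {0<..<1})) S}"

text \<open>Connected subsets are understood to be nonempty.\<close>

definition reduced :: "('v::finite) model \<Rightarrow> real^'v \<Rightarrow> 'v divisor \<Rightarrow> bool" where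
  "reduced G P D \<longleftrightarrow> is_divisor G D \<and> (\<forall>v. v \<noteq> P \<longrightarrow> 0 \<le> D v) \<and>
     (\<forall>X. X \<subseteq> curve G \<and> closed X \<and> connected X \<and> X \<noteq> {} \<and> P \<notin> X \<longrightarrow>
        (\<exists>v \<in> top_of_set (curve G) frontier_of X. D v < int (out_degree G X v)))"

definition Red :: "('v::finite) model \<Rightarrow> 'v divisor \<Rightarrow> real^'v \<Rightarrow> 'v divisor" where
  "Red G D P = (THE D'. reduced G P D' \<and> lin_equiv G D' D)"

definition red_fun :: "('v::finite) model \<Rightarrow> 'v divisor \<Rightarrow> real^'v \<Rightarrow> real^'v \<Rightarrow> real" where
  "red_fun G D P = (THE f. rational_fun G f \<and> (\<lambda>x. D x + div_fun G f x) = Red G D P \<and> f P = 0)"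


section \<open>Tropical operations\<close>

definition trop_add ::
    "('v::finite) model \<Rightarrow> (real^'v \<Rightarrow> real) \<Rightarrow> (real^'v \<Rightarrow> real) \<Rightarrow> real^'v \<Rightarrow> real" where
  "trop_add G f g = (\<lambda>x\<in>curve G. max (f x) (g x))"

definition trop_scale :: "('v::finite) model \<Rightarrow> real \<Rightarrow> (real^'v \<Rightarrow> real) \<Rightarrow> real^'v \<Rightarrow> real" where
  "trop_scale G c f = (\<lambda>x\<in>curve G. c + f x)"

text \<open>
  The tropical module generated by \<open>F\<close>.  It is stable under \<open>trop_scale\<close>, i.e. under adding
  constants, so two such modules are equal iff they are equal modulo additive constants; for this
  reason no quotient by constants is formed.
\<close>

definition trop_span :: "('v::finite) model \<Rightarrow> (real^'v \<Rightarrow> real) set \<Rightarrow> (real^'v \<Rightarrow> real) set" where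
  "trop_span G F =
     {(\<lambda>x\<in>curve G. Max ((\<lambda>f. trop_scale G (c f) f x) ` A)) | A c. finite A \<and> A \<noteq> {} \<and> A \<subseteq> F}"

definition trop_finitely_generated ::
    "('v::finite) model \<Rightarrow> (real^'v \<Rightarrow> real) set \<Rightarrow> bool" where
  "trop_finitely_generated G M \<longleftrightarrow> (\<exists>F. finite F \<and> F \<subseteq> M \<and> M = trop_span G F)"

definition Red_hull :: "('v::finite) model \<Rightarrow> 'v divisor \<Rightarrow> (real^'v \<Rightarrow> real) set" where
  "Red_hull G D = trop_span G (red_fun G D ` curve G)"


section \<open>The cell structure of a complete linear system\<close>

text \<open>
  The symmetric product of the curve with itself \<open>d\<close> times is the set of effective divisors of
  degree \<open>d\<close> with the quotient topology under \<open>(p\<^sub>0, \<dots>, p\<^sub>d\<^sub>-\<^sub>1) \<mapsto> (p\<^sub>0) + \<dots> + (p\<^sub>d\<^sub>-\<^sub>1)\<close>.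
\<close>

definition curve_power :: "('v::finite) model \<Rightarrow> nat \<Rightarrow> (nat \<Rightarrow> real^'v) topology" where
  "curve_power G d = product_topology (\<lambda>_. top_of_set (curve G)) {..<d}"

definition tuple_divisor :: "nat \<Rightarrow> (nat \<Rightarrow> real^'v) \<Rightarrow> ('v::finite) divisor" where
  "tuple_divisor d p = (\<lambda>x. int (card {i. i < d \<and> p i = x}))"

definition sym_power :: "('v::finite) model \<Rightarrow> nat \<Rightarrow> 'v divisor topology" where
  "sym_power G d = topology (\<lambda>U. U \<subseteq> tuple_divisor d ` topspace (curve_power G d) \<and>
     openin (curve_power G d) {p \<in> topspace (curve_power G d). tuple_divisor d p \<in> U})"

lemma openin_sym_power:
  "openin (sym_power G d) U \<longleftrightarrow> U \<subseteq> tuple_divisor d ` topspace (curve_power G d) \<and>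
     openin (curve_power G d) {p \<in> topspace (curve_power G d). tuple_divisor d p \<in> U}"
proof -
  let ?X = "curve_power G d" and ?q = "tuple_divisor d"
  let ?pre = "\<lambda>U. {p \<in> topspace ?X. ?q p \<in> U}"
  have "istopology (\<lambda>U. U \<subseteq> ?q ` topspace ?X \<and> openin ?X (?pre U))"
    unfolding istopology_def
  proof (intro conjI allI impI)
    fix S T
    assume S: "S \<subseteq> ?q ` topspace ?X \<and> openin ?X (?pre S)"
      and T: "T \<subseteq> ?q ` topspace ?X \<and> openin ?X (?pre T)"
    show "S \<inter> T \<subseteq> ?q ` topspace ?X" using S by blast
    have "?pre (S \<inter> T) = ?pre S \<inter> ?pre T" by blast
    then show "openin ?X (?pre (S \<inter> T))" using S T by (simp add: openin_Int)
  next
    fix K assume K: "\<forall>S\<in>K. S \<subseteq> ?q ` topspace ?X \<and> openin ?X (?pre S)"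
    then show "\<Union>K \<subseteq> ?q ` topspace ?X" by blast
    have "?pre (\<Union>K) = (\<Union>S\<in>K. ?pre S)" by blast
    then show "openin ?X (?pre (\<Union>K))" using K by auto
  qed
  then show ?thesis unfolding sym_power_def by (simp only: topology_inverse')
qed

lemma quotient_map_tuple_divisor:
  "quotient_map (curve_power G d) (sym_power G d) (tuple_divisor d)"
proof -
  let ?X = "curve_power G d" and ?q = "tuple_divisor d"
  have "{p \<in> topspace ?X. ?q p \<in> ?q ` topspace ?X} = topspace ?X" by blast
  then have "openin (sym_power G d) (?q ` topspace ?X)"
    unfolding openin_sym_power by simp
  then have sup: "?q ` topspace ?X \<subseteq> topspace (sym_power G d)"
    by (rule openin_subset)
  have "openin (sym_power G d) (topspace (sym_power G d))"
    by (rule openin_topspace)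
  then have "topspace (sym_power G d) \<subseteq> ?q ` topspace ?X"
    unfolding openin_sym_power by (rule conjunct1)
  with sup have top: "topspace (sym_power G d) = ?q ` topspace ?X"
    by (rule subset_antisym[rotated])
  show ?thesis
    unfolding quotient_map_def top openin_sym_power by blast
qed

text \<open>The multiplicities of the points of \<open>D\<close> in the interior of \<open>e\<close>, listed along \<open>e\<close>.\<close>

definition edge_sequence :: "('v::finite) model \<Rightarrow> 'v divisor \<Rightarrow> 'v \<times> 'v \<Rightarrow> int list" where
  "edge_sequence G D e =
     map (\<lambda>t. D (edge_point G e t))
       (sorted_list_of_set {t. 0 < t \<and> t < edge_length G e \<and> D (edge_point G e t) \<noteq> 0})"

definition same_type :: "('v::finite) model \<Rightarrow> 'v divisor \<Rightarrow> 'v divisor \<Rightarrow> bool" where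
  "same_type G D D' \<longleftrightarrow> (\<forall>v. D (axis v 1) = D' (axis v 1)) \<and>
     (\<forall>e\<in>edges G. edge_sequence G D e = edge_sequence G D' e)"

definition open_cells :: "('v::finite) model \<Rightarrow> 'v divisor \<Rightarrow> 'v divisor set set" where
  "open_cells G D = (\<Union>E\<in>linear_system G D. connected_components_of
     (subtopology (sym_power G (nat (deg D))) {E' \<in> linear_system G D. same_type G E' E}))"

definition cells :: "('v::finite) model \<Rightarrow> 'v divisor \<Rightarrow> 'v divisor set set" where
  "cells G D = (\<lambda>C. sym_power G (nat (deg D)) closure_of C) ` open_cells G D"

text \<open>
  \<open>dim_le\<close> is the small inductive dimension.  A zero-dimensional cell is nonempty, connected and
  Hausdorff, hence of the form \<open>{E}\<close>; it is identified with \<open>E\<close>.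
\<close>

definition cell_vertices :: "('v::finite) model \<Rightarrow> 'v divisor \<Rightarrow> 'v divisor set" where
  "cell_vertices G D =
     {E. {E} \<in> cells G D \<and> subtopology (sym_power G (nat (deg D))) {E} dim_le 0}"

end

theory Submission
  imports Defs
begin

text \<open>
  A divisor \<open>D + div f\<close> is reduced at \<open>P\<close> iff \<open>f - f P\<close> is the pointwise maximum of all
  \<open>g - g P\<close> with \<open>g\<close> in \<open>R(D)\<close>: a function exceeding it would fire the set where the difference is
  largest, and conversely firing a set not containing \<open>P\<close> would produce such a function.

  Call an effective divisor rigid if its chips in the interior of the edges do not disconnect the
  curve.  If \<open>D + div f\<close> is not rigid, some of these chips separate the curve into two sides.
  Moving them into either side until a chip meets a vertex or another chip writes \<open>f\<close> as the maximum
  of two functions in \<open>R(D)\<close> with fewer chips inside edges.  A flow argument shows that a rigid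
  divisor is determined by its combinatorial type and a rough knowledge of the positions of its
  chips.  Hence there are finitely many rigid divisors in \<open>|D|\<close>, they are vertices of \<open>|D|\<close>, and
  maxima over the corresponding functions provide the reduced divisors.

  If \<open>D\<^sub>P\<close> is not rigid, then \<open>P\<close> is one of the separating chips.  While the chips move, the curve
  with the divisor and the chip coming from \<open>P\<close> stays homeomorphic to the original one, so the
  divisor stays reduced at that chip, also in the limit.  At the first collision it has become
  rigid, so the two functions above come from rigid divisors in the image of \<open>Red\<close>.
\<close>

section \<open>Local slopes of functions of a real variable\<close>

text \<open>Reducedness quantifies over all closed connected sets and all arcs, which does not pass
  to limits. As a pointwise maximum it becomes the family of weak inequalities
  \<open>f' x - f' P \<le> f x - f P\<close>. These survive the collision, where the homeomorphism
  degenerates, and they also yield existence and uniqueness of \<open>D_P\<close>: every function in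
  R(D) is dominated by a rigid one, so a maximum over finitely many functions suffices. One
  collision is enough to reach a rigid divisor because, by maximality, \<open>P\<close> belongs to
  every separating set of chips of \<open>D_P\<close>. If a second separating set survived the
  collision, its symmetric difference with the moved one would separate the curve while avoiding
  \<open>P\<close>. Finiteness rests on integrality. The difference of two functions has integral
  slopes at the ends of the edges, and they form a conserved flow. A nonzero integral slope changes
  the function along an edge by at least the length of the edge, which is more than multiplicity
  times displacement of a chip can compensate.\<close>

definition has_slope :: "(real \<Rightarrow> real) \<Rightarrow> real \<Rightarrow> real \<Rightarrow> int \<Rightarrow> bool" where
  "has_slope \<phi> t s m \<longleftrightarrow> (\<forall>\<^sub>F h in at_right 0. \<phi> (t + s * h) = \<phi> t + of_int m * h)"

definition the_slope :: "(real \<Rightarrow> real) \<Rightarrow> real \<Rightarrow> real \<Rightarrow> int" where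
  "the_slope \<phi> t s = (THE m. has_slope \<phi> t s m)"

definition valid_dir :: "real \<Rightarrow> real \<Rightarrow> real \<Rightarrow> bool" where
  "valid_dir l t s \<longleftrightarrow> (s = 1 \<and> 0 \<le> t \<and> t < l) \<or> (s = -1 \<and> 0 < t \<and> t \<le> l)"

text \<open>A pointwise form of piecewise linearity. It passes to sums and maxima without merging
  lists of break points, and compactness of the interval brings the finitely many pieces
  back.\<close>

definition locally_linear :: "real \<Rightarrow> (real \<Rightarrow> real) \<Rightarrow> bool" where
  "locally_linear l \<phi> \<longleftrightarrow> (\<forall>t s. valid_dir l t s \<longrightarrow> (\<exists>m. has_slope \<phi> t s m))"

lemma eventually_at_right_small: "(0::real) < d \<Longrightarrow> \<forall>\<^sub>F h in at_right 0. 0 < h \<and> h < d"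
  unfolding eventually_at_right_field by metis

lemma has_slope_ex: "has_slope \<phi> t s m \<longleftrightarrow> (\<exists>d>0. \<forall>h\<in>{0..d}. \<phi> (t + s * h) = \<phi> t + of_int m * h)"
proof
  assume "has_slope \<phi> t s m"
  then obtain d where d: "d > 0" "\<And>h. 0 < h \<Longrightarrow> h < d \<Longrightarrow> \<phi> (t + s * h) = \<phi> t + of_int m * h"
    unfolding has_slope_def eventually_at_right_field by auto
  have "\<phi> (t + s * h) = \<phi> t + of_int m * h" if "h \<in> {0..d/2}" for h
    using d that by (cases "h = 0") auto
  then show "\<exists>d>0. \<forall>h\<in>{0..d}. \<phi> (t + s * h) = \<phi> t + of_int m * h"
    using d(1) by (intro exI[of _ "d/2"]) auto
next
  assume "\<exists>d>0. \<forall>h\<in>{0..d}. \<phi> (t + s * h) = \<phi> t + of_int m * h"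
  then show "has_slope \<phi> t s m"
    unfolding has_slope_def eventually_at_right_field by (meson atLeastAtMost_iff less_imp_le)
qed

lemma has_slope_unique: assumes "has_slope \<phi> t s m" "has_slope \<phi> t s n" shows "m = n"
proof -
  obtain d where d: "d > 0" "\<forall>h\<in>{0..d}. \<phi> (t + s * h) = \<phi> t + of_int m * h"
    using assms(1) unfolding has_slope_ex by blast
  obtain d' where d': "d' > 0" "\<forall>h\<in>{0..d'}. \<phi> (t + s * h) = \<phi> t + of_int n * h"
    using assms(2) unfolding has_slope_ex by blast
  let ?h = "min d d'"
  have "of_int m * ?h = of_int n * ?h"
    using d d' by (metis add_left_cancel atLeastAtMost_iff less_imp_le min.cobounded1 min.cobounded2 min_less_iff_conj)
  then show ?thesis using d(1) d'(1) by auto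
qed

lemma the_slopeI: "has_slope \<phi> t s m \<Longrightarrow> the_slope \<phi> t s = m"
  unfolding the_slope_def using has_slope_unique by blast

lemma has_slope_the_slope: "locally_linear l \<phi> \<Longrightarrow> valid_dir l t s \<Longrightarrow> has_slope \<phi> t s (the_slope \<phi> t s)"
  unfolding locally_linear_def using the_slopeI by metis

lemma valid_dir_ev:
  assumes "valid_dir l t s"
  shows "\<exists>d>0. \<forall>h\<in>{0<..d}. 0 < t + s * h \<and> t + s * h < l"
proof (cases "s = 1")
  case True
  with assms show ?thesis unfolding valid_dir_def
    by (intro exI[of _ "(l - t) / 2"]) (auto simp: field_simps)
next
  case False
  with assms show ?thesis unfolding valid_dir_def
    by (intro exI[of _ "t / 2"]) (auto simp: field_simps)
qed

lemma valid_dir_range: "valid_dir l t s \<Longrightarrow> 0 \<le> t \<and> t \<le> l"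
  unfolding valid_dir_def by auto

lemma has_slope_cong_ev:
  assumes "has_slope \<phi> t s m" "0 < d" "\<And>h. 0 < h \<Longrightarrow> h \<le> d \<Longrightarrow> \<psi> (t + s * h) = \<phi> (t + s * h)" "\<psi> t = \<phi> t"
  shows "has_slope \<psi> t s m"
proof -
  have "\<forall>\<^sub>F h in at_right 0. 0 < h \<and> h < d" using assms(2) by (rule eventually_at_right_small)
  then show ?thesis using assms(1) unfolding has_slope_def
    by eventually_elim (use assms(3,4) in auto)
qed

lemma has_slope_cong:
  assumes "has_slope \<phi> t s m" "valid_dir l t s" "\<And>x. 0 \<le> x \<Longrightarrow> x \<le> l \<Longrightarrow> \<psi> x = \<phi> x"
  shows "has_slope \<psi> t s m"
proof -
  obtain d where d: "d > 0" "\<forall>h\<in>{0<..d}. 0 < t + s * h \<and> t + s * h < l"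
    using valid_dir_ev[OF assms(2)] by blast
  show ?thesis
  proof (rule has_slope_cong_ev[OF assms(1) d(1)])
    show "\<psi> (t + s * h) = \<phi> (t + s * h)" if "0 < h" "h \<le> d" for h
      using d(2) that by (intro assms(3)) (auto intro: less_imp_le)
    show "\<psi> t = \<phi> t" using valid_dir_range[OF assms(2)] assms(3) by blast
  qed
qed

lemma the_slope_cong:
  assumes "valid_dir l t s" "\<And>x. 0 \<le> x \<Longrightarrow> x \<le> l \<Longrightarrow> \<psi> x = \<phi> x"
  shows "the_slope \<psi> t s = the_slope \<phi> t s"
proof -
  have "has_slope \<psi> t s m \<longleftrightarrow> has_slope \<phi> t s m" for m
    using has_slope_cong[OF _ assms(1), of \<phi> m \<psi>] has_slope_cong[OF _ assms(1), of \<psi> m \<phi>] assms(2) by auto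
  then have "has_slope \<psi> t s = has_slope \<phi> t s" by (intro ext) simp
  then show ?thesis unfolding the_slope_def by simp
qed

lemma locally_linear_cong:
  assumes "locally_linear l \<phi>" "\<And>x. 0 \<le> x \<Longrightarrow> x \<le> l \<Longrightarrow> \<psi> x = \<phi> x"
  shows "locally_linear l \<psi>"
  using assms has_slope_cong unfolding locally_linear_def by metis

lemma has_slope_const: "has_slope (\<lambda>x. c) t s 0"
  unfolding has_slope_def by simp

lemma has_slope_id: "s = 1 \<or> s = -1 \<Longrightarrow> has_slope (\<lambda>x. x) t s (if s = 1 then 1 else -1)"
  unfolding has_slope_def by auto

lemma has_slope_add: "has_slope \<phi> t s m \<Longrightarrow> has_slope \<psi> t s n \<Longrightarrow> has_slope (\<lambda>x. \<phi> x + \<psi> x) t s (m + n)"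
  unfolding has_slope_def by (rule eventually_elim2, assumption, assumption) (auto simp: algebra_simps)

lemma has_slope_cmult: "has_slope \<phi> t s m \<Longrightarrow> has_slope (\<lambda>x. of_int k * \<phi> x) t s (k * m)"
  unfolding has_slope_def by (elim eventually_mono) (auto simp: algebra_simps)

lemma has_slope_minus: "has_slope \<phi> t s m \<Longrightarrow> has_slope (\<lambda>x. - \<phi> x) t s (- m)"
  unfolding has_slope_def by (elim eventually_mono) (auto simp: algebra_simps)

lemma has_slope_diff: "has_slope \<phi> t s m \<Longrightarrow> has_slope \<psi> t s n \<Longrightarrow> has_slope (\<lambda>x. \<phi> x - \<psi> x) t s (m - n)"
  unfolding has_slope_def by (rule eventually_elim2, assumption, assumption) (auto simp: algebra_simps)

lemma has_slope_max1:
  assumes "has_slope \<phi> t s m" "has_slope \<psi> t s n" "\<psi> t < \<phi> t"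
  shows "has_slope (\<lambda>x. max (\<phi> x) (\<psi> x)) t s m"
proof -
  have "((\<lambda>h. \<phi> t + of_int m * h - (\<psi> t + of_int n * h)) \<longlongrightarrow> \<phi> t + of_int m * 0 - (\<psi> t + of_int n * 0)) (at_right 0)"
    by (intro tendsto_intros)
  then have "\<forall>\<^sub>F h in at_right 0. 0 < \<phi> t + of_int m * h - (\<psi> t + of_int n * h)"
    by (rule order_tendstoD) (use assms(3) in simp)
  then show ?thesis using assms(1,2) unfolding has_slope_def
    by eventually_elim (use assms(3) in auto)
qed

lemma has_slope_max2:
  assumes "has_slope \<phi> t s m" "has_slope \<psi> t s n" "\<psi> t = \<phi> t"
  shows "has_slope (\<lambda>x. max (\<phi> x) (\<psi> x)) t s (max m n)"
proof -
  have "\<forall>\<^sub>F h in at_right (0::real). 0 < h" by (rule eventually_at_right_less)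
  then show ?thesis using assms(1,2) unfolding has_slope_def
  proof eventually_elim
    case (elim h)
    have "m \<le> n \<Longrightarrow> of_int m * h \<le> of_int n * h" using elim(1) by (intro mult_right_mono) auto
    moreover have "n \<le> m \<Longrightarrow> of_int n * h \<le> of_int m * h" using elim(1) by (intro mult_right_mono) auto
    ultimately show ?case using elim assms(3) by (auto simp: max_def)
  qed
qed

lemma has_slope_max:
  assumes "has_slope \<phi> t s m" "has_slope \<psi> t s n"
  shows "has_slope (\<lambda>x. max (\<phi> x) (\<psi> x)) t s
     (if \<psi> t < \<phi> t then m else if \<phi> t < \<psi> t then n else max m n)"
proof -
  have "\<phi> t < \<psi> t \<Longrightarrow> has_slope (\<lambda>x. max (\<phi> x) (\<psi> x)) t s n"
    using has_slope_max1[OF assms(2,1)] by (simp add: max.commute)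
  then show ?thesis using has_slope_max1[OF assms] has_slope_max2[OF assms] by auto
qed

lemma locally_linear_const: "locally_linear l (\<lambda>x. c)"
  unfolding locally_linear_def using has_slope_const by blast
lemma locally_linear_id: "locally_linear l (\<lambda>x. x)"
  unfolding locally_linear_def valid_dir_def using has_slope_id by blast
lemma locally_linear_add: "locally_linear l \<phi> \<Longrightarrow> locally_linear l \<psi> \<Longrightarrow> locally_linear l (\<lambda>x. \<phi> x + \<psi> x)"
  unfolding locally_linear_def using has_slope_add by blast
lemma locally_linear_diff: "locally_linear l \<phi> \<Longrightarrow> locally_linear l \<psi> \<Longrightarrow> locally_linear l (\<lambda>x. \<phi> x - \<psi> x)"
  unfolding locally_linear_def using has_slope_diff by blast
lemma locally_linear_minus: "locally_linear l \<phi> \<Longrightarrow> locally_linear l (\<lambda>x. - \<phi> x)"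
  unfolding locally_linear_def using has_slope_minus by blast
lemma locally_linear_cmult: "locally_linear l \<phi> \<Longrightarrow> locally_linear l (\<lambda>x. of_int k * \<phi> x)"
  unfolding locally_linear_def using has_slope_cmult by blast
lemma locally_linear_max: "locally_linear l \<phi> \<Longrightarrow> locally_linear l \<psi> \<Longrightarrow> locally_linear l (\<lambda>x. max (\<phi> x) (\<psi> x))"
  unfolding locally_linear_def using has_slope_max by blast
lemma locally_linear_sum: "(\<And>i. i \<in> I \<Longrightarrow> locally_linear l (\<phi> i)) \<Longrightarrow> locally_linear l (\<lambda>x. \<Sum>i\<in>I. \<phi> i x)"
  by (induction I rule: infinite_finite_induct) (auto intro: locally_linear_const locally_linear_add)
lemma locally_linear_abs: "locally_linear l \<phi> \<Longrightarrow> locally_linear l (\<lambda>x. \<bar>\<phi> x\<bar>)"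
  using locally_linear_max[OF _ locally_linear_minus, of l \<phi> \<phi>] by (simp add: abs_real_def max_def if_distrib cong: if_cong) (smt (verit) locally_linear_cong)

lemmas locally_linear_intros = locally_linear_const locally_linear_id locally_linear_add locally_linear_diff locally_linear_cmult locally_linear_max locally_linear_sum

lemma the_slope_add: "locally_linear l \<phi> \<Longrightarrow> locally_linear l \<psi> \<Longrightarrow> valid_dir l t s \<Longrightarrow>
    the_slope (\<lambda>x. \<phi> x + \<psi> x) t s = the_slope \<phi> t s + the_slope \<psi> t s"
  by (intro the_slopeI has_slope_add has_slope_the_slope)
lemma the_slope_diff: "locally_linear l \<phi> \<Longrightarrow> locally_linear l \<psi> \<Longrightarrow> valid_dir l t s \<Longrightarrow>
    the_slope (\<lambda>x. \<phi> x - \<psi> x) t s = the_slope \<phi> t s - the_slope \<psi> t s"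
  by (intro the_slopeI has_slope_diff has_slope_the_slope)
lemma the_slope_cmult: "locally_linear l \<phi> \<Longrightarrow> valid_dir l t s \<Longrightarrow>
    the_slope (\<lambda>x. of_int k * \<phi> x) t s = k * the_slope \<phi> t s"
  by (intro the_slopeI has_slope_cmult has_slope_the_slope)

section \<open>Orders of functions on a single edge\<close>

text \<open>The contribution of one edge of length \<open>l\<close> to the order at the parameter
  \<open>t\<close>; at an end of the edge only one of the two slopes exists.\<close>

definition slope_sum :: "real \<Rightarrow> (real \<Rightarrow> real) \<Rightarrow> real \<Rightarrow> int" where
  "slope_sum l \<phi> t = (if t < l then the_slope \<phi> t 1 else 0) + (if 0 < t then the_slope \<phi> t (-1) else 0)"

lemma slope_sum_cong:
  assumes "\<And>x. 0 \<le> x \<Longrightarrow> x \<le> l \<Longrightarrow> \<psi> x = \<phi> x" "0 \<le> t" "t \<le> l"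
  shows "slope_sum l \<psi> t = slope_sum l \<phi> t"
  unfolding slope_sum_def
  using the_slope_cong[of l t 1 \<psi> \<phi>] the_slope_cong[of l t "-1" \<psi> \<phi>] assms
  by (auto simp: valid_dir_def)

lemma slope_sum_add: "locally_linear l \<phi> \<Longrightarrow> locally_linear l \<psi> \<Longrightarrow> 0 \<le> t \<Longrightarrow> t \<le> l \<Longrightarrow>
    slope_sum l (\<lambda>x. \<phi> x + \<psi> x) t = slope_sum l \<phi> t + slope_sum l \<psi> t"
  unfolding slope_sum_def by (auto simp: the_slope_add[of l] valid_dir_def)
lemma slope_sum_diff: "locally_linear l \<phi> \<Longrightarrow> locally_linear l \<psi> \<Longrightarrow> 0 \<le> t \<Longrightarrow> t \<le> l \<Longrightarrow>
    slope_sum l (\<lambda>x. \<phi> x - \<psi> x) t = slope_sum l \<phi> t - slope_sum l \<psi> t"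
  unfolding slope_sum_def by (auto simp: the_slope_diff[of l] valid_dir_def)
lemma slope_sum_cmult: "locally_linear l \<phi> \<Longrightarrow> 0 \<le> t \<Longrightarrow> t \<le> l \<Longrightarrow>
    slope_sum l (\<lambda>x. of_int k * \<phi> x) t = k * slope_sum l \<phi> t"
  unfolding slope_sum_def by (auto simp: the_slope_cmult[of l] valid_dir_def algebra_simps)
lemma slope_sum_const: "slope_sum l (\<lambda>x. c) t = 0"
  unfolding slope_sum_def by (simp add: the_slopeI[OF has_slope_const])
lemma slope_sum_sum: "(\<And>i. i \<in> I \<Longrightarrow> locally_linear l (\<phi> i)) \<Longrightarrow> 0 \<le> t \<Longrightarrow> t \<le> l \<Longrightarrow>
   slope_sum l (\<lambda>x. \<Sum>i\<in>I. \<phi> i x) t = (\<Sum>i\<in>I. slope_sum l (\<phi> i) t)"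
  by (induction I rule: infinite_finite_induct) (auto simp: slope_sum_const slope_sum_add locally_linear_sum)

lemma slope_sum_id: "0 < l \<Longrightarrow> 0 \<le> t \<Longrightarrow> t \<le> l \<Longrightarrow> slope_sum l (\<lambda>x. x) t = of_bool (t = 0) - of_bool (t = l)"
  unfolding slope_sum_def using the_slopeI[OF has_slope_id[of 1 t]] the_slopeI[OF has_slope_id[of "-1" t]] by auto

lemma locally_linear_hinge: "locally_linear l (\<lambda>x. max 0 (x - c))"
  by (intro locally_linear_intros)

text \<open>On the edge a hinge has divisor \<open>(c) - (l)\<close>. Every function on an edge is a
  combination of a constant, the identity and hinges, so orders are computed from these
  cases.\<close>

lemma slope_sum_hinge:
  assumes "0 < l" "0 \<le> c" "c \<le> l" "0 \<le> t" "t \<le> l"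
  shows "slope_sum l (\<lambda>x. max 0 (x - c)) t = of_bool (t = c) - of_bool (t = l)"
proof -
  let ?f = "\<lambda>x::real. max 0 (x - c)"
  have g: "has_slope (\<lambda>x. x - c) t 1 1" "has_slope (\<lambda>x. x - c) t (-1) (-1)"
    unfolding has_slope_def by auto
  have "the_slope ?f t 1 = (if t \<ge> c then 1 else 0)"
    using the_slopeI[OF has_slope_max[OF has_slope_const[of 0] g(1)]] by auto
  moreover have "the_slope ?f t (-1) = (if t > c then -1 else 0)"
    using the_slopeI[OF has_slope_max[OF has_slope_const[of 0] g(2)]] by auto
  ultimately show ?thesis unfolding slope_sum_def using assms by auto
qed

subsection \<open>Piecewise linear functions\<close>

text \<open>A normal form: \<open>s\<close> is the initial slope and \<open>J c\<close> is the
  change of slope at the break point \<open>c\<close>.\<close>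

definition piecewise_linear :: "real \<Rightarrow> real \<Rightarrow> (real \<Rightarrow> real) \<Rightarrow> bool" where
  "piecewise_linear a b \<phi> \<longleftrightarrow> (\<exists>(s::int) (J::real \<Rightarrow> int) C \<beta>. finite C \<and> C \<subseteq> {a<..<b} \<and>
     (\<forall>t\<in>{a..b}. \<phi> t = \<beta> + of_int s * t + (\<Sum>c\<in>C. of_int (J c) * max 0 (t - c))))"

lemma piecewise_linear_trans:
  assumes "piecewise_linear a b \<phi>" "piecewise_linear b c \<phi>" "a \<le> b" "b \<le> c"
  shows "piecewise_linear a c \<phi>"
proof (cases "a = b \<or> b = c")
  case True
  then show ?thesis using assms by auto
next
  case False
  then have ab: "a < b" "b < c" using assms by auto
  obtain s J C \<beta> where 1: "finite C" "C \<subseteq> {a<..<b}"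
      "\<And>t. t\<in>{a..b} \<Longrightarrow> \<phi> t = \<beta> + of_int s * t + (\<Sum>c\<in>C. of_int (J c :: int) * max 0 (t - c))"
    using assms(1) unfolding piecewise_linear_def by metis
  obtain s' J' C' \<beta>' where 2: "finite C'" "C' \<subseteq> {b<..<c}"
      "\<And>t. t\<in>{b..c} \<Longrightarrow> \<phi> t = \<beta>' + of_int s' * t + (\<Sum>c\<in>C'. of_int (J' c :: int) * max 0 (t - c))"
    using assms(2) unfolding piecewise_linear_def by metis
  define \<sigma> where "\<sigma> = s + sum J C"
  \<comment> \<open>The left piece arrives at \<open>b\<close> with slope \<open>\<sigma>\<close>
    and the right piece starts with slope \<open>s'\<close>; the jump at \<open>b\<close> is their
    difference.\<close>
  define K where "K x = (if x \<in> C then J x else if x = b then s' - \<sigma> else J' x)" for x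
  define h where "h t x = of_int (K x) * max 0 (t - x)" for t x
  have disj: "C \<inter> C' = {}" "b \<notin> C" "b \<notin> C'" using 1(2) 2(2) by force+
  have S: "(\<Sum>x\<in>insert b (C \<union> C'). h t x) = (\<Sum>x\<in>C. of_int (J x) * max 0 (t - x))
      + of_int (s' - \<sigma>) * max 0 (t - b) + (\<Sum>x\<in>C'. of_int (J' x) * max 0 (t - x))" for t
  proof -
    have "(\<Sum>x\<in>insert b (C \<union> C'). h t x) = h t b + (\<Sum>x\<in>C. h t x) + (\<Sum>x\<in>C'. h t x)"
      using 1(1) 2(1) disj by (simp add: sum.union_disjoint)
    moreover have "(\<Sum>x\<in>C. h t x) = (\<Sum>x\<in>C. of_int (J x) * max 0 (t - x))"
      by (rule sum.cong) (auto simp: h_def K_def)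
    moreover have "(\<Sum>x\<in>C'. h t x) = (\<Sum>x\<in>C'. of_int (J' x) * max 0 (t - x))"
      using disj by (intro sum.cong) (auto simp: h_def K_def)
    ultimately show ?thesis using disj by (simp add: h_def K_def)
  qed
  have lin: "(\<Sum>x\<in>C. of_int (J x) * max 0 (t - x)) = (\<Sum>x\<in>C. of_int (J x) * (max 0 (b - x))) + of_int (sum J C) * (t - b)"
    if "t \<ge> b" for t
  proof -
    have "(\<Sum>x\<in>C. of_int (J x) * max 0 (t - x)) = (\<Sum>x\<in>C. of_int (J x) * (max 0 (b - x)) + of_int (J x) * (t - b))"
      using 1(2) that by (intro sum.cong) (force simp: algebra_simps max_def)+
    then show ?thesis by (simp add: sum.distrib sum_distrib_right of_int_sum)
  qed
  have "\<phi> t = \<beta> + of_int s * t + (\<Sum>x\<in>insert b (C \<union> C'). h t x)" if t: "t \<in> {a..c}" for t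
  proof (cases "t \<le> b")
    case True
    have "(\<Sum>x\<in>C'. of_int (J' x) * max 0 (t - x)) = 0"
      using 2(2) True by (intro sum.neutral) force
    then show ?thesis unfolding S using 1(3)[of t] True t by simp
  next
    case False
    have z: "(\<Sum>x\<in>C'. of_int (J' x) * max 0 (b - x)) = 0"
      using 2(2) by (intro sum.neutral) force
    have e1: "\<phi> b = \<beta> + of_int s * b + (\<Sum>x\<in>C. of_int (J x) * (max 0 (b - x)))"
      using 1(3)[of b] ab by simp
    have e2: "\<phi> b = \<beta>' + of_int s' * b" using 2(3)[of b] ab z by simp
    have e3: "\<phi> t = \<beta>' + of_int s' * t + (\<Sum>x\<in>C'. of_int (J' x) * max 0 (t - x))"
      using 2(3)[of t] t False by simp
    have m: "max 0 (t - b) = t - b" using False by simp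
    show ?thesis unfolding S m using e1 e2 e3 lin[of t] False
      by (simp add: \<sigma>_def algebra_simps)
  qed
  moreover have "finite (insert b (C \<union> C'))" "insert b (C \<union> C') \<subseteq> {a<..<c}"
    using 1 2 ab by auto
  ultimately show ?thesis unfolding piecewise_linear_def h_def by blast
qed

lemma piecewise_linear_linear: "(\<And>t. t \<in> {a..b} \<Longrightarrow> \<phi> t = \<beta> + of_int s * t) \<Longrightarrow> piecewise_linear a b \<phi>"
  unfolding piecewise_linear_def by (rule exI[of _ s], rule exI, rule exI[of _ "{}"], rule exI[of _ \<beta>]) auto

text \<open>The two one-sided slopes at a point give a piecewise linear neighbourhood, and such
  intervals can be joined; the bisection principle \<open>Bolzano\<close> extends this to all of
  \<open>{0..l}\<close>.\<close>

lemma locally_linear_imp_piecewise_linear: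
  assumes "locally_linear l \<phi>" "0 \<le> l" shows "piecewise_linear 0 l \<phi>"
proof -
  have "0 \<le> (0::real) \<longrightarrow> l \<le> l \<longrightarrow> piecewise_linear 0 l \<phi>"
    using assms(2)
  proof (rule Bolzano[where P = "\<lambda>a b. 0 \<le> a \<longrightarrow> b \<le> l \<longrightarrow> piecewise_linear a b \<phi>"])
    show "0 \<le> a \<longrightarrow> c \<le> l \<longrightarrow> piecewise_linear a c \<phi>"
      if "0 \<le> a \<longrightarrow> b \<le> l \<longrightarrow> piecewise_linear a b \<phi>" "0 \<le> b \<longrightarrow> c \<le> l \<longrightarrow> piecewise_linear b c \<phi>" "a \<le> b" "b \<le> c" for a b c
      using that piecewise_linear_trans[of a b \<phi> c] by auto
  next
    fix x assume local: "0 \<le> x" "x \<le> l"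
    obtain d1 where d1: "d1 > 0" "\<And>d. 0 < x \<Longrightarrow> 0 \<le> d \<Longrightarrow> d \<le> d1 \<Longrightarrow> piecewise_linear (x - d) x \<phi>"
    proof (cases "0 < x")
      case True
      then obtain m where "has_slope \<phi> x (-1) m" using assms(1) local unfolding locally_linear_def valid_dir_def by blast
      then obtain d where d: "d>0" "\<forall>h\<in>{0..d}. \<phi> (x + (-1) * h) = \<phi> x + of_int m * h"
        unfolding has_slope_ex by blast
      have *: "piecewise_linear (x - e) x \<phi>" if "0 \<le> e" "e \<le> d" for e
      proof (rule piecewise_linear_linear[where s = "-m" and \<beta> = "\<phi> x + m * x"])
        fix t assume "t \<in> {x - e..x}"
        then show "\<phi> t = \<phi> x + real_of_int m * x + real_of_int (- m) * t"
          using d(2)[rule_format, of "x - t"] that by (auto simp: algebra_simps)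
      qed
      show ?thesis using that[of d] d(1) * by blast
    next
      case False then show ?thesis using that[of 1] by auto
    qed
    obtain d2 where d2: "d2 > 0" "\<And>d. x < l \<Longrightarrow> 0 \<le> d \<Longrightarrow> d \<le> d2 \<Longrightarrow> piecewise_linear x (x + d) \<phi>"
    proof (cases "x < l")
      case True
      then obtain m where "has_slope \<phi> x 1 m" using assms(1) local unfolding locally_linear_def valid_dir_def by blast
      then obtain d where d: "d>0" "\<forall>h\<in>{0..d}. \<phi> (x + 1 * h) = \<phi> x + of_int m * h"
        unfolding has_slope_ex by blast
      have *: "piecewise_linear x (x + e) \<phi>" if "0 \<le> e" "e \<le> d" for e
      proof (rule piecewise_linear_linear[where s = "m" and \<beta> = "\<phi> x - m * x"])
        fix t assume "t \<in> {x..x + e}"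
        then show "\<phi> t = \<phi> x - real_of_int m * x + real_of_int m * t"
          using d(2)[rule_format, of "t - x"] that by (auto simp: algebra_simps)
      qed
      show ?thesis using that[of d] d(1) * by blast
    next
      case False then show ?thesis using that[of 1] by auto
    qed
    have pt: "piecewise_linear x x \<phi>" by (rule piecewise_linear_linear[where s = 0 and \<beta> = "\<phi> x"]) auto
    have pab: "piecewise_linear a b \<phi>" if "a \<le> x" "x \<le> b" "b - a < min d1 d2" "0 \<le> a" "b \<le> l" for a b
    proof (rule piecewise_linear_trans[of a x])
      show "piecewise_linear a x \<phi>" using d1(2)[of "x - a"] d1(1) that pt by (cases "a = x") auto
      show "piecewise_linear x b \<phi>" using d2(2)[of "b - x"] d2(1) that pt by (cases "b = x") auto
    qed (use that in auto)
    then show "\<exists>d>0. \<forall>a b. a \<le> x \<and> x \<le> b \<and> b - a < d \<longrightarrow> 0 \<le> a \<longrightarrow> b \<le> l \<longrightarrow> piecewise_linear a b \<phi>"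
      using d1(1) d2(1) by (intro exI[of _ "min d1 d2"]) auto
  qed
  then show ?thesis by simp
qed

lemma locally_linear_continuous: assumes "locally_linear l \<phi>" "0 \<le> l" shows "continuous_on {0..l} \<phi>"
proof -
  obtain s J C \<beta> where 1: "\<And>t. t\<in>{0..l} \<Longrightarrow> \<phi> t = \<beta> + of_int s * t + (\<Sum>c\<in>C. of_int (J c :: int) * max 0 (t - c))"
    using locally_linear_imp_piecewise_linear[OF assms] unfolding piecewise_linear_def by metis
  have "continuous_on {0..l} (\<lambda>t. \<beta> + of_int s * t + (\<Sum>c\<in>C. of_int (J c :: int) * max 0 (t - c)))"
    by (intro continuous_intros)
  then show ?thesis by (rule continuous_on_eq) (use 1 in auto)
qed

lemma slope_sum_rep:
  assumes "0 < l" "finite C" "C \<subseteq> {0<..<l}" "0 \<le> t" "t \<le> l"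
    and "\<And>t. t\<in>{0..l} \<Longrightarrow> \<phi> t = \<beta> + of_int s * t + (\<Sum>c\<in>C. of_int (J c :: int) * max 0 (t - c))"
  shows "slope_sum l \<phi> t = s * (of_bool (t = 0) - of_bool (t = l))
     + (\<Sum>c\<in>C. J c * (of_bool (t = c) - of_bool (t = l)))"
proof -
  have L: "locally_linear l (\<lambda>t. of_int (J c) * max 0 (t - c))" for c by (intro locally_linear_intros)
  have "slope_sum l \<phi> t = slope_sum l (\<lambda>t. (\<beta> + of_int s * t) + (\<Sum>c\<in>C. of_int (J c) * max 0 (t - c))) t"
    by (rule slope_sum_cong) (use assms in auto)
  also have "\<dots> = slope_sum l (\<lambda>t. \<beta> + of_int s * t) t + (\<Sum>c\<in>C. slope_sum l (\<lambda>t. of_int (J c) * max 0 (t - c)) t)"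
    using assms(4,5) by (subst slope_sum_add) (auto intro!: locally_linear_intros simp: slope_sum_sum[OF L])
  also have "slope_sum l (\<lambda>t. \<beta> + of_int s * t) t = s * (of_bool (t = 0) - of_bool (t = l))"
    using assms(1,4,5) by (subst slope_sum_add) (auto intro!: locally_linear_intros simp: slope_sum_const slope_sum_cmult[OF locally_linear_id] slope_sum_id)
  also have "(\<Sum>c\<in>C. slope_sum l (\<lambda>t. of_int (J c) * max 0 (t - c)) t) = (\<Sum>c\<in>C. J c * (of_bool (t = c) - of_bool (t = l)))"
    by (rule sum.cong) (use assms in \<open>auto simp: slope_sum_cmult[OF locally_linear_hinge] slope_sum_hinge subset_iff\<close>)
  finally show ?thesis .
qed

text \<open>A function on an edge is recovered from its value at 0 and its orders. The slope
  arriving at \<open>l\<close> is the initial slope plus all jumps, so the orders on one edge add up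
  to 0.\<close>

lemma locally_linear_slope_sum_rep:
  assumes "locally_linear l \<phi>" "0 < l"
  obtains C where "finite C" "C \<subseteq> {0<..<l}"
    "\<And>t. 0 < t \<Longrightarrow> t < l \<Longrightarrow> t \<notin> C \<Longrightarrow> slope_sum l \<phi> t = 0"
    "slope_sum l \<phi> l = - slope_sum l \<phi> 0 - (\<Sum>c\<in>C. slope_sum l \<phi> c)"
    "\<And>t. t \<in> {0..l} \<Longrightarrow> \<phi> t = \<phi> 0 + of_int (slope_sum l \<phi> 0) * t + (\<Sum>c\<in>C. of_int (slope_sum l \<phi> c) * max 0 (t - c))"
proof -
  obtain s J C \<beta> where C: "finite C" "C \<subseteq> {0<..<l}" and
    1: "\<And>t. t\<in>{0..l} \<Longrightarrow> \<phi> t = \<beta> + of_int s * t + (\<Sum>c\<in>C. of_int (J c :: int) * max 0 (t - c))"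
    using locally_linear_imp_piecewise_linear[OF assms(1)] assms(2) unfolding piecewise_linear_def by (metis less_imp_le)
  note j = slope_sum_rep[OF assms(2) C _ _ 1]
  have j0: "slope_sum l \<phi> 0 = s"
  proof -
    have "(\<Sum>c\<in>C. J c * (of_bool (0 = c) - of_bool (0 = l))) = 0"
      using C(2) assms(2) by (intro sum.neutral) force
    then show ?thesis using j[of 0] assms(2) by simp
  qed
  have jt: "slope_sum l \<phi> t = (\<Sum>c\<in>C. if t = c then J c else 0)" if "0 < t" "t < l" for t
  proof -
    have "(\<Sum>c\<in>C. J c * (of_bool (t = c) - of_bool (t = l))) = (\<Sum>c\<in>C. if t = c then J c else 0)"
      using that by (intro sum.cong) auto
    then show ?thesis using j[of t] that by simp
  qed
  have jc: "slope_sum l \<phi> c = J c" if "c \<in> C" for c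
    using jt[of c] that C by (auto simp: sum.delta)
  have jl: "slope_sum l \<phi> l = - s - sum J C"
  proof -
    have "(\<Sum>c\<in>C. J c * (of_bool (l = c) - of_bool (l = l))) = (\<Sum>c\<in>C. - J c)"
      using C(2) by (intro sum.cong) force+
    then show ?thesis using j[of l] assms(2) by (simp add: sum_negf)
  qed
  have b: "\<beta> = \<phi> 0"
  proof -
    have "(\<Sum>c\<in>C. of_int (J c) * max 0 (0 - c)) = 0"
      using C(2) assms(2) by (intro sum.neutral) force
    then show ?thesis using 1[of 0] assms(2) by simp
  qed
  show thesis
  proof (rule that[OF C])
    show "slope_sum l \<phi> t = 0" if "0 < t" "t < l" "t \<notin> C" for t
      unfolding jt[OF that(1,2)] using that(3) by (intro sum.neutral) auto
    show "slope_sum l \<phi> l = - slope_sum l \<phi> 0 - (\<Sum>c\<in>C. slope_sum l \<phi> c)"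
      unfolding jl j0 using jc by (simp cong: sum.cong)
    show "\<phi> t = \<phi> 0 + of_int (slope_sum l \<phi> 0) * t + (\<Sum>c\<in>C. of_int (slope_sum l \<phi> c) * max 0 (t - c))" if "t \<in> {0..l}" for t
      using 1[OF that] jc unfolding j0 b by (simp cong: sum.cong)
  qed
qed

lemma piecewise_imp_locally_linear:
  assumes "finite B" and
    "\<And>a b. 0 \<le> a \<Longrightarrow> a < b \<Longrightarrow> b \<le> l \<Longrightarrow> {a<..<b} \<inter> B = {} \<Longrightarrow>
           \<exists>(m::int) c. \<forall>t\<in>{a..b}. \<phi> t = of_int m * t + c"
  shows "locally_linear l \<phi>"
  unfolding locally_linear_def
proof (intro allI impI)
  fix t s assume "valid_dir l t s"
  then consider "s = 1" "0 \<le> t" "t < l" | "s = -1" "0 < t" "t \<le> l" unfolding valid_dir_def by blast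
  then show "\<exists>m. has_slope \<phi> t s m"
  proof cases
    case 1
    define b where "b = Min (insert l {x\<in>B. t < x})"
    have b: "t < b" "b \<le> l" "{t<..<b} \<inter> B = {}"
      using 1 assms(1) unfolding b_def by (auto simp: not_less)
    obtain m c where m: "\<forall>t\<in>{t..b}. \<phi> t = of_int m * t + c" using assms(2)[OF 1(2) b] by blast
    have "has_slope \<phi> t s m" unfolding has_slope_ex
      using b m 1 by (intro exI[of _ "b - t"]) (auto simp: algebra_simps)
    then show ?thesis ..
  next
    case 2
    define b where "b = Max (insert 0 {x\<in>B. x < t})"
    have b: "0 \<le> b" "b < t" "{b<..<t} \<inter> B = {}"
      using 2 assms(1) unfolding b_def by (auto simp: not_less)
    obtain m c where m: "\<forall>t\<in>{b..t}. \<phi> t = of_int m * t + c" using assms(2)[OF b(1,2) 2(3) b(3)] by blast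
    have "has_slope \<phi> t s (-m)" unfolding has_slope_ex
      using b m 2 by (intro exI[of _ "t - b"]) (auto simp: algebra_simps)
    then show ?thesis ..
  qed
qed

lemma locally_linear_imp_piecewise:
  assumes "locally_linear l \<phi>" "0 \<le> l"
  shows "\<exists>B. finite B \<and> (\<forall>a b. 0 \<le> a \<and> a < b \<and> b \<le> l \<and> {a<..<b} \<inter> B = {} \<longrightarrow>
           (\<exists>(m::int) c. \<forall>t\<in>{a..b}. \<phi> t = of_int m * t + c))"
proof -
  obtain s J C \<beta> where C: "finite C" and
    1: "\<And>t. t\<in>{0..l} \<Longrightarrow> \<phi> t = \<beta> + of_int s * t + (\<Sum>c\<in>C. of_int (J c :: int) * max 0 (t - c))"
    using locally_linear_imp_piecewise_linear[OF assms] unfolding piecewise_linear_def by metis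
  show ?thesis
  proof (intro exI[of _ C] conjI allI impI C)
    fix a b assume ab: "0 \<le> a \<and> a < b \<and> b \<le> l \<and> {a<..<b} \<inter> C = {}"
    define K where "K c = (if c \<le> a then J c else 0)" for c
    have "\<phi> t = of_int (s + sum K C) * t + (\<beta> - (\<Sum>c\<in>C. of_int (K c) * c))" if t: "t \<in> {a..b}" for t
    proof -
      have "of_int (J c) * max 0 (t - c) = of_int (K c) * t - of_int (K c) * c" if "c \<in> C" for c
      proof (cases "c \<le> a")
        case True then show ?thesis using t by (auto simp: K_def algebra_simps)
      next
        case False
        then have "b \<le> c" using ab that by force
        then show ?thesis using t False by (auto simp: K_def)
      qed
      then have "(\<Sum>c\<in>C. of_int (J c) * max 0 (t - c)) = (\<Sum>c\<in>C. of_int (K c) * t - of_int (K c) * c)"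
        by (intro sum.cong) auto
      also have "\<dots> = of_int (sum K C) * t - (\<Sum>c\<in>C. of_int (K c) * c)"
        by (simp add: sum_subtractf sum_distrib_right)
      finally show ?thesis using 1[of t] t ab by (simp add: algebra_simps)
    qed
    then show "\<exists>(m::int) c. \<forall>t\<in>{a..b}. \<phi> t = of_int m * t + c" by blast
  qed
qed

section \<open>Points of the curve and rational functions\<close>

locale tcurve =
  fixes G :: "('v::finite) model"
  assumes tc: "tropical_curve G"
begin

abbreviation L :: "'v \<times> 'v \<Rightarrow> real" where "L \<equiv> edge_length G"
abbreviation pt :: "'v \<times> 'v \<Rightarrow> real \<Rightarrow> real^'v" where "pt \<equiv> edge_point G"
abbreviation vx :: "'v \<Rightarrow> real^'v" where "vx v \<equiv> axis v 1"

definition params :: "real^'v \<Rightarrow> (('v \<times> 'v) \<times> real) set" where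
  "params x = {(e, t). e \<in> edges G \<and> 0 \<le> t \<and> t \<le> L e \<and> pt e t = x}"

lemma L_pos: "e \<in> edges G \<Longrightarrow> 0 < L e"
  using tc unfolding tropical_curve_def by blast

lemma edge_neq: "e \<in> edges G \<Longrightarrow> fst e \<noteq> snd e"
  using tc unfolding tropical_curve_def by (metis prod.collapse)

lemma edge_flip: "(u, w) \<in> edges G \<Longrightarrow> (w, u) \<notin> edges G"
  using tc unfolding tropical_curve_def by blast

lemma vx_inj: "vx u = vx w \<longleftrightarrow> u = w"
  by (simp add: axis_eq_axis)

lemma pt_nth: "e \<in> edges G \<Longrightarrow>
   pt e t $ i = (if i = fst e then 1 - t / L e else if i = snd e then t / L e else 0)"
  using edge_neq[of e] unfolding edge_point_def by (auto simp: axis_def)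

lemma pt_0: "e \<in> edges G \<Longrightarrow> pt e 0 = vx (fst e)"
  unfolding edge_point_def by simp
lemma pt_L: "e \<in> edges G \<Longrightarrow> pt e (L e) = vx (snd e)"
  unfolding edge_point_def using L_pos[of e] by simp

text \<open>The coordinate at the head of the edge is linear in the parameter, which provides a
  continuous inverse of the parametrization.\<close>

lemma pt_param: "e \<in> edges G \<Longrightarrow> t = L e * pt e t $ snd e"
  using pt_nth[of e t "snd e"] edge_neq[of e] L_pos[of e] by (auto split: if_splits)

lemma pt_inj: "e \<in> edges G \<Longrightarrow> pt e t = pt e t' \<Longrightarrow> t = t'"
  using pt_param by metis

text \<open>Both end coordinates of an interior point are nonzero, so its edge is known as an
  unordered pair of vertices; since no edge occurs with both orientations, the edge itself is
  known.\<close>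

lemma pt_interior_eq:
  assumes "e \<in> edges G" "e' \<in> edges G" "0 < t" "t < L e" "0 \<le> t'" "t' \<le> L e'" "pt e t = pt e' t'"
  shows "e = e' \<and> t = t'"
proof -
  have nz: "1 - t / L e > 0" "t / L e > 0" using assms L_pos by auto
  have supp: "pt e t $ i \<noteq> 0 \<Longrightarrow> i = fst e' \<or> i = snd e'" for i
    unfolding assms(7) pt_nth[OF assms(2)] by (auto split: if_splits)
  have "pt e t $ fst e \<noteq> 0" "pt e t $ snd e \<noteq> 0"
    using nz edge_neq[OF assms(1)] unfolding pt_nth[OF assms(1)] by auto
  then have "fst e = fst e' \<or> fst e = snd e'" "snd e = fst e' \<or> snd e = snd e'" using supp by auto
  then have "e = e' \<or> (fst e = snd e' \<and> snd e = fst e')"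
    using edge_neq[OF assms(1)] by (metis prod.collapse)
  then have "e = e'" using edge_flip[of "fst e" "snd e"] assms(1,2) by (metis prod.collapse)
  then show ?thesis using pt_inj assms by metis
qed

lemma pt_vertex:
  assumes "e \<in> edges G" "0 \<le> t" "t \<le> L e" "pt e t = vx v"
  shows "t = 0 \<and> v = fst e \<or> t = L e \<and> v = snd e"
proof -
  consider "t = 0" | "t = L e" | "0 < t" "t < L e" using assms by linarith
  then show ?thesis
  proof cases
    case 3
    have "pt e t $ fst e \<noteq> 0" "pt e t $ snd e \<noteq> 0"
      using 3 assms(1) L_pos[OF assms(1)] edge_neq[OF assms(1)] unfolding pt_nth[OF assms(1)] by auto
    then show ?thesis using assms(4) edge_neq[OF assms(1)] by (auto simp: axis_def split: if_splits)
  qed (use assms pt_0 pt_L vx_inj in auto)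
qed

lemma pt_curve: "e \<in> edges G \<Longrightarrow> 0 \<le> t \<Longrightarrow> t \<le> L e \<Longrightarrow> pt e t \<in> curve G"
  unfolding curve_def by (intro UnI2 UN_I[of e]) auto
lemma vx_curve: "vx v \<in> curve G" unfolding curve_def by auto

lemma curve_cases:
  assumes "x \<in> curve G"
  obtains (vertex) v where "x = vx v"
    | (interior) e t where "e \<in> edges G" "0 < t" "t < L e" "x = pt e t"
proof -
  consider v where "x = vx v" | e t where "e \<in> edges G" "0 \<le> t" "t \<le> L e" "x = pt e t"
    using assms unfolding curve_def by auto
  then show thesis
  proof cases
    case 1 then show ?thesis using vertex by blast
  next
    case (2 e t)
    then show ?thesis using vertex pt_0 pt_L interior by (metis less_eq_real_def)
  qed
qed

lemma finite_edges: "finite (edges G)" by simp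

lemma finite_params: "finite (params x)"
proof -
  have "params x \<subseteq> (\<lambda>e. (e, L e * x $ snd e)) ` edges G"
    unfolding params_def using pt_param by auto
  then show ?thesis using finite_edges finite_surj by blast
qed

lemma params_interior: "e \<in> edges G \<Longrightarrow> 0 < t \<Longrightarrow> t < L e \<Longrightarrow> params (pt e t) = {(e, t)}"
  unfolding params_def using pt_interior_eq[of e] by (auto, metis+)

lemma params_vertex: "params (vx v) = (\<lambda>e. (e, 0)) ` {e\<in>edges G. fst e = v} \<union> (\<lambda>e. (e, L e)) ` {e\<in>edges G. snd e = v}"
proof (intro equalityI subsetI)
  fix k assume "k \<in> params (vx v)"
  then obtain e t where k: "k = (e, t)" "e \<in> edges G" "0 \<le> t" "t \<le> L e" "pt e t = vx v"
    unfolding params_def by auto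
  then show "k \<in> (\<lambda>e. (e, 0)) ` {e\<in>edges G. fst e = v} \<union> (\<lambda>e. (e, L e)) ` {e\<in>edges G. snd e = v}"
    using pt_vertex[OF k(2-5)] by auto
qed (use pt_0 pt_L L_pos in \<open>auto simp: params_def less_imp_le\<close>)

lemma params_off_curve: "x \<notin> curve G \<Longrightarrow> params x = {}"
  unfolding params_def using pt_curve by auto

lemma directions_iff: "(e, t, s) \<in> directions G x \<longleftrightarrow> e \<in> edges G \<and> valid_dir (L e) t s \<and> pt e t = x"
  unfolding directions_def valid_dir_def by auto

lemma outgoing_slope_eq: "outgoing_slope G f (e, t, s) = the_slope (\<lambda>t. f (pt e t)) t s"
  unfolding outgoing_slope_def the_slope_def has_slope_def by simp

lemma directions_eq: "directions G x = (\<lambda>(e,t). (e,t,1)) ` {(e,t)\<in>params x. t < L e} \<union> (\<lambda>(e,t). (e,t,-1)) ` {(e,t)\<in>params x. 0 < t}"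
  unfolding directions_def params_def by (auto simp: image_iff)

lemma finite_directions: "finite (directions G x)"
proof -
  have "finite {(e,t)\<in>params x. t < L e}" "finite {(e,t)\<in>params x. 0 < t}"
    by (auto intro: finite_subset[OF _ finite_params[of x]])
  then show ?thesis unfolding directions_eq by blast
qed

lemma ord_eq: "ord G f x = (\<Sum>(e,t)\<in>params x. slope_sum (L e) (\<lambda>t. f (pt e t)) t)"
proof -
  define \<Phi> where "\<Phi> e = (\<lambda>t. f (pt e t))" for e
  let ?A = "{(e,t)\<in>params x. t < L e}" and ?B = "{(e,t)\<in>params x. 0 < t}"
  have fin: "finite ?A" "finite ?B" by (auto intro: finite_subset[OF _ finite_params[of x]])
  have i1: "inj_on (\<lambda>(e,t). (e,t,1::real)) ?A" and i2: "inj_on (\<lambda>(e,t). (e,t,-1::real)) ?B"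
    by (auto simp: inj_on_def)
  have d: "(\<lambda>(e,t). (e,t,1::real)) ` ?A \<inter> (\<lambda>(e,t). (e,t,-1::real)) ` ?B = {}" by auto
  have "ord G f x = (\<Sum>(e,t)\<in>?A. the_slope (\<Phi> e) t 1) + (\<Sum>(e,t)\<in>?B. the_slope (\<Phi> e) t (-1))"
    unfolding ord_def directions_eq
    by (subst sum.union_disjoint[OF _ _ d])
      (use fin in \<open>auto simp: sum.reindex[OF i1] sum.reindex[OF i2] outgoing_slope_eq \<Phi>_def intro!: arg_cong2[of _ _ _ _ "(+)"] sum.cong\<close>)
  also have "(\<Sum>(e,t)\<in>?A. the_slope (\<Phi> e) t 1) = (\<Sum>(e,t)\<in>params x. if t < L e then the_slope (\<Phi> e) t 1 else 0)"
    by (rule sum.mono_neutral_cong_left) (use finite_params in \<open>auto split: if_splits\<close>)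
  also have "(\<Sum>(e,t)\<in>?B. the_slope (\<Phi> e) t (-1)) = (\<Sum>(e,t)\<in>params x. if 0 < t then the_slope (\<Phi> e) t (-1) else 0)"
    by (rule sum.mono_neutral_cong_left) (use finite_params in \<open>auto split: if_splits\<close>)
  also have "(\<Sum>(e,t)\<in>params x. if t < L e then the_slope (\<Phi> e) t 1 else 0) + (\<Sum>(e,t)\<in>params x. if 0 < t then the_slope (\<Phi> e) t (-1) else 0)
     = (\<Sum>(e,t)\<in>params x. slope_sum (L e) (\<Phi> e) t)"
    unfolding sum.distrib[symmetric] slope_sum_def by (intro sum.cong) auto
  finally show ?thesis unfolding \<Phi>_def .
qed

lemma glue_ex:
  fixes \<beta> :: "'v \<Rightarrow> 'a"
  assumes "\<And>e. e \<in> edges G \<Longrightarrow> \<phi> e 0 = \<beta> (fst e)" "\<And>e. e \<in> edges G \<Longrightarrow> \<phi> e (L e) = \<beta> (snd e)"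
  obtains f where "\<And>v. f (vx v) = \<beta> v" "\<And>e t. e \<in> edges G \<Longrightarrow> 0 \<le> t \<Longrightarrow> t \<le> L e \<Longrightarrow> f (pt e t) = \<phi> e t"
proof -
  define f where "f x = (if \<exists>v. x = vx v then \<beta> (THE v. x = vx v)
     else (let p = SOME p. p \<in> params x in \<phi> (fst p) (snd p)))" for x
  have v: "f (vx v) = \<beta> v" for v
  proof -
    have "(THE v'. vx v = vx v') = v" by (rule the_equality) (auto simp: vx_inj)
    then show ?thesis unfolding f_def by auto
  qed
  have "f (pt e t) = \<phi> e t" if "e \<in> edges G" "0 \<le> t" "t \<le> L e" for e t
  proof (cases "0 < t \<and> t < L e")
    case True
    then have "\<not> (\<exists>v. pt e t = vx v)" using pt_vertex that by fastforce
    moreover have "(SOME p. p \<in> params (pt e t)) = (e, t)"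
      using params_interior[OF that(1)] True by simp
    ultimately show ?thesis unfolding f_def by simp
  next
    case False
    then show ?thesis using v assms that pt_0 pt_L by (metis less_eq_real_def)
  qed
  then show thesis using that v by blast
qed

lemma pt_continuous: "continuous_on S (pt e)"
  unfolding edge_point_def by (cases "L e = 0") (auto intro!: continuous_intros)

lemma continuous_on_curve:
  fixes f :: "real^'v \<Rightarrow> 'a::topological_space"
  assumes "\<And>e. e \<in> edges G \<Longrightarrow> continuous_on {0..L e} (\<lambda>t. f (pt e t))"
  shows "continuous_on (curve G) f"
proof -
  have 1: "continuous_on (pt e ` {0..L e}) f" if "e \<in> edges G" for e
  proof -
    have "continuous_on (pt e ` {0..L e}) ((\<lambda>t. f (pt e t)) \<circ> (\<lambda>x. L e * x $ snd e))"
    proof (rule continuous_on_compose)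
      show "continuous_on (pt e ` {0..L e}) (\<lambda>x. L e * x $ snd e)" by (intro continuous_intros)
      have "(\<lambda>x. L e * x $ snd e) ` pt e ` {0..L e} \<subseteq> {0..L e}"
        using pt_param[OF that] by auto
      then show "continuous_on ((\<lambda>x. L e * x $ snd e) ` pt e ` {0..L e}) (\<lambda>t. f (pt e t))"
        using assms[OF that] continuous_on_subset by blast
    qed
    then show ?thesis
      by (rule continuous_on_eq) (use pt_param[OF that] in auto)
  qed
  have cl: "closed (pt e ` {0..L e})" for e
    by (intro compact_imp_closed compact_continuous_image pt_continuous compact_Icc)
  have "continuous_on (\<Union>e\<in>edges G. pt e ` {0..L e}) f"
    by (rule continuous_on_closed_Union) (use finite_edges cl 1 in auto)
  moreover have "continuous_on (range vx) f" by (rule continuous_on_finite) simp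
  ultimately show ?thesis unfolding curve_def
    by (intro continuous_on_closed_Un closed_UN) (use cl finite_edges in \<open>auto intro!: finite_imp_closed\<close>)
qed

lemma compact_curve: "compact (curve G)"
  unfolding curve_def
  by (rule compact_Un, rule finite_imp_compact, simp, rule compact_UN)
    (auto simp del: box_real intro!: compact_continuous_image pt_continuous compact_Icc)

lemma closed_curve: "closed (curve G)" by (rule compact_imp_closed[OF compact_curve])

text \<open>Continuity is automatic: local linearity gives it along each closed edge, and the curve
  is covered by finitely many closed edges and the vertices.\<close>

lemma rational_iff: "rational_fun G f \<longleftrightarrow>
   f \<in> extensional (curve G) \<and> (\<forall>e\<in>edges G. locally_linear (L e) (\<lambda>t. f (pt e t)))"
proof
  assume "rational_fun G f"
  then show "f \<in> extensional (curve G) \<and> (\<forall>e\<in>edges G. locally_linear (L e) (\<lambda>t. f (pt e t)))"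
    unfolding rational_fun_def by (metis (no_types, lifting) piecewise_imp_locally_linear)
next
  assume *: "f \<in> extensional (curve G) \<and> (\<forall>e\<in>edges G. locally_linear (L e) (\<lambda>t. f (pt e t)))"
  then have "continuous_on (curve G) f"
    using L_pos by (intro continuous_on_curve locally_linear_continuous) (auto simp: less_imp_le)
  then show "rational_fun G f" unfolding rational_fun_def
    using * locally_linear_imp_piecewise L_pos by (simp add: less_imp_le)
qed

lemma rational_locally_linear: "rational_fun G f \<Longrightarrow> e \<in> edges G \<Longrightarrow> locally_linear (L e) (\<lambda>t. f (pt e t))"
  unfolding rational_iff by blast

lemma rational_cont: "rational_fun G f \<Longrightarrow> continuous_on (curve G) f"
  unfolding rational_fun_def by blast

lemma rational_glue:
  assumes "\<And>e. e \<in> edges G \<Longrightarrow> \<phi> e 0 = \<beta> (fst e)" "\<And>e. e \<in> edges G \<Longrightarrow> \<phi> e (L e) = \<beta> (snd e)"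
    "\<And>e. e \<in> edges G \<Longrightarrow> locally_linear (L e) (\<phi> e)"
  obtains f where "rational_fun G f" "\<And>v. f (vx v) = \<beta> v"
     "\<And>e t. e \<in> edges G \<Longrightarrow> 0 \<le> t \<Longrightarrow> t \<le> L e \<Longrightarrow> f (pt e t) = \<phi> e t"
proof -
  obtain f where f: "\<And>v. f (vx v) = \<beta> v" "\<And>e t. e \<in> edges G \<Longrightarrow> 0 \<le> t \<Longrightarrow> t \<le> L e \<Longrightarrow> f (pt e t) = \<phi> e t"
    by (rule glue_ex[of \<phi> \<beta>]) (use assms in auto)
  let ?g = "restrict f (curve G)"
  have g: "?g (pt e t) = \<phi> e t" if "e \<in> edges G" "0 \<le> t" "t \<le> L e" for e t
    using f(2) pt_curve that by simp
  have "rational_fun G ?g" unfolding rational_iff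
    using g assms(3) by (intro conjI ballI restrict_extensional, intro locally_linear_cong[OF assms(3)]) auto
  then show thesis using that[of ?g] f(1) g vx_curve by simp
qed

lemma rational_comb:
  assumes "rational_fun G f" "rational_fun G g" "\<And>l \<phi> \<psi>. locally_linear l \<phi> \<Longrightarrow> locally_linear l \<psi> \<Longrightarrow> locally_linear l (\<lambda>t. F (\<phi> t) (\<psi> t))"
  shows "rational_fun G (\<lambda>x\<in>curve G. F (f x) (g x))"
  unfolding rational_iff
proof (intro conjI ballI)
  fix e assume e: "e \<in> edges G"
  show "locally_linear (L e) (\<lambda>t. (\<lambda>x\<in>curve G. F (f x) (g x)) (pt e t))"
    by (rule locally_linear_cong[OF assms(3)[OF rational_locally_linear[OF assms(1) e] rational_locally_linear[OF assms(2) e]]])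
      (use pt_curve[OF e] in auto)
qed auto

lemma rational_add: "rational_fun G f \<Longrightarrow> rational_fun G g \<Longrightarrow> rational_fun G (\<lambda>x\<in>curve G. f x + g x)"
  by (rule rational_comb) (auto intro: locally_linear_intros)
lemma rational_diff: "rational_fun G f \<Longrightarrow> rational_fun G g \<Longrightarrow> rational_fun G (\<lambda>x\<in>curve G. f x - g x)"
  by (rule rational_comb) (auto intro: locally_linear_intros)
lemma rational_max: "rational_fun G f \<Longrightarrow> rational_fun G g \<Longrightarrow> rational_fun G (\<lambda>x\<in>curve G. max (f x) (g x))"
  by (rule rational_comb) (auto intro: locally_linear_intros)
lemma rational_shift: "rational_fun G f \<Longrightarrow> rational_fun G (\<lambda>x\<in>curve G. f x + c)"
  by (rule rational_comb[of f f]) (auto intro: locally_linear_intros)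
lemma ord_slope_sum_cong:
  assumes "\<And>e t. e \<in> edges G \<Longrightarrow> 0 \<le> t \<Longrightarrow> t \<le> L e \<Longrightarrow> pt e t = x \<Longrightarrow> slope_sum (L e) (\<lambda>t. f (pt e t)) t = F e t"
  shows "ord G f x = (\<Sum>(e,t)\<in>params x. F e t)"
  unfolding ord_eq by (rule sum.cong) (auto simp: params_def assms)

lemma ord_add:
  assumes "rational_fun G f" "rational_fun G g"
  shows "ord G (\<lambda>x\<in>curve G. f x + g x) x = ord G f x + ord G g x"
proof -
  have "ord G (\<lambda>x\<in>curve G. f x + g x) x = (\<Sum>(e,t)\<in>params x. slope_sum (L e) (\<lambda>t. f (pt e t)) t + slope_sum (L e) (\<lambda>t. g (pt e t)) t)"
  proof (rule ord_slope_sum_cong)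
    fix e t assume e: "e \<in> edges G" "0 \<le> t" "t \<le> L e"
    have "slope_sum (L e) (\<lambda>t. (\<lambda>x\<in>curve G. f x + g x) (pt e t)) t = slope_sum (L e) (\<lambda>t. f (pt e t) + g (pt e t)) t"
      by (rule slope_sum_cong) (use e pt_curve in auto)
    then show "slope_sum (L e) (\<lambda>t. (\<lambda>x\<in>curve G. f x + g x) (pt e t)) t = slope_sum (L e) (\<lambda>t. f (pt e t)) t + slope_sum (L e) (\<lambda>t. g (pt e t)) t"
      using slope_sum_add[OF rational_locally_linear[OF assms(1) e(1)] rational_locally_linear[OF assms(2) e(1)] e(2,3)] by simp
  qed
  then show ?thesis unfolding ord_eq by (simp add: sum.distrib split_def)
qed

lemma ord_shift:
  shows "ord G (\<lambda>x\<in>curve G. f x + c) x = ord G f x"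
proof -
  have o: "the_slope (\<lambda>x. \<phi> x + c) t s = the_slope \<phi> t s" for \<phi> t s
    unfolding the_slope_def has_slope_def by (simp add: algebra_simps)
  have "ord G (\<lambda>x\<in>curve G. f x + c) x = (\<Sum>(e,t)\<in>params x. slope_sum (L e) (\<lambda>t. f (pt e t)) t)"
  proof (rule ord_slope_sum_cong)
    fix e t assume e: "e \<in> edges G" "0 \<le> t" "t \<le> L e"
    have "slope_sum (L e) (\<lambda>t. (\<lambda>x\<in>curve G. f x + c) (pt e t)) t = slope_sum (L e) (\<lambda>t. f (pt e t) + c) t"
      by (rule slope_sum_cong) (use e pt_curve in auto)
    then show "slope_sum (L e) (\<lambda>t. (\<lambda>x\<in>curve G. f x + c) (pt e t)) t = slope_sum (L e) (\<lambda>t. f (pt e t)) t"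
      unfolding slope_sum_def o by simp
  qed
  then show ?thesis unfolding ord_eq .
qed

lemma ord_diff:
  assumes "rational_fun G f" "rational_fun G g"
  shows "ord G (\<lambda>x\<in>curve G. f x - g x) x = ord G f x - ord G g x"
proof -
  have "(\<lambda>x\<in>curve G. (\<lambda>x\<in>curve G. f x - g x) x + g x) = f"
    using assms(1) unfolding rational_iff by (auto simp: extensional_def)
  then show ?thesis using ord_add[OF rational_diff[OF assms] assms(2), of x] by simp
qed

lemma ord_off_curve: "x \<notin> curve G \<Longrightarrow> ord G f x = 0"
  unfolding ord_eq by (simp add: params_off_curve)

lemma has_slope_dir:
  assumes "rational_fun G f" "(e, t, s) \<in> directions G x"
  shows "has_slope (\<lambda>t. f (pt e t)) t s (outgoing_slope G f (e, t, s))"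
  using assms has_slope_the_slope[OF rational_locally_linear] unfolding directions_iff outgoing_slope_eq by blast

text \<open>The sum is taken over parameters on edges instead of points of the curve; then every
  single edge contributes 0.\<close>

lemma ord_support_sum:
  assumes "rational_fun G f"
  shows "finite {x. ord G f x \<noteq> 0}" "(\<Sum>x | ord G f x \<noteq> 0. ord G f x) = 0"
proof -
  define J where "J = (\<lambda>(e,t). slope_sum (L e) (\<lambda>t. f (pt e t)) t)"
  have "\<forall>e\<in>edges G. \<exists>C. finite C \<and> C \<subseteq> {0<..<L e} \<and> (\<forall>t. 0 < t \<longrightarrow> t < L e \<longrightarrow> t \<notin> C \<longrightarrow> J (e,t) = 0) \<and>
    J (e, L e) = - J (e,0) - (\<Sum>c\<in>C. J (e,c))"
  proof
    fix e assume e: "e \<in> edges G"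
    define \<phi> where "\<phi> = (\<lambda>t. f (pt e t))"
    have l: "locally_linear (L e) \<phi>" unfolding \<phi>_def by (rule rational_locally_linear[OF assms e])
    have J: "J (e, t) = slope_sum (L e) \<phi> t" for t unfolding J_def \<phi>_def by simp
    obtain C where "finite C" "C \<subseteq> {0<..<L e}"
        "\<And>t. 0 < t \<Longrightarrow> t < L e \<Longrightarrow> t \<notin> C \<Longrightarrow> slope_sum (L e) \<phi> t = 0"
        "slope_sum (L e) \<phi> (L e) = - slope_sum (L e) \<phi> 0 - (\<Sum>c\<in>C. slope_sum (L e) \<phi> c)"
        "\<And>t. t \<in> {0..L e} \<Longrightarrow> \<phi> t = \<phi> 0 + of_int (slope_sum (L e) \<phi> 0) * t + (\<Sum>c\<in>C. of_int (slope_sum (L e) \<phi> c) * max 0 (t - c))"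
      by (rule locally_linear_slope_sum_rep[OF l L_pos[OF e]]) (rule that)
    then show "\<exists>C. finite C \<and> C \<subseteq> {0<..<L e} \<and> (\<forall>t. 0 < t \<longrightarrow> t < L e \<longrightarrow> t \<notin> C \<longrightarrow> J (e,t) = 0) \<and>
    J (e, L e) = - J (e,0) - (\<Sum>c\<in>C. J (e,c))" unfolding J by blast
  qed
  then obtain C where C: "\<And>e. e \<in> edges G \<Longrightarrow> finite (C e) \<and> C e \<subseteq> {0<..<L e} \<and>
    (\<forall>t. 0 < t \<longrightarrow> t < L e \<longrightarrow> t \<notin> C e \<longrightarrow> J (e,t) = 0) \<and> J (e, L e) = - J (e,0) - (\<Sum>c\<in>C e. J (e,c))"
    by metis
  \<comment> \<open>The break points together with both ends of every edge; the contribution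
    \<open>J\<close> vanishes at all other parameters.\<close>
  define K where "K = Sigma (edges G) (\<lambda>e. insert 0 (insert (L e) (C e)))"
  have finK: "finite K" unfolding K_def using C by auto
  have Ksub: "e \<in> edges G \<and> 0 \<le> t \<and> t \<le> L e" if "(e,t) \<in> K" for e t
    using that C[of e] L_pos[of e] unfolding K_def by force
  have "(\<Sum>t\<in>insert 0 (insert (L e) (C e)). J (e,t)) = 0" if e: "e \<in> edges G" for e
  proof -
    have "0 \<notin> insert (L e) (C e)" "L e \<notin> C e" using C[OF e] L_pos[OF e] by force+
    then show ?thesis using C[OF e] by simp
  qed
  then have "sum J K = 0" unfolding K_def using C by (subst sum.Sigma[symmetric, where g = "\<lambda>e t. J (e,t)", simplified]) auto
  moreover
  let ?p = "\<lambda>(e,t). pt e t"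
  have prK: "J k = 0" if "k \<in> params x" "k \<notin> K" for k x
  proof -
    obtain e t where k: "k = (e,t)" by (cases k)
    show ?thesis using that C[of e] unfolding k params_def K_def by auto
  qed
  have ordJ: "ord G f x = (\<Sum>k\<in>{k\<in>K. ?p k = x}. J k)" for x
  proof -
    have "ord G f x = sum J (params x)" unfolding ord_eq J_def ..
    also have "\<dots> = (\<Sum>k\<in>{k\<in>K. ?p k = x}. J k)"
      by (rule sum.mono_neutral_right[OF finite_params]) (use prK Ksub in \<open>auto simp: params_def\<close>)
    finally show ?thesis .
  qed
  have supp: "{x. ord G f x \<noteq> 0} \<subseteq> ?p ` K"
  proof
    fix x assume "x \<in> {x. ord G f x \<noteq> 0}"
    then have "{k\<in>K. ?p k = x} \<noteq> {}" unfolding ordJ by (metis (mono_tags, lifting) mem_Collect_eq sum.empty)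
    then show "x \<in> ?p ` K" by force
  qed
  then show "finite {x. ord G f x \<noteq> 0}" using finK finite_surj by blast
  have "(\<Sum>x | ord G f x \<noteq> 0. ord G f x) = (\<Sum>x\<in>?p ` K. ord G f x)"
    by (rule sum.mono_neutral_left) (use supp finK in auto)
  also have "\<dots> = sum J K" unfolding ordJ by (rule sum.image_gen[OF finK, symmetric])
  finally show "(\<Sum>x | ord G f x \<noteq> 0. ord G f x) = 0" using \<open>sum J K = 0\<close> by simp
qed

lemma is_divisor_add_div:
  assumes "is_divisor G D" "rational_fun G f"
  shows "is_divisor G (\<lambda>x. D x + ord G f x)"
proof -
  have "{x. D x + ord G f x \<noteq> 0} \<subseteq> {x. D x \<noteq> 0} \<union> {x. ord G f x \<noteq> 0}" by auto
  moreover have "{x. ord G f x \<noteq> 0} \<subseteq> curve G" using ord_off_curve by blast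
  ultimately show ?thesis using assms ord_support_sum(1)[OF assms(2)] unfolding is_divisor_def
    by (meson finite_UnI finite_subset le_sup_iff order_trans)
qed

lemma deg_add_div:
  assumes "is_divisor G D" "rational_fun G f"
  shows "deg (\<lambda>x. D x + ord G f x) = deg D"
proof -
  let ?A = "{x. D x \<noteq> 0} \<union> {x. ord G f x \<noteq> 0}"
  have fin: "finite ?A" using assms ord_support_sum(1) unfolding is_divisor_def by auto
  have "deg (\<lambda>x. D x + ord G f x) = (\<Sum>x\<in>?A. D x + ord G f x)"
    unfolding deg_def by (rule sum.mono_neutral_left[OF fin]) auto
  also have "\<dots> = (\<Sum>x\<in>?A. D x) + (\<Sum>x\<in>?A. ord G f x)" by (rule sum.distrib)
  also have "(\<Sum>x\<in>?A. D x) = deg D"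
    unfolding deg_def by (rule sum.mono_neutral_right[OF fin]) auto
  also have "(\<Sum>x\<in>?A. ord G f x) = (\<Sum>x | ord G f x \<noteq> 0. ord G f x)"
    by (rule sum.mono_neutral_right[OF fin]) auto
  finally show ?thesis using ord_support_sum(2)[OF assms(2)] by simp
qed


section \<open>Bump functions\<close>

text \<open>Along every edge one can pass between \<open>X\<close> and its complement only at points of \<open>W\<close>.\<close>

definition adapted :: "(real^'v) set \<Rightarrow> (real^'v) set \<Rightarrow> bool" where
  "adapted X W \<longleftrightarrow> (\<forall>e\<in>edges G. \<forall>a b t0. 0 \<le> a \<longrightarrow> b \<le> L e \<longrightarrow> a < t0 \<longrightarrow> t0 < b \<longrightarrow>
     (\<forall>t. a < t \<longrightarrow> t < b \<longrightarrow> pt e t \<notin> W) \<longrightarrow> pt e t0 \<in> X \<longrightarrow> (\<forall>t\<in>{a..b}. pt e t \<in> X))"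

lemma adaptedD:
  assumes "adapted X W" "e \<in> edges G" "0 \<le> a" "b \<le> L e" "a < t0" "t0 < b"
    "\<And>t. a < t \<Longrightarrow> t < b \<Longrightarrow> pt e t \<notin> W" "pt e t0 \<in> X" "t \<in> {a..b}"
  shows "pt e t \<in> X"
  using assms unfolding adapted_def by blast

lemma gap_in_direction:
  assumes "finite W" "e \<in> edges G" "valid_dir (L e) t s"
  shows "\<exists>d>0. \<forall>h\<in>{0<..d}. 0 < t + s * h \<and> t + s * h < L e \<and> pt e (t + s * h) \<notin> W"
proof -
  obtain d where d: "d > 0" "\<forall>h\<in>{0<..d}. 0 < t + s * h \<and> t + s * h < L e"
    using valid_dir_ev[OF assms(3)] by blast
  have s: "s \<noteq> 0" using assms(3) unfolding valid_dir_def by auto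
  define S where "S = {h. 0 < h \<and> pt e (t + s * h) \<in> W}"
  have "inj (\<lambda>h. pt e (t + s * h))"
    using pt_inj[OF assms(2)] s by (auto simp: inj_def dest!: pt_inj[OF assms(2)])
  then have "finite ((\<lambda>h. pt e (t + s * h)) -` W)" using assms(1) by (rule finite_vimageI[rotated])
  then have fin: "finite S" unfolding S_def by (rule finite_subset[rotated]) auto
  define d' where "d' = Min (insert d S) / 2"
  have m: "Min (insert d S) > 0" "Min (insert d S) \<le> d" using fin d(1) by (auto simp: S_def)
  have "h \<notin> S" if "h \<in> {0<..d'}" for h
  proof
    assume "h \<in> S"
    then have "Min (insert d S) \<le> h" using fin by simp
    then show False using that m unfolding d'_def by auto
  qed
  moreover have "0 < d'" "d' \<le> d" using m unfolding d'_def by auto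
  ultimately show ?thesis using d unfolding S_def by (intro exI[of _ d']) auto
qed

text \<open>A short piece of an edge contains no further point of \<open>W\<close>, so membership in
  \<open>X\<close> is constant along it.\<close>

lemma stays_or_leaves:
  assumes "finite W" "adapted X W" "range vx \<subseteq> W" "(e, t, s) \<in> directions G x" "x \<in> X"
  shows "(\<exists>d>0. \<forall>h\<in>{0<..d}. pt e (t + s * h) \<in> X) \<or>
     (x \<in> W \<and> (\<exists>d>0. \<forall>h\<in>{0<..d}. pt e (t + s * h) \<notin> X))"
proof -
  have e: "e \<in> edges G" "valid_dir (L e) t s" "pt e t = x" using assms(4) unfolding directions_iff by auto
  have s: "s = 1 \<or> s = -1" using e(2) unfolding valid_dir_def by auto
  obtain d where d: "d > 0" "\<forall>h\<in>{0<..d}. 0 < t + s * h \<and> t + s * h < L e \<and> pt e (t + s * h) \<notin> W"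
    using gap_in_direction[OF assms(1) e(1,2)] by blast
  show ?thesis
  proof (cases "\<exists>h0. 0 < h0 \<and> h0 < d \<and> pt e (t + s * h0) \<in> X")
    case True
    then obtain h0 where h0: "0 < h0" "h0 < d" "pt e (t + s * h0) \<in> X" by blast
    have "\<forall>u\<in>{min t (t + s * d)..max t (t + s * d)}. pt e u \<in> X"
    proof (intro ballI, rule adaptedD[OF assms(2) e(1), of "min t (t + s * d)" "max t (t + s * d)" "t + s * h0"])
      show "0 \<le> min t (t + s * d)" "max t (t + s * d) \<le> L e"
        using d valid_dir_range[OF e(2)] by (auto simp: less_imp_le)
      show "min t (t + s * d) < t + s * h0" "t + s * h0 < max t (t + s * d)"
        using s h0 by auto
      show "pt e u \<notin> W" if "min t (t + s * d) < u" "u < max t (t + s * d)" for u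
        using that s d(2)[rule_format, of "s * (u - t)"] d(1) by (auto simp: min_def max_def split: if_splits)
    qed (use h0 in auto)
    then have "\<forall>h\<in>{0<..d}. pt e (t + s * h) \<in> X" using s by (auto simp: min_def max_def)
    then show ?thesis using d(1) by blast
  next
    case False
    \<comment> \<open>Otherwise an interval around \<open>t\<close> is free of \<open>W\<close>. It
      contains the point \<open>x\<close> of \<open>X\<close>, so adaptedness puts the whole
      interval into \<open>X\<close>.\<close>
    have "x \<in> W"
    proof (rule ccontr)
      assume xW: "x \<notin> W"
      have "t \<noteq> 0" "t \<noteq> L e" using xW assms(3) pt_0[OF e(1)] pt_L[OF e(1)] e(3) by auto
      then have "valid_dir (L e) t (-s)" using e(2) unfolding valid_dir_def by auto
      then obtain d2 where d2: "d2 > 0" "\<forall>h\<in>{0<..d2}. 0 < t + (-s) * h \<and> t + (-s) * h < L e \<and> pt e (t + (-s) * h) \<notin> W"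
        using gap_in_direction[OF assms(1) e(1)] by blast
      define c where "c = min d d2"
      have c: "c > 0" "c \<le> d" "c \<le> d2" unfolding c_def using d d2 by auto
      have "\<forall>u\<in>{t - c..t + c}. pt e u \<in> X"
      proof (intro ballI, rule adaptedD[OF assms(2) e(1), of "t - c" "t + c" t])
        show "0 \<le> t - c" "t + c \<le> L e"
          using s d(2)[rule_format, of c] d2(2)[rule_format, of c] c by auto
        show "pt e u \<notin> W" if "t - c < u" "u < t + c" for u
          using that s d(2)[rule_format, of "s * (u - t)"] d2(2)[rule_format, of "- s * (u - t)"] c xW e(3)
          by (cases "u = t"; cases "u < t") auto
      qed (use c e assms(5) in auto)
      then have "pt e (t + s * (c/2)) \<in> X" using s c by auto
      then show False using False c by (metis half_gt_zero less_le_trans field_sum_of_halves less_add_same_cancel1)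
    qed
    moreover have "\<forall>h\<in>{0<..d/2}. pt e (t + s * h) \<notin> X" using False d(1) by auto
    ultimately show ?thesis using d(1) by (metis half_gt_zero)
  qed
qed

lemma closed_preimage:
  assumes "closed X" shows "closed {u. pt e u \<in> X}"
proof -
  have "continuous_on UNIV (pt e)" by (rule pt_continuous)
  then have "closed (pt e -` X)" using assms continuous_closed_vimage continuous_on_eq_continuous_at by blast
  then show ?thesis unfolding vimage_def .
qed

text \<open>This is the function that fires \<open>X\<close>: constant on \<open>X\<close>, then
  falling with slope -1 along every direction leaving \<open>X\<close> until it reaches 0.
  Directions leave \<open>X\<close> only at points of \<open>W\<close>. The last conclusion locates
  the points of intermediate height; it is used to count segments by the level sets of a
  tent.\<close>

lemma bump:
  assumes X: "closed X" "X \<subseteq> curve G" and W: "finite W" "adapted X W" "range vx \<subseteq> W"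
  obtains \<eta> b where "0 < \<eta>" "rational_fun G b" "\<And>x. x \<in> X \<Longrightarrow> b x = \<eta>"
     "\<And>x. x \<in> curve G - X \<Longrightarrow> 0 \<le> b x \<and> b x < \<eta>"
     "\<And>x. x \<in> W \<inter> curve G - X \<Longrightarrow> b x = 0"
     "\<And>x. x \<in> curve G - X \<Longrightarrow> 0 \<le> ord G b x"
     "\<And>x e t s. x \<in> X \<Longrightarrow> (e, t, s) \<in> directions G x \<Longrightarrow> outgoing_slope G b (e, t, s) = 0 \<or>
        (outgoing_slope G b (e, t, s) = -1 \<and> (\<exists>d>0. \<forall>h\<in>{0<..d}. pt e (t + s * h) \<notin> X))"
     "\<And>x. x \<in> curve G - X \<Longrightarrow> 0 < b x \<Longrightarrow>
        \<exists>v\<in>X. \<exists>e t s. (e, t, s) \<in> directions G v \<and> x = pt e (t + s * (\<eta> - b x))"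
proof -
  define We where "We e = {w\<in>{0..L e}. pt e w \<in> W}" for e
  define Ve where "Ve e = {w\<in>We e. pt e w \<in> X}" for e
  have finWe: "finite (We e)" if "e \<in> edges G" for e
  proof -
    have "inj (pt e)" using pt_inj[OF that] by (auto simp: inj_def)
    then have "finite (pt e -` W)" using W(1) by (rule finite_vimageI[rotated])
    then show ?thesis unfolding We_def by (rule finite_subset[rotated]) auto
  qed
  then have finVe: "finite (Ve e)" if "e \<in> edges G" for e
    unfolding Ve_def using that by auto
  define Z where "Z = (\<Union>e\<in>edges G. (\<lambda>(w,w'). \<bar>w - w'\<bar>) ` (We e \<times> We e)) - {0}"
  have finZ: "finite Z" unfolding Z_def using finWe finite_edges by auto
  \<comment> \<open>Half the smallest distance between two marked parameters on an edge, so that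
    tents do not overlap; the 1 keeps the minimum defined when there are no edges.\<close>
  define \<eta> where "\<eta> = Min (insert 1 Z) / 2"
  have \<eta>: "0 < \<eta>" unfolding \<eta>_def using finZ by (auto simp: Z_def)
  have sep: "2 * \<eta> \<le> \<bar>w - w'\<bar>" if "e \<in> edges G" "w \<in> We e" "w' \<in> We e" "w \<noteq> w'" for e w w'
  proof -
    have "\<bar>w - w'\<bar> \<in> Z" unfolding Z_def using that by force
    then show ?thesis unfolding \<eta>_def using finZ by auto
  qed
  define ten where "ten e t = (\<Sum>w\<in>Ve e. max 0 (\<eta> - \<bar>t - w\<bar>))" for e t
  define \<phi> where "\<phi> e t = (if pt e t \<in> X then \<eta> else ten e t)" for e t
  have ten1: "ten e t = \<eta> - \<bar>t - w\<bar>" if "e \<in> edges G" "w \<in> Ve e" "\<bar>t - w\<bar> \<le> \<eta>" for e t w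
  proof -
    have "(\<Sum>w'\<in>Ve e - {w}. max 0 (\<eta> - \<bar>t - w'\<bar>)) = 0"
    proof (rule sum.neutral, intro ballI)
      fix w' assume "w' \<in> Ve e - {w}"
      then have "2 * \<eta> \<le> \<bar>w - w'\<bar>" using sep[OF that(1)] that(2) unfolding Ve_def by auto
      then show "max 0 (\<eta> - \<bar>t - w'\<bar>) = 0" using that(3) by auto
    qed
    then show ?thesis unfolding ten_def sum.remove[OF finVe[OF that(1)] that(2)] using that(3) by simp
  qed
  have ten0: "ten e t = 0" if "\<And>w. w \<in> Ve e \<Longrightarrow> \<eta> \<le> \<bar>t - w\<bar>" for e t
    unfolding ten_def using that by (intro sum.neutral) force
  have tenW: "ten e t = 0" if "e \<in> edges G" "t \<in> We e" "pt e t \<notin> X" for e t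
  proof (rule ten0)
    fix w assume "w \<in> Ve e"
    then have "2 * \<eta> \<le> \<bar>t - w\<bar>" using sep[OF that(1,2)] that(3) unfolding Ve_def by auto
    then show "\<eta> \<le> \<bar>t - w\<bar>" using \<eta> by linarith
  qed
  have endsW: "0 \<in> We e" "L e \<in> We e" if "e \<in> edges G" for e
    unfolding We_def using W(3) pt_0[OF that] pt_L[OF that] L_pos[OF that] by auto
  have loc_ten: "locally_linear l (ten e)" for l e
    unfolding ten_def by (intro locally_linear_intros locally_linear_abs)
  have offX: "\<exists>d>0. \<forall>h. \<bar>h\<bar> \<le> d \<longrightarrow> pt e (t + h) \<notin> X" if "pt e t \<notin> X" for e t
  proof -
    have "open (- {u. pt e u \<in> X})" using closed_preimage[OF X(1), of e] by (simp only: closed_def)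
    moreover have "t \<in> - {u. pt e u \<in> X}" using that by simp
    ultimately have "\<exists>d>0. \<forall>u. dist u t < d \<longrightarrow> u \<in> - {u. pt e u \<in> X}" unfolding open_dist by (rule bspec)
    then obtain d where "d > 0" "\<And>u. dist u t < d \<Longrightarrow> pt e u \<notin> X" by auto
    then show ?thesis by (intro exI[of _ "d/2"]) (auto simp: dist_real_def)
  qed
  have leave: "has_slope (\<phi> e) t s (-1)"
    if "e \<in> edges G" "t \<in> Ve e" "s = 1 \<or> s = -1" "d > 0" "\<forall>h\<in>{0<..d}. pt e (t + s * h) \<notin> X" for e t s d
  proof -
    have "has_slope (\<lambda>u. \<eta> - s * (u - t)) t s (-1)"
      unfolding has_slope_def using that(3) by (auto simp: algebra_simps)
    then show ?thesis
    proof (rule has_slope_cong_ev[where d = "min d \<eta>"])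
      show "0 < min d \<eta>" using that(4) \<eta> by simp
      show "\<phi> e (t + s * h) = \<eta> - s * (t + s * h - t)" if h: "0 < h" "h \<le> min d \<eta>" for h
      proof -
        have "ten e (t + s * h) = \<eta> - \<bar>t + s * h - t\<bar>"
          by (rule ten1) (use \<open>e \<in> edges G\<close> \<open>t \<in> Ve e\<close> \<open>s = 1 \<or> s = -1\<close> h in auto)
        then show ?thesis using h \<open>\<forall>h\<in>{0<..d}. pt e (t + s * h) \<notin> X\<close> \<open>s = 1 \<or> s = -1\<close>
          unfolding \<phi>_def by auto
      qed
      show "\<phi> e t = \<eta> - s * (t - t)" using that(2) unfolding \<phi>_def Ve_def by simp
    qed
  qed
  have stay: "has_slope (\<phi> e) t s 0" if "pt e t \<in> X" "d > 0" "\<forall>h\<in>{0<..d}. pt e (t + s * h) \<in> X" for e t s d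
    by (rule has_slope_cong_ev[OF has_slope_const[of \<eta>] that(2)]) (use that in \<open>auto simp: \<phi>_def\<close>)
  have inX: "has_slope (\<phi> e) t s 0 \<or> (has_slope (\<phi> e) t s (-1) \<and> (\<exists>d>0. \<forall>h\<in>{0<..d}. pt e (t + s * h) \<notin> X))"
    if "(e, t, s) \<in> directions G x" "x \<in> X" for e t s x
  proof -
    have e: "e \<in> edges G" "valid_dir (L e) t s" "pt e t = x" using that(1) unfolding directions_iff by auto
    have s: "s = 1 \<or> s = -1" using e(2) unfolding valid_dir_def by auto
    from stays_or_leaves[OF W that] show ?thesis
    proof
      assume "\<exists>d>0. \<forall>h\<in>{0<..d}. pt e (t + s * h) \<in> X"
      then show ?thesis using stay e that by blast
    next
      assume *: "x \<in> W \<and> (\<exists>d>0. \<forall>h\<in>{0<..d}. pt e (t + s * h) \<notin> X)"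
      then have "t \<in> Ve e" unfolding Ve_def We_def using e that valid_dir_range[OF e(2)] by auto
      then show ?thesis using leave[OF e(1) _ s] * by blast
    qed
  qed
  have loc: "locally_linear (L e) (\<phi> e)" if e: "e \<in> edges G" for e
    unfolding locally_linear_def
  proof (intro allI impI)
    fix t s assume dir: "valid_dir (L e) t s"
    show "\<exists>m. has_slope (\<phi> e) t s m"
    proof (cases "pt e t \<in> X")
      case True
      then show ?thesis using inX[of e t s "pt e t"] e dir unfolding directions_iff by blast
    next
      case False
      then obtain d where d: "d > 0" "\<forall>h. \<bar>h\<bar> \<le> d \<longrightarrow> pt e (t + h) \<notin> X" using offX by blast
      obtain m where "has_slope (ten e) t s m" using loc_ten dir unfolding locally_linear_def by blast
      then have "has_slope (\<phi> e) t s m"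
      proof (rule has_slope_cong_ev[OF _ d(1)])
        show "\<phi> e (t + s * h) = ten e (t + s * h)" if "0 < h" "h \<le> d" for h
          using d(2)[rule_format, of "s * h"] that dir unfolding \<phi>_def valid_dir_def by auto
      qed (use False in \<open>simp add: \<phi>_def\<close>)
      then show ?thesis ..
    qed
  qed
  obtain b where b: "rational_fun G b" "\<And>v. b (vx v) = (if vx v \<in> X then \<eta> else 0)"
     "\<And>e t. e \<in> edges G \<Longrightarrow> 0 \<le> t \<Longrightarrow> t \<le> L e \<Longrightarrow> b (pt e t) = \<phi> e t"
  proof (rule rational_glue[of \<phi> "\<lambda>v. if vx v \<in> X then \<eta> else 0"])
    show "\<phi> e 0 = (if vx (fst e) \<in> X then \<eta> else 0)" if "e \<in> edges G" for e
      unfolding \<phi>_def using pt_0[OF that] tenW[OF that endsW(1)[OF that]] by simp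
    show "\<phi> e (L e) = (if vx (snd e) \<in> X then \<eta> else 0)" if "e \<in> edges G" for e
      unfolding \<phi>_def using pt_L[OF that] tenW[OF that endsW(2)[OF that]] by simp
  qed (use loc in auto)
  have slope: "outgoing_slope G b (e, t, s) = m" if "(e, t, s) \<in> directions G x" "has_slope (\<phi> e) t s m" for e t s x m
  proof -
    have e: "e \<in> edges G" "valid_dir (L e) t s" using that(1) unfolding directions_iff by auto
    have "has_slope (\<lambda>t. b (pt e t)) t s m"
      by (rule has_slope_cong[OF that(2) e(2)]) (use b(3) e in auto)
    then show ?thesis unfolding outgoing_slope_eq by (rule the_slopeI)
  qed
  have val: "b x = 0 \<or> (0 < b x \<and> b x < \<eta> \<and> (\<exists>e t w. x = pt e t \<and> e \<in> edges G \<and> 0 < t \<and> t < L e \<and> w \<in> Ve e \<and> \<bar>t - w\<bar> < \<eta> \<and> t \<noteq> w \<and> b x = \<eta> - \<bar>t - w\<bar>))"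
    if "x \<in> curve G - X" for x
  proof -
    have "x \<in> curve G" using that by blast
    then show ?thesis
    proof (cases rule: curve_cases)
      case (vertex v) then show ?thesis using b(2) that by auto
    next
      case (interior e t)
      have bx: "b x = ten e t" using b(3)[of e t] interior that unfolding \<phi>_def by auto
      show ?thesis
      proof (cases "\<exists>w\<in>Ve e. \<bar>t - w\<bar> < \<eta>")
        case True
        then obtain w where w: "w \<in> Ve e" "\<bar>t - w\<bar> < \<eta>" by blast
        have "t \<noteq> w" using w(1) interior that unfolding Ve_def by auto
        moreover have "b x = \<eta> - \<bar>t - w\<bar>" using bx ten1[OF interior(1) w(1)] w(2) by simp
        ultimately have "x = pt e t \<and> e \<in> edges G \<and> 0 < t \<and> t < L e \<and> w \<in> Ve e \<and> \<bar>t - w\<bar> < \<eta> \<and> t \<noteq> w \<and> b x = \<eta> - \<bar>t - w\<bar>"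
          using w interior by auto
        moreover from this have "0 < b x \<and> b x < \<eta>" by auto
        ultimately show ?thesis by blast
      next
        case False
        then show ?thesis using bx ten0[of e t] by (auto simp: not_less)
      qed
    qed
  qed
  show thesis
  proof (rule that[OF \<eta> b(1)])
    show bX: "b x = \<eta>" if "x \<in> X" for x
    proof -
      have "x \<in> curve G" using that X(2) by blast
      then show ?thesis by (cases rule: curve_cases) (use that b in \<open>auto simp: \<phi>_def\<close>)
    qed
    show *: "0 \<le> b x \<and> b x < \<eta>" if "x \<in> curve G - X" for x
      using val[OF that] \<eta> by auto
    show "b x = 0" if "x \<in> W \<inter> curve G - X" for x
    proof -
      have "x \<in> curve G" using that by blast
      then show ?thesis
      proof (cases rule: curve_cases)
        case (vertex v) then show ?thesis using b(2) that by auto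
      next
        case (interior e t)
        then show ?thesis using b(3)[of e t] tenW[OF interior(1), of t] that unfolding \<phi>_def We_def by auto
      qed
    qed
    show "outgoing_slope G b (e, t, s) = 0 \<or>
        (outgoing_slope G b (e, t, s) = -1 \<and> (\<exists>d>0. \<forall>h\<in>{0<..d}. pt e (t + s * h) \<notin> X))"
      if "x \<in> X" "(e, t, s) \<in> directions G x" for x e t s
      using inX[OF that(2,1)] slope[OF that(2)] by blast
    show "\<exists>v\<in>X. \<exists>e t s. (e, t, s) \<in> directions G v \<and> x = pt e (t + s * (\<eta> - b x))"
      if x: "x \<in> curve G - X" "0 < b x" for x
    proof -
      obtain e t w where w: "x = pt e t" "e \<in> edges G" "0 < t" "t < L e" "w \<in> Ve e" "t \<noteq> w" "b x = \<eta> - \<bar>t - w\<bar>"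
        using val[OF x(1)] x(2) by auto
      define s :: real where "s = (if w < t then 1 else -1)"
      have "(e, w, s) \<in> directions G (pt e w)"
        unfolding directions_iff valid_dir_def using w unfolding Ve_def We_def s_def by auto
      moreover have "w + s * (\<eta> - b x) = t" unfolding w(7) s_def using w(6) by auto
      moreover have "pt e w \<in> X" using w(5) unfolding Ve_def by simp
      ultimately show ?thesis using w(1) by metis
    qed
    \<comment> \<open>Where \<open>b\<close> vanishes it has a minimum, so its outgoing slopes are
      nonnegative. On the flank of a tent the point is interior to an edge and the two slopes
      cancel.\<close>
    show "0 \<le> ord G b x" if x: "x \<in> curve G - X" for x
    proof (cases "b x = 0")
      case True
      have "0 \<le> outgoing_slope G b (e,t,s)" if d: "(e,t,s) \<in> directions G x" for e t s
      proof -
        have e: "e \<in> edges G" "valid_dir (L e) t s" "pt e t = x" using d unfolding directions_iff by auto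
        obtain d1 where d1: "d1 > 0" "\<forall>h\<in>{0..d1}. b (pt e (t + s * h)) = b (pt e t) + of_int (outgoing_slope G b (e,t,s)) * h"
          using has_slope_dir[OF b(1) d] unfolding has_slope_ex by blast
        obtain d2 where d2: "d2 > 0" "\<forall>h\<in>{0<..d2}. 0 < t + s * h \<and> t + s * h < L e"
          using valid_dir_ev[OF e(2)] by blast
        define h where "h = min d1 d2"
        have h: "h > 0" "h \<le> d1" "h \<le> d2" using d1 d2 unfolding h_def by auto
        have "pt e (t + s * h) \<in> curve G" using d2(2) h pt_curve[OF e(1)] by (auto simp: less_imp_le)
        then have "0 \<le> b (pt e (t + s * h))" using * bX \<eta> by (cases "pt e (t + s * h) \<in> X") auto
        then have "0 \<le> of_int (outgoing_slope G b (e,t,s)) * h" using d1(2) h e(3) True by auto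
        then show ?thesis using h(1) by (simp add: zero_le_mult_iff)
      qed
      then show ?thesis unfolding ord_def by (intro sum_nonneg) auto
    next
      case False
      then obtain e t w where w: "x = pt e t" "e \<in> edges G" "0 < t" "t < L e" "w \<in> Ve e" "\<bar>t - w\<bar> < \<eta>" "t \<noteq> w"
        using val[OF x] by auto
      obtain d0 where d0: "d0 > 0" "\<forall>h. \<bar>h\<bar> \<le> d0 \<longrightarrow> pt e (t + h) \<notin> X" using offX[of e t] x w(1) by auto
      define d where "d = min d0 (min (\<bar>t - w\<bar>) (\<eta> - \<bar>t - w\<bar>))"
      have d: "d > 0" "d \<le> d0" "d \<le> \<bar>t - w\<bar>" "d \<le> \<eta> - \<bar>t - w\<bar>" unfolding d_def using w d0 by auto
      define k :: int where "k = (if w < t then -1 else 1)"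
      have sl: "has_slope (\<phi> e) t s (if s = 1 then k else -k)" if s: "s = 1 \<or> s = -1" for s
      proof -
        have "has_slope (\<lambda>u. \<eta> + of_int k * (u - w)) t s (if s = 1 then k else -k)"
          unfolding has_slope_def using s by (auto simp: algebra_simps)
        then show ?thesis
        proof (rule has_slope_cong_ev[OF _ d(1)])
          show "\<phi> e (t + s * h) = \<eta> + of_int k * (t + s * h - w)" if h: "0 < h" "h \<le> d" for h
          proof -
            have a: "\<bar>t + s * h - w\<bar> = - of_int k * (t + s * h - w)"
              using s h d w(7) unfolding k_def by auto
            have "ten e (t + s * h) = \<eta> - \<bar>t + s * h - w\<bar>"
              by (rule ten1[OF w(2,5)]) (use s h d in auto)
            moreover have "pt e (t + s * h) \<notin> X" using d0(2)[rule_format, of "s * h"] s h d by auto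
            ultimately show ?thesis using a unfolding \<phi>_def by simp
          qed
          have "ten e t = \<eta> - \<bar>t - w\<bar>" by (rule ten1[OF w(2,5)]) (use w in auto)
          then show "\<phi> e t = \<eta> + of_int k * (t - w)" using x w(1,7) unfolding \<phi>_def k_def by auto
        qed
      qed
      have o: "the_slope (\<lambda>t. b (pt e t)) t s = (if s = 1 then k else -k)" if s: "s = 1 \<or> s = -1" for s
      proof -
        have "(e,t,s) \<in> directions G x" unfolding directions_iff valid_dir_def using w s by auto
        from slope[OF this sl[OF s]] show ?thesis unfolding outgoing_slope_eq .
      qed
      have "ord G b x = 0" unfolding ord_eq w(1) params_interior[OF w(2-4)] using o w(3,4) by (simp add: slope_sum_def)
      then show ?thesis by simp
    qed
  qed
qed

lemma slope_le:
  assumes "rational_fun G f" "(e,t,s) \<in> directions G x" "\<And>y. y \<in> curve G \<Longrightarrow> f y \<le> f x"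
  shows "outgoing_slope G f (e,t,s) \<le> 0"
proof -
  have e: "e \<in> edges G" "valid_dir (L e) t s" "pt e t = x" using assms(2) unfolding directions_iff by auto
  obtain d1 where d1: "d1 > 0" "\<forall>h\<in>{0..d1}. f (pt e (t + s * h)) = f (pt e t) + of_int (outgoing_slope G f (e,t,s)) * h"
    using has_slope_dir[OF assms(1,2)] unfolding has_slope_ex by blast
  obtain d2 where d2: "d2 > 0" "\<forall>h\<in>{0<..d2}. 0 < t + s * h \<and> t + s * h < L e"
    using valid_dir_ev[OF e(2)] by blast
  define h where "h = min d1 d2"
  have h: "h > 0" "h \<le> d1" "h \<le> d2" using d1 d2 unfolding h_def by auto
  have "pt e (t + s * h) \<in> curve G" using d2(2) h pt_curve[OF e(1)] by (auto simp: less_imp_le)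
  then have "f (pt e (t + s * h)) \<le> f x" using assms(3) by blast
  then have "of_int (outgoing_slope G f (e,t,s)) * h \<le> 0" using d1(2) h e(3) by auto
  then show ?thesis using h(1) by (simp add: mult_le_0_iff)
qed

section \<open>Counting segments leaving a set\<close>

definition segment_family :: "(real^'v) set \<Rightarrow> real^'v \<Rightarrow> (real \<Rightarrow> real^'v) set \<Rightarrow> bool" where
  "segment_family X v S \<longleftrightarrow> finite S \<and>
     (\<forall>g\<in>S. arc g \<and> pathstart g = v \<and> path_image g \<subseteq> curve G - (X - {v})) \<and>
     pairwise (\<lambda>g h. disjnt (g ` {0<..<1}) (h ` {0<..<1})) S"

lemma out_degree_segment_family: "out_degree G X v = Max {card S | S. segment_family X v S}"
  unfolding out_degree_def segment_family_def by simp

text \<open>A segment starting at \<open>v\<close> attains all values of a tent function at \<open>v\<close> close to the top, so it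
  meets every small sphere around \<open>v\<close>.\<close>

lemma segment_family_bound:
  assumes v: "v \<in> curve G" and S: "segment_family X v S"
  shows "\<exists>r0>0. \<forall>r. 0 < r \<longrightarrow> r < r0 \<longrightarrow>
    card S \<le> card {d \<in> directions G v. (case d of (e,t,s) \<Rightarrow> pt e (t + s * r)) \<notin> X}"
proof -
  \<comment> \<open>Vacuous: an interval free of marked points does not contain
    \<open>v\<close>.\<close>
  have ad: "adapted {v} (insert v (range vx))" unfolding adapted_def by auto
  obtain \<eta> b where \<eta>: "0 < \<eta>" and b: "rational_fun G b" "\<And>x. x \<in> {v} \<Longrightarrow> b x = \<eta>"
     "\<And>x. x \<in> curve G - {v} \<Longrightarrow> 0 \<le> b x \<and> b x < \<eta>"
     "\<And>x. x \<in> curve G - {v} \<Longrightarrow> 0 < b x \<Longrightarrow>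
        \<exists>v\<in>{v}. \<exists>e t s. (e, t, s) \<in> directions G v \<and> x = pt e (t + s * (\<eta> - b x))"
    by (rule bump[of "{v}" "insert v (range vx)"]) (use v ad in auto)
  have g1: "g 1 \<in> curve G - {v}" if "g \<in> S" for g
  proof -
    have "arc g" "pathstart g = v" "path_image g \<subseteq> curve G" using S that unfolding segment_family_def by auto
    moreover have "g 1 \<noteq> g 0" using \<open>arc g\<close> unfolding arc_def inj_on_def by force
    ultimately show ?thesis unfolding pathstart_def path_image_def by auto
  qed
  have finS: "finite S" using S unfolding segment_family_def by simp
  \<comment> \<open>For \<open>r\<close> below \<open>r0\<close> every segment ends under the level
    \<open>\<eta> - r\<close>, so each of them has to cross that level.\<close>
  define r0 where "r0 = Min (insert \<eta> ((\<lambda>g. \<eta> - b (g 1)) ` S))"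
  have r0: "r0 > 0" unfolding r0_def using finS \<eta> b(3) g1 by auto
  have r0S: "r0 \<le> \<eta> - b (g 1)" if "g \<in> S" for g unfolding r0_def using finS that by simp
  have r0\<eta>: "r0 \<le> \<eta>" unfolding r0_def using finS by simp
  show ?thesis
  proof (intro exI[of _ r0] conjI r0 allI impI)
    fix r assume r: "0 < r" "r < r0"
    let ?T = "{d \<in> directions G v. (case d of (e,t,s) \<Rightarrow> pt e (t + s * r)) \<notin> X}"
    have "\<forall>g\<in>S. \<exists>d. d \<in> ?T \<and> (case d of (e,t,s) \<Rightarrow> pt e (t + s * r)) \<in> g ` {0<..<1}"
    proof
      fix g assume g: "g \<in> S"
      have ga: "arc g" "g 0 = v" "path_image g \<subseteq> curve G - (X - {v})"
        using S g unfolding segment_family_def pathstart_def by auto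
      have "continuous_on {0..1} (\<lambda>\<tau>. b (g \<tau>))"
      proof (rule continuous_on_compose2[OF rational_cont[OF b(1)]])
        show "continuous_on {0..1} g" using ga(1) unfolding arc_def path_def by simp
        show "g ` {0..1} \<subseteq> curve G" using ga(3) unfolding path_image_def by auto
      qed
      then have "\<exists>\<tau>\<ge>0. \<tau> \<le> 1 \<and> b (g \<tau>) = \<eta> - r"
        by (intro IVT2'[of "\<lambda>\<tau>. b (g \<tau>)"]) (use r r0S[OF g] b(2) ga(2) in auto)
      then obtain \<tau> where \<tau>: "0 \<le> \<tau>" "\<tau> \<le> 1" "b (g \<tau>) = \<eta> - r" by blast
      have t01: "\<tau> \<noteq> 0" "\<tau> \<noteq> 1" using \<tau>(3) r r0S[OF g] b(2)[of v] ga(2) by auto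
      have ne: "g \<tau> \<noteq> v" using \<tau>(3) b(2)[of v] r by auto
      have gt: "g \<tau> \<in> curve G" "g \<tau> \<notin> X"
      proof -
        have "g \<tau> \<in> path_image g" using \<tau> unfolding path_image_def by auto
        then show "g \<tau> \<in> curve G" "g \<tau> \<notin> X" using ga(3) ne by auto
      qed
      have "0 < b (g \<tau>)" using \<tau>(3) r r0\<eta> by simp
      then obtain e t s where d: "(e, t, s) \<in> directions G v" "g \<tau> = pt e (t + s * (\<eta> - b (g \<tau>)))"
        using b(4)[of "g \<tau>"] gt(1) ne by blast
      then have "g \<tau> = pt e (t + s * r)" using \<tau>(3) by simp
      then show "\<exists>d. d \<in> ?T \<and> (case d of (e,t,s) \<Rightarrow> pt e (t + s * r)) \<in> g ` {0<..<1}"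
        using d(1) gt(2) \<tau> t01 by (intro exI[of _ "(e,t,s)"]) (auto intro!: image_eqI[of _ g \<tau>])
    qed
    then obtain F where F0: "\<forall>g\<in>S. F g \<in> ?T \<and> (case F g of (e,t,s) \<Rightarrow> pt e (t + s * r)) \<in> g ` {0<..<1}"
      by (rule bchoice[THEN exE])
    note F = bspec[OF F0]
    \<comment> \<open>The crossing points lie in the interiors of the segments, and these are
      pairwise disjoint.\<close>
    have "inj_on F S"
    proof (rule inj_onI, rule ccontr)
      fix g g' assume *: "g \<in> S" "g' \<in> S" "F g = F g'" "g \<noteq> g'"
      then have "disjnt (g ` {0<..<1}) (g' ` {0<..<1})" using S unfolding segment_family_def pairwise_def by blast
      then show False using F[OF *(1)] F[OF *(2)] *(3) unfolding disjnt_def by (metis (no_types, lifting) IntI empty_iff)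
    qed
    moreover have "F ` S \<subseteq> ?T" using F by blast
    moreover have "finite ?T" using finite_directions by simp
    ultimately show "card S \<le> card ?T" by (rule card_inj_on_le)
  qed
qed

lemma segment_family_card_le: "v \<in> curve G \<Longrightarrow> segment_family X v S \<Longrightarrow> card S \<le> card (directions G v)"
proof -
  assume "v \<in> curve G" "segment_family X v S"
  then obtain r0 where r0: "r0 > 0" "\<And>r. 0 < r \<Longrightarrow> r < r0 \<Longrightarrow>
    card S \<le> card {d \<in> directions G v. (case d of (e,t,s) \<Rightarrow> pt e (t + s * r)) \<notin> X}"
    using segment_family_bound by blast
  have "card S \<le> card {d \<in> directions G v. (case d of (e,t,s) \<Rightarrow> pt e (t + s * (r0/2))) \<notin> X}"
    by (rule r0(2)) (use r0(1) in auto)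
  also have "\<dots> \<le> card (directions G v)" by (rule card_mono[OF finite_directions]) auto
  finally show ?thesis .
qed

lemma segment_family_cards_finite: "v \<in> curve G \<Longrightarrow> finite {card S | S. segment_family X v S}"
  by (rule finite_subset[of _ "{..card (directions G v)}"]) (use segment_family_card_le in auto)

lemma out_degree_ge: "v \<in> curve G \<Longrightarrow> segment_family X v S \<Longrightarrow> card S \<le> out_degree G X v"
  unfolding out_degree_segment_family by (rule Max_ge[OF segment_family_cards_finite]) auto

lemma out_degree_witness:
  assumes "v \<in> curve G" obtains S where "segment_family X v S" "card S = out_degree G X v"
proof -
  have "segment_family X v {}" unfolding segment_family_def by simp
  then have "{card S | S. segment_family X v S} \<noteq> {}" by blast
  from Max_in[OF segment_family_cards_finite[OF assms] this] show thesis
    unfolding out_degree_segment_family[symmetric] using that by auto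
qed

text \<open>Straight pieces of length \<open>d\<close> in the directions of \<open>A\<close> are
  internally disjoint segments, because an interior point of an edge determines its edge and
  parameter.\<close>

lemma out_degree_ge_directions:
  assumes "v \<in> curve G" "v \<in> X" "A \<subseteq> directions G v" "0 < d"
    and A: "\<And>e t s h. (e,t,s) \<in> A \<Longrightarrow> 0 < h \<Longrightarrow> h \<le> d \<Longrightarrow> 0 < t + s * h \<and> t + s * h < L e \<and> pt e (t + s * h) \<notin> X"
  shows "card A \<le> out_degree G X v"
proof -
  define g where "g = (\<lambda>(e,t,s) \<tau>. pt e (t + s * (d * \<tau>)))"
  have dA: "e \<in> edges G \<and> valid_dir (L e) t s \<and> pt e t = v" if "(e,t,s) \<in> A" for e t s
    using that assms(3) directions_iff by blast
  have sA: "s = 1 \<or> s = -1" if "(e,t,s) \<in> A" for e t s using dA[OF that] unfolding valid_dir_def by auto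
  have key: "k = k'" if "k \<in> A" "k' \<in> A" "0 < \<tau>" "\<tau> \<le> 1" "0 < \<tau>'" "\<tau>' \<le> 1" "g k \<tau> = g k' \<tau>'" for k k' \<tau> \<tau>'
  proof -
    obtain e t s e' t' s' where k: "k = (e,t,s)" "k' = (e',t',s')" by (metis prod_cases3)
    have b: "0 < d * \<tau>" "d * \<tau> \<le> d" "0 < d * \<tau>'" "d * \<tau>' \<le> d" using that(3-6) assms(4) by (auto simp: mult_le_cancel_left1)
    note a = A[of e t s, OF _ b(1,2)] A[of e' t' s', OF _ b(3,4)]
    have "e = e' \<and> t + s * (d * \<tau>) = t' + s' * (d * \<tau>')"
      by (rule pt_interior_eq) (use a that k dA in \<open>auto simp: g_def less_imp_le\<close>)
    moreover from this have "t = t'" using dA[of e t s] dA[of e' t' s'] pt_inj that(1,2) k by metis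
    ultimately have "e = e'" "t = t'" "s * (d * \<tau>) = s' * (d * \<tau>')" by auto
    then show ?thesis using sA[of e t s] sA[of e' t' s'] b that(1,2) k by auto
  qed
  have "inj_on g A" by (rule inj_onI) (use key[of _ _ 1 1] in auto)
  then have "card (g ` A) = card A" by (rule card_image)
  moreover have "segment_family X v (g ` A)"
    unfolding segment_family_def
  proof (intro conjI ballI)
    show "finite (g ` A)" using finite_directions assms(3) finite_subset by blast
    show "pairwise (\<lambda>g h. disjnt (g ` {0<..<1}) (h ` {0<..<1})) (g ` A)"
    proof (rule pairwiseI)
      fix p q assume pq: "p \<in> g ` A" "q \<in> g ` A" "p \<noteq> q"
      then obtain k k' where k: "k \<in> A" "k' \<in> A" "p = g k" "q = g k'" by blast
      show "disjnt (p ` {0<..<1}) (q ` {0<..<1})"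
        unfolding disjnt_iff
      proof (intro allI notI, elim conjE imageE)
        fix x a b assume "x = p a" "x = q b" "a \<in> {0<..<1}" "b \<in> {0<..<1}"
        then have "k = k'" using key[OF k(1,2), of a b] k by auto
        then show False using pq(3) k by simp
      qed
    qed
    fix p assume "p \<in> g ` A"
    then obtain e t s where k: "(e,t,s) \<in> A" "p = g (e,t,s)" by auto
    note dk = dA[OF k(1)] and sk = sA[OF k(1)]
    have p: "p = (\<lambda>\<tau>. pt e (t + s * (d * \<tau>)))" unfolding k(2) g_def by simp
    have "path p" unfolding path_def p
      by (rule continuous_on_compose2[OF pt_continuous[of UNIV]]) (auto intro!: continuous_intros)
    moreover have "inj_on p {0..1}"
      unfolding p using pt_inj[of e] dk sk assms(4) by (intro inj_onI) (fastforce dest: pt_inj)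
    ultimately show "arc p" unfolding arc_def by simp
    show "pathstart p = v" unfolding pathstart_def p using dk by simp
    show "path_image p \<subseteq> curve G - (X - {v})"
    proof
      fix x assume "x \<in> path_image p"
      then obtain \<tau> where \<tau>: "0 \<le> \<tau>" "\<tau> \<le> 1" "x = p \<tau>" unfolding path_image_def by auto
      show "x \<in> curve G - (X - {v})"
      proof (cases "\<tau> = 0")
        case True then show ?thesis using \<tau>(3) p dk assms(1) by simp
      next
        case False
        then have b: "0 < d * \<tau>" "d * \<tau> \<le> d" using \<tau> assms(4) by (auto simp: mult_le_cancel_left1)
        from A[OF k(1) b] show ?thesis using \<tau>(3) p dk pt_curve[of e] by (auto simp: less_imp_le)
      qed
    qed
  qed
  ultimately show ?thesis using out_degree_ge[OF assms(1)] by metis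
qed

lemma leaving_frontier:
  assumes "X \<subseteq> curve G" "v \<in> X" "(e,t,s) \<in> directions G v" "0 < d" "\<forall>h\<in>{0<..d}. pt e (t + s * h) \<notin> X"
  shows "v \<in> top_of_set (curve G) frontier_of X"
proof -
  have e: "e \<in> edges G" "valid_dir (L e) t s" "pt e t = v" using assms(3) unfolding directions_iff by auto
  obtain d2 where d2: "d2 > 0" "\<forall>h\<in>{0<..d2}. 0 < t + s * h \<and> t + s * h < L e"
    using valid_dir_ev[OF e(2)] by blast
  have "v \<in> top_of_set (curve G) closure_of X"
    using closure_of_subset[of X "top_of_set (curve G)"] assms(1,2) by auto
  moreover have "v \<notin> top_of_set (curve G) interior_of X"
  proof
    assume "v \<in> top_of_set (curve G) interior_of X"
    then obtain T where T: "openin (top_of_set (curve G)) T" "v \<in> T" "T \<subseteq> X" unfolding interior_of_def by auto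
    then obtain O' where O: "open O'" "T = curve G \<inter> O'" unfolding openin_open by auto
    have "continuous_on UNIV (\<lambda>h. pt e (t + s * h))"
      by (rule continuous_on_compose2[OF pt_continuous[of UNIV]]) (auto intro!: continuous_intros)
    then have "open ((\<lambda>h. pt e (t + s * h)) -` O')"
      using O(1) open_vimage by blast
    moreover have "0 \<in> (\<lambda>h. pt e (t + s * h)) -` O'" using T O e by auto
    ultimately obtain d3 where d3: "d3 > 0" "\<And>h. dist h 0 < d3 \<Longrightarrow> pt e (t + s * h) \<in> O'"
      unfolding open_dist by (metis vimageD)
    define h where "h = min d (min d2 (d3/2))"
    have h: "0 < h" "h \<le> d" "h \<le> d2" "h < d3" unfolding h_def using assms(4) d2 d3 by auto
    have "pt e (t + s * h) \<in> O'" using d3(2)[of h] h by simp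
    moreover have "pt e (t + s * h) \<in> curve G" using d2(2) h pt_curve[OF e(1)] by (auto simp: less_imp_le)
    ultimately show False using T(3) O(2) assms(5) h by auto
  qed
  ultimately show ?thesis unfolding frontier_of_def by blast
qed

section \<open>Reduced divisors as maximal functions\<close>

abbreviation plus_div :: "'v divisor \<Rightarrow> (real^'v \<Rightarrow> real) \<Rightarrow> 'v divisor" where
  "plus_div D f \<equiv> \<lambda>x. D x + ord G f x"

definition in_R :: "'v divisor \<Rightarrow> (real^'v \<Rightarrow> real) \<Rightarrow> bool" where
  "in_R D f \<longleftrightarrow> rational_fun G f \<and> effective G (plus_div D f)"

definition maximal :: "'v divisor \<Rightarrow> real^'v \<Rightarrow> (real^'v \<Rightarrow> real) \<Rightarrow> bool" where
  "maximal D P f \<longleftrightarrow> in_R D f \<and> (\<forall>f'. in_R D f' \<longrightarrow> (\<forall>x\<in>curve G. f' x - f' P \<le> f x - f P))"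

lemma in_R_nonneg: "in_R D f \<Longrightarrow> 0 \<le> D x + ord G f x"
  unfolding in_R_def effective_def by blast

lemma in_RI:
  assumes "is_divisor G D" "rational_fun G f" "\<And>x. x \<in> curve G \<Longrightarrow> 0 \<le> D x + ord G f x"
  shows "in_R D f"
proof -
  have d: "is_divisor G (plus_div D f)" using is_divisor_add_div assms by blast
  moreover have "0 \<le> D x + ord G f x" for x
    using assms(3)[of x] d unfolding is_divisor_def by (cases "x \<in> curve G") force+
  ultimately show ?thesis unfolding in_R_def effective_def using assms(2) by blast
qed

text \<open>If every frontier point of \<open>X\<close> carried at least as many chips as its
  outdegree, adding the bump function of \<open>X\<close> would keep the divisor effective, raise
  \<open>f\<close> on \<open>X\<close> and fix its value at \<open>P\<close>, against
  maximality.\<close>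

lemma maximal_imp_reduced:
  assumes D: "is_divisor G D" and P: "P \<in> curve G" and f: "maximal D P f"
  shows "reduced G P (plus_div D f)"
proof -
  let ?E = "plus_div D f"
  have fR: "in_R D f" and rf: "rational_fun G f" using f unfolding maximal_def in_R_def by auto
  have E: "is_divisor G ?E" "\<And>x. 0 \<le> ?E x" using fR unfolding in_R_def effective_def by auto
  have part: "\<exists>v \<in> top_of_set (curve G) frontier_of X. ?E v < int (out_degree G X v)"
    if X: "X \<subseteq> curve G" "closed X" "X \<noteq> {}" "P \<notin> X" for X
  proof (rule ccontr)
    assume "\<not> ?thesis"
    then have fr: "\<And>v. v \<in> top_of_set (curve G) frontier_of X \<Longrightarrow> int (out_degree G X v) \<le> ?E v" by force
    \<comment> \<open>The directions leaving \<open>X\<close> at \<open>v\<close> are realized by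
      segments, so the outdegree is at least their number; as soon as there is one of them,
      \<open>v\<close> is a frontier point.\<close>
    have leaving: "int (card A) \<le> ?E v"
      if v: "v \<in> X" "A \<subseteq> directions G v" and A: "\<And>e t s. (e,t,s) \<in> A \<Longrightarrow> \<exists>d>0. \<forall>h\<in>{0<..d}. pt e (t + s * h) \<notin> X" for v A
    proof (cases "A = {}")
      case True then show ?thesis using E by simp
    next
      case False
      have finA: "finite A" using v(2) finite_directions finite_subset by blast
      have "\<forall>k\<in>A. \<exists>d>0. \<forall>h. 0 < h \<longrightarrow> h \<le> d \<longrightarrow> (case k of (e,t,s) \<Rightarrow> 0 < t + s * h \<and> t + s * h < L e \<and> pt e (t + s * h) \<notin> X)"
      proof
        fix k assume k: "k \<in> A"
        obtain e t s where k': "k = (e,t,s)" by (metis prod_cases3)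
        have e: "e \<in> edges G" "valid_dir (L e) t s" using k k' v(2) directions_iff by blast+
        obtain d1 where d1: "d1 > 0" "\<forall>h\<in>{0<..d1}. pt e (t + s * h) \<notin> X" using A k k' by blast
        obtain d2 where d2: "d2 > 0" "\<forall>h\<in>{0<..d2}. 0 < t + s * h \<and> t + s * h < L e"
          using valid_dir_ev[OF e(2)] by blast
        show "\<exists>d>0. \<forall>h. 0 < h \<longrightarrow> h \<le> d \<longrightarrow> (case k of (e,t,s) \<Rightarrow> 0 < t + s * h \<and> t + s * h < L e \<and> pt e (t + s * h) \<notin> X)"
          using d1 d2 unfolding k' by (intro exI[of _ "min d1 d2"]) auto
      qed
      then obtain dd where dd0: "\<forall>k\<in>A. dd k > 0 \<and> (\<forall>h. 0 < h \<longrightarrow> h \<le> dd k \<longrightarrow> (case k of (e,t,s) \<Rightarrow> 0 < t + s * h \<and> t + s * h < L e \<and> pt e (t + s * h) \<notin> X))"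
        by (rule bchoice[THEN exE])
      note dd = bspec[OF dd0]
      define d where "d = Min (dd ` A)"
      have d: "d > 0" "\<And>k. k \<in> A \<Longrightarrow> d \<le> dd k" unfolding d_def using finA False dd by auto
      have "card A \<le> out_degree G X v"
        by (rule out_degree_ge_directions[OF _ v(1,2) d(1)]) (use X v dd d in fastforce)+
      moreover have "v \<in> top_of_set (curve G) frontier_of X"
      proof -
        obtain e t s where k: "(e,t,s) \<in> A" using False by auto
        then obtain d1 where "d1 > 0" "\<forall>h\<in>{0<..d1}. pt e (t + s * h) \<notin> X" using A by blast
        then show ?thesis using leaving_frontier[OF X(1) v(1)] k v(2) by blast
      qed
      ultimately show ?thesis using fr[of v] by linarith
    qed
    \<comment> \<open>\<open>P\<close> is marked to make the bump function vanish there; the chips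
      are marked because \<open>X\<close> can be left only at chips.\<close>
    define W where "W = {x. ?E x \<noteq> 0} \<union> {P} \<union> range vx"
    have finW: "finite W" unfolding W_def using E(1) unfolding is_divisor_def by simp
    have ad: "adapted X W"
      unfolding adapted_def
    proof (intro ballI allI impI)
      fix e a b t0 t
      assume e: "e \<in> edges G" and ab: "0 \<le> a" "b \<le> L e" "a < t0" "t0 < b"
        and nW: "\<forall>t. a < t \<longrightarrow> t < b \<longrightarrow> pt e t \<notin> W" and t0: "pt e t0 \<in> X" and t: "t \<in> {a..b}"
      have inn: "pt e y \<in> X" if y: "a < y" "y < b" for y
      proof (rule ccontr)
        assume yX: "pt e y \<notin> X"
        define s :: real where "s = (if t0 < y then 1 else -1)"
        define l where "l = \<bar>y - t0\<bar>"
        have yl: "y = t0 + s * l" unfolding s_def l_def by auto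
        define K where "K = {0..l} \<inter> {h. pt e (t0 + s * h) \<in> X}"
        have "closed {h. pt e (t0 + s * h) \<in> X}"
        proof -
          have "continuous_on UNIV (\<lambda>h. pt e (t0 + s * h))"
            by (rule continuous_on_compose2[OF pt_continuous[of UNIV]]) (auto intro!: continuous_intros)
          then have "closed ((\<lambda>h. pt e (t0 + s * h)) -` X)" using X(2) continuous_closed_vimage continuous_on_eq_continuous_at by blast
          then show ?thesis unfolding vimage_def .
        qed
        then have "compact K" unfolding K_def by (intro compact_Int_closed) auto
        moreover have "0 \<in> K" unfolding K_def l_def using t0 by simp
        \<comment> \<open>The last position in \<open>X\<close> on the way from \<open>t0\<close> to
          \<open>y\<close>. A direction leaves \<open>X\<close> there, so the point carries a chip
          and is marked.\<close>
        ultimately obtain m where m: "m \<in> K" "\<And>h. h \<in> K \<Longrightarrow> h \<le> m" using compact_attains_sup[of K] by blast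
        have ml: "0 \<le> m" "m < l" using m(1) yX yl unfolding K_def by (auto simp: less_le)
        define \<alpha> where "\<alpha> = t0 + s * m"
        have \<alpha>: "a < \<alpha>" "\<alpha> < b" "pt e \<alpha> \<in> X" using m(1) ml yl y ab unfolding \<alpha>_def K_def s_def
          by (auto split: if_splits)
        have "(e, \<alpha>, s) \<in> directions G (pt e \<alpha>)"
          unfolding directions_iff valid_dir_def using e \<alpha> ab unfolding s_def by auto
        moreover have "\<forall>h\<in>{0<..l - m}. pt e (\<alpha> + s * h) \<notin> X"
        proof (intro ballI notI)
          fix h assume h: "h \<in> {0<..l - m}" "pt e (\<alpha> + s * h) \<in> X"
          then have "m + h \<in> K" using ml unfolding K_def \<alpha>_def by (auto simp: algebra_simps)
          then show False using m(2)[of "m + h"] h by auto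
        qed
        ultimately have "int (card {(e, \<alpha>, s)}) \<le> ?E (pt e \<alpha>)"
          by (intro leaving[OF \<alpha>(3)]) (use ml in \<open>auto intro!: exI[of _ "l - m"]\<close>)
        then have "pt e \<alpha> \<in> W" unfolding W_def by simp
        then show False using nW \<alpha> by blast
      qed
      have "{a<..<b} \<subseteq> {u. pt e u \<in> X}" using inn by auto
      then have "closure {a<..<b} \<subseteq> {u. pt e u \<in> X}" by (rule closure_minimal[OF _ closed_preimage[OF X(2)]])
      then show "pt e t \<in> X" using t ab by auto
    qed
    obtain \<eta> b where \<eta>: "0 < \<eta>" and b: "rational_fun G b" "\<And>x. x \<in> X \<Longrightarrow> b x = \<eta>"
      "\<And>x. x \<in> W \<inter> curve G - X \<Longrightarrow> b x = 0" "\<And>x. x \<in> curve G - X \<Longrightarrow> 0 \<le> ord G b x"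
      "\<And>x e t s. x \<in> X \<Longrightarrow> (e, t, s) \<in> directions G x \<Longrightarrow> outgoing_slope G b (e, t, s) = 0 \<or>
        (outgoing_slope G b (e, t, s) = -1 \<and> (\<exists>d>0. \<forall>h\<in>{0<..d}. pt e (t + s * h) \<notin> X))"
      by (rule bump[OF X(2,1) finW ad]) (auto simp: W_def)
    let ?f = "\<lambda>x\<in>curve G. f x + b x"
    have rat: "rational_fun G ?f" by (rule rational_add[OF rf b(1)])
    have "in_R D ?f"
    proof (rule in_RI[OF D rat])
      fix x assume x: "x \<in> curve G"
      have "- ?E x \<le> ord G b x"
      proof (cases "x \<in> X")
        case True
        define A where "A = {k\<in>directions G x. outgoing_slope G b k = -1}"
        have "int (card A) \<le> ?E x"
        proof (rule leaving[OF True])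
          show "\<exists>d>0. \<forall>h\<in>{0<..d}. pt e (t + s * h) \<notin> X" if "(e,t,s) \<in> A" for e t s
            using b(5)[OF True, of e t s] that unfolding A_def by fastforce
        qed (auto simp: A_def)
        moreover have "ord G b x = - int (card A)"
        proof -
          have "ord G b x = (\<Sum>k\<in>directions G x. if outgoing_slope G b k = -1 then -1 else 0)"
            unfolding ord_def using b(5)[OF True] by (intro sum.cong) auto
          also have "\<dots> = (\<Sum>k\<in>A. -1)" unfolding A_def by (rule sum.inter_filter[symmetric, OF finite_directions])
          finally show ?thesis by simp
        qed
        ultimately show ?thesis by simp
      next
        case False
        then have "0 \<le> ord G b x" using b(4) x by blast
        then show ?thesis using E(2)[of x] by linarith
      qed
      then show "0 \<le> D x + ord G ?f x" unfolding ord_add[OF rf b(1)] by simp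
    qed
    moreover obtain x where x: "x \<in> X" using X(3) by blast
    ultimately have "?f x - ?f P \<le> f x - f P" using f X(1) unfolding maximal_def by blast
    moreover have "b P = 0" using b(3) P X(4) unfolding W_def by simp
    ultimately show False using x X(1) P b(2)[OF x] \<eta> by (auto simp: subset_iff)
  qed
  show ?thesis unfolding reduced_def
    by (intro conjI allI impI E) (use part in blast)
qed

text \<open>Let \<open>X\<close> be a component of the set where \<open>f' - f\<close> is largest. A
  direction of slope 0 stays in this component, so every direction leaving \<open>X\<close> has
  slope at most -1. At a frontier point the coefficient of \<open>D + div f'\<close> is then at most
  that of \<open>D + div f\<close> minus the outdegree. If \<open>P\<close> were outside the set,
  reducedness would make one of these coefficients negative.\<close>

lemma reduced_imp_maximal:
  assumes D: "is_divisor G D" and P: "P \<in> curve G" and rf: "rational_fun G f"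
    and red: "reduced G P (plus_div D f)" and ne: "\<exists>f. in_R D f"
  shows "maximal D P f"
proof -
  let ?E = "plus_div D f"
  have key: "f' x - f x \<le> f' P - f P" if f': "in_R D f'" and x: "x \<in> curve G" for f' x
  proof -
    let ?g = "\<lambda>x\<in>curve G. f' x - f x"
    have rf': "rational_fun G f'" using f' unfolding in_R_def by simp
    have rg: "rational_fun G ?g" by (rule rational_diff[OF rf' rf])
    obtain m where m: "m \<in> curve G" "\<And>y. y \<in> curve G \<Longrightarrow> ?g y \<le> ?g m"
      using continuous_attains_sup[OF compact_curve _ rational_cont[OF rg]] P by blast
    define M where "M = {y\<in>curve G. ?g y = ?g m}"
    have clM: "closed M" unfolding M_def
    proof -
      have "closed (curve G \<inter> ?g -` {?g m})"
        by (rule continuous_closed_preimage[OF rational_cont[OF rg] closed_curve closed_singleton])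
      then show "closed {y \<in> curve G. ?g y = ?g m}"
        by (rule back_subst[of closed]) auto
    qed
    have "P \<in> M"
    proof (rule ccontr)
      assume PM: "P \<notin> M"
      define X where "X = connected_component_set M m"
      have mM: "m \<in> M" unfolding M_def using m by simp
      have X: "X \<subseteq> M" "closed X" "connected X" "m \<in> X"
        unfolding X_def using clM mM by (auto simp: connected_component_subset closed_connected_component)
      have "\<exists>v \<in> top_of_set (curve G) frontier_of X. ?E v < int (out_degree G X v)"
        using red X PM unfolding reduced_def M_def by blast
      then obtain v where v: "v \<in> top_of_set (curve G) frontier_of X" "?E v < int (out_degree G X v)" by blast
      have vX: "v \<in> X"
      proof -
        have "closedin (top_of_set (curve G)) X" using X unfolding M_def by (intro closed_subset) auto
        then show ?thesis using v(1) frontier_of_subset_closedin by blast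
      qed
      have vG: "v \<in> curve G" using vX X(1) unfolding M_def by auto
      have vmax: "?g y \<le> ?g v" if "y \<in> curve G" for y using vX X(1) m(2)[OF that] unfolding M_def by auto
      have sl: "outgoing_slope G ?g k \<le> 0" if "k \<in> directions G v" for k
        using slope_le[OF rg, of "fst k" "fst (snd k)" "snd (snd k)" v] that vmax by auto
      obtain S where S: "segment_family X v S" "card S = out_degree G X v" using out_degree_witness[OF vG] by blast
      obtain r0 where r0: "r0 > 0" "\<And>r. 0 < r \<Longrightarrow> r < r0 \<Longrightarrow>
         card S \<le> card {d \<in> directions G v. (case d of (e,t,s) \<Rightarrow> pt e (t + s * r)) \<notin> X}"
        using segment_family_bound[OF vG S(1)] by blast
      have "\<forall>k\<in>directions G v. \<exists>d>0. \<forall>h. 0 \<le> h \<longrightarrow> h \<le> d \<longrightarrow> (case k of (e,t,s) \<Rightarrow>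
          0 \<le> t + s * h \<and> t + s * h \<le> L e \<and> ?g (pt e (t + s * h)) = ?g v + of_int (outgoing_slope G ?g k) * h)"
      proof
        fix k assume k: "k \<in> directions G v"
        obtain e t s where k': "k = (e,t,s)" by (metis prod_cases3)
        have e: "valid_dir (L e) t s" "pt e t = v" using k k' directions_iff by blast+
        obtain d1 where d1: "d1 > 0" "\<forall>h\<in>{0..d1}. ?g (pt e (t + s * h)) = ?g (pt e t) + of_int (outgoing_slope G ?g k) * h"
          using has_slope_dir[OF rg] k unfolding has_slope_ex k' by blast
        obtain d2 where d2: "d2 > 0" "\<forall>h\<in>{0<..d2}. 0 < t + s * h \<and> t + s * h < L e"
          using valid_dir_ev[OF e(1)] by blast
        have d2': "0 \<le> t + s * h \<and> t + s * h \<le> L e" if "0 \<le> h" "h \<le> d2" for h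
          using d2(2)[rule_format, of h] that valid_dir_range[OF e(1)] by (cases "h = 0") auto
        show "\<exists>d>0. \<forall>h. 0 \<le> h \<longrightarrow> h \<le> d \<longrightarrow> (case k of (e,t,s) \<Rightarrow>
          0 \<le> t + s * h \<and> t + s * h \<le> L e \<and> ?g (pt e (t + s * h)) = ?g v + of_int (outgoing_slope G ?g k) * h)"
          using d1 d2(1) d2' e(2) unfolding k' by (intro exI[of _ "min d1 d2"]) auto
      qed
      then obtain dd where dd0: "\<forall>k\<in>directions G v. dd k > 0 \<and> (\<forall>h. 0 \<le> h \<longrightarrow> h \<le> dd k \<longrightarrow> (case k of (e,t,s) \<Rightarrow>
          0 \<le> t + s * h \<and> t + s * h \<le> L e \<and> ?g (pt e (t + s * h)) = ?g v + of_int (outgoing_slope G ?g k) * h))"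
        by (rule bchoice[THEN exE])
      note dd = bspec[OF dd0]
      define r where "r = Min (insert r0 (dd ` directions G v)) / 2"
      have fin: "finite (insert r0 (dd ` directions G v))" using finite_directions by simp
      have Mp: "0 < Min (insert r0 (dd ` directions G v))" using fin dd r0(1) by auto
      have r: "0 < r" "r < r0" "\<And>k. k \<in> directions G v \<Longrightarrow> r \<le> dd k"
      proof -
        show "0 < r" unfolding r_def using Mp by simp
        show "r < r0" using Mp Min_le[OF fin, of r0] unfolding r_def by simp
        show "r \<le> dd k" if "k \<in> directions G v" for k
          using Mp Min_le[OF fin, of "dd k"] that unfolding r_def by simp
      qed
      define A where "A = {k\<in>directions G v. outgoing_slope G ?g k < 0}"
      have "{d \<in> directions G v. (case d of (e,t,s) \<Rightarrow> pt e (t + s * r)) \<notin> X} \<subseteq> A"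
      proof
        fix k assume "k \<in> {d \<in> directions G v. (case d of (e,t,s) \<Rightarrow> pt e (t + s * r)) \<notin> X}"
        moreover obtain e t s where k': "k = (e,t,s)" by (metis prod_cases3)
        ultimately have k: "k \<in> directions G v" "pt e (t + s * r) \<notin> X" by auto
        have e: "e \<in> edges G" "pt e t = v" using k k' directions_iff by blast+
        have "outgoing_slope G ?g k \<noteq> 0"
        proof
          assume z: "outgoing_slope G ?g k = 0"
          let ?I = "(\<lambda>h. pt e (t + s * h)) ` {0..r}"
          have "connected ?I"
            by (intro connected_continuous_image continuous_on_compose2[OF pt_continuous[of UNIV]])
              (auto intro!: continuous_intros)
          moreover have "?I \<subseteq> M"
          proof
            fix y assume "y \<in> ?I"
            then obtain h where h: "0 \<le> h" "h \<le> r" "y = pt e (t + s * h)" by auto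
            then have "0 \<le> t + s * h \<and> t + s * h \<le> L e \<and> ?g (pt e (t + s * h)) = ?g v"
              using dd[OF k(1)] r(3)[OF k(1)] z unfolding k' by auto
            then show "y \<in> M" using h(3) pt_curve[OF e(1)] vX X(1) unfolding M_def by auto
          qed
          moreover have "v \<in> ?I" using e(2) r(1) by (intro image_eqI[of _ _ 0]) auto
          ultimately have "?I \<subseteq> connected_component_set M v" by (intro connected_component_maximal) auto
          also have "\<dots> = X" unfolding X_def using vX connected_component_eq unfolding X_def by metis
          finally have "?I \<subseteq> X" .
          moreover have "pt e (t + s * r) \<in> ?I" using r(1) by (intro image_eqI[of _ _ r]) auto
          ultimately show False using k(2) by blast
        qed
        then show "k \<in> A" unfolding A_def using k(1) sl[OF k(1)] by auto
      qed
      then have "card {d \<in> directions G v. (case d of (e,t,s) \<Rightarrow> pt e (t + s * r)) \<notin> X} \<le> card A"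
        by (intro card_mono) (auto simp: A_def finite_directions)
      then have c: "out_degree G X v \<le> card A" using r0(2)[OF r(1,2)] S(2) by linarith
      have "ord G ?g v \<le> (\<Sum>k\<in>directions G v. if outgoing_slope G ?g k < 0 then -1 else 0)"
        unfolding ord_def using sl by (intro sum_mono) auto
      also have "\<dots> = (\<Sum>k\<in>A. -1)" unfolding A_def by (rule sum.inter_filter[symmetric, OF finite_directions])
      finally have "ord G ?g v \<le> - int (card A)" by simp
      moreover have "ord G ?g v = (D v + ord G f' v) - ?E v" unfolding ord_diff[OF rf' rf] by simp
      ultimately show False using in_R_nonneg[OF f', of v] v(2) c by linarith
    qed
    then have "?g x \<le> ?g P" using m(2)[OF x] unfolding M_def by auto
    then show ?thesis using x P by simp
  qed
  have "in_R D f"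
  proof (rule in_RI[OF D rf])
    fix x assume x: "x \<in> curve G"
    show "0 \<le> ?E x"
    proof (cases "x = P")
      case False then show ?thesis using red unfolding reduced_def by blast
    next
      case True
      \<comment> \<open>Reducedness gives no sign for the coefficient at \<open>P\<close>. There
        \<open>f' - f\<close> is largest, so its order is nonpositive and the coefficient is at
        least that of the effective divisor \<open>D + div f'\<close>.\<close>
      obtain f' where f': "in_R D f'" using ne by blast
      then have rf': "rational_fun G f'" unfolding in_R_def by simp
      let ?g = "\<lambda>x\<in>curve G. f' x - f x"
      have rg: "rational_fun G ?g" by (rule rational_diff[OF rf' rf])
      have "outgoing_slope G ?g k \<le> 0" if "k \<in> directions G P" for k
        using slope_le[OF rg, of "fst k" "fst (snd k)" "snd (snd k)" P] that key[OF f'] P by auto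
      then have "ord G ?g P \<le> 0" unfolding ord_def by (intro sum_nonpos) auto
      then show ?thesis using in_R_nonneg[OF f', of P] True unfolding ord_diff[OF rf' rf] by simp
    qed
  qed
  then show ?thesis unfolding maximal_def using key by (simp add: algebra_simps)
qed

end

section \<open>Ramps, and the first zero of finitely many affine functions\<close>

lemma mult_min_pos: "0 < m \<Longrightarrow> m * min p q = min (m * p) (m * q)" for m :: real
  by (simp add: min_def mult_le_cancel_left)

text \<open>A difference of two hinges, scaled by \<open>m\<close>, is a ramp of slope
  \<open>m\<close> over the distance \<open>\<delta> / m\<close>, hence of height
  \<open>\<delta>\<close>.\<close>

lemma ramp_up: "0 < m \<Longrightarrow> 0 \<le> \<delta> \<Longrightarrow>
    m * (max 0 (t - x) - max 0 (t - (x + \<delta> / m))) = min \<delta> (m * max 0 (t - x))" for t :: real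
proof -
  assume a: "0 < m" "0 \<le> \<delta>"
  then have q: "0 \<le> \<delta> / m" "\<delta> = m * (\<delta> / m)" by auto
  have "max 0 (t - x) - max 0 (t - (x + \<delta> / m)) = min (\<delta> / m) (max 0 (t - x))" using q(1) by auto
  also have "m * \<dots> = min (m * (\<delta> / m)) (m * max 0 (t - x))"
    by (rule mult_min_pos[OF a(1)])
  finally show ?thesis using a by simp
qed

text \<open>The descending ramp comes with the constant \<open>- \<delta>\<close>, which cancels
  against the value \<open>\<delta>\<close> at the start of an edge that begins on the side
  \<open>\<kappa> = 1\<close>.\<close>

lemma ramp_down: "0 < m \<Longrightarrow> 0 \<le> \<delta> \<Longrightarrow>
    m * (max 0 (t - x) - max 0 (t - (x - \<delta> / m))) = min \<delta> (m * max 0 (x - t)) - \<delta>" for t :: real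
proof -
  assume a: "0 < m" "0 \<le> \<delta>"
  then have q: "0 \<le> \<delta> / m" "\<delta> = m * (\<delta> / m)" by auto
  have "max 0 (t - x) - max 0 (t - (x - \<delta> / m)) = min (\<delta> / m) (max 0 (x - t)) - \<delta> / m" using q(1) by auto
  also have "m * \<dots> = min (m * (\<delta> / m)) (m * max 0 (x - t)) - m * (\<delta> / m)"
    by (simp only: right_diff_distrib mult_min_pos[OF a(1)])
  finally show ?thesis using a by simp
qed

text \<open>Each pair \<open>(a, k)\<close> stands for an affine function of the time that is
  positive at time 0. The decreasing ones vanish at \<open>a / (- k)\<close>, and the minimum of
  these times works.\<close>

lemma first_event:
  fixes I :: "(real \<times> real) set"
  assumes "finite I" "\<And>a k. (a,k) \<in> I \<Longrightarrow> 0 < a" "\<exists>(a,k)\<in>I. k < 0"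
  shows "\<exists>\<delta>>0. (\<forall>(a,k)\<in>I. 0 \<le> a + k * \<delta>) \<and> (\<forall>\<delta>'. 0 \<le> \<delta>' \<longrightarrow> \<delta>' < \<delta> \<longrightarrow> (\<forall>(a,k)\<in>I. 0 < a + k * \<delta>'))
     \<and> (\<exists>(a,k)\<in>I. a + k * \<delta> = 0)"
proof -
  let ?J = "{(a,k)\<in>I. k < 0}" and ?q = "\<lambda>(a,k). a / (- k)"
  define \<delta> where "\<delta> = Min (?q ` ?J)"
  have fin: "finite (?q ` ?J)" using assms(1) by (auto intro: finite_subset[of _ I])
  have ne: "?q ` ?J \<noteq> {}" using assms(3) by auto
  have pos: "0 < \<delta>" unfolding \<delta>_def using fin ne assms(2) by (auto simp: Min_gr_iff field_simps)
  have le: "\<delta> \<le> a / (- k)" if "(a,k) \<in> I" "k < 0" for a k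
    unfolding \<delta>_def using fin that by (intro Min_le) force+
  have A: "0 \<le> a + k * \<delta>" if "(a,k) \<in> I" for a k
  proof (cases "k < 0")
    case True then show ?thesis using le[OF that True] by (simp add: field_simps)
  next
    case False then show ?thesis using assms(2)[OF that] pos by (simp add: add_nonneg_nonneg)
  qed
  have B: "0 < a + k * \<delta>'" if "(a,k) \<in> I" "0 \<le> \<delta>'" "\<delta>' < \<delta>" for a k \<delta>'
  proof (cases "k < 0")
    case True
    then have "k * \<delta> < k * \<delta>'" using that by simp
    then show ?thesis using A[OF that(1)] by simp
  next
    case False then show ?thesis using assms(2)[OF that(1)] that by (simp add: add_pos_nonneg)
  qed
  have "\<delta> \<in> ?q ` ?J" unfolding \<delta>_def by (rule Min_in[OF fin ne])
  then obtain a k where "(a,k) \<in> I" "k < 0" "\<delta> = a / (- k)" by auto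
  then have C: "\<exists>(a,k)\<in>I. a + k * \<delta> = 0" by (intro bexI[of _ "(a,k)"]) (auto simp: field_simps)
  show ?thesis using pos A B C by (intro exI[of _ \<delta>]) blast
qed

context tcurve
begin

section \<open>Moving chips across cuts\<close>

definition chips :: "'v divisor \<Rightarrow> (('v \<times> 'v) \<times> real) set" where
  "chips E = {(e, t). e \<in> edges G \<and> 0 < t \<and> t < L e \<and> E (pt e t) \<noteq> 0}"

text \<open>Equivalently, the curve without the support points of \<open>E\<close> interior to edges is connected.\<close>

definition rigid :: "'v divisor \<Rightarrow> bool" where
  "rigid E \<longleftrightarrow> (\<forall>e x y. (e, x) \<in> chips E \<longrightarrow> (e, y) \<in> chips E \<longrightarrow> x = y) \<and>
     (\<forall>C. C \<noteq> {} \<longrightarrow> C \<noteq> UNIV \<longrightarrow> (\<exists>e\<in>edges G. (fst e \<in> C) \<noteq> (snd e \<in> C) \<and> (\<forall>t. (e, t) \<notin> chips E)))"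

text \<open>The chips in \<open>T\<close> separate the curve into two sides: \<open>\<kappa>\<close> is the indicator function of one side
  at the vertices, and \<open>\<sigma>\<close> is the direction in which a chip enters that side.  Two chips of \<open>T\<close> on
  the same edge cut out a segment on the side opposite to the ends of the edge.\<close>

definition is_cut :: "'v divisor \<Rightarrow> (('v \<times> 'v) \<times> real) set \<Rightarrow> (('v \<times> 'v) \<times> real \<Rightarrow> real) \<Rightarrow> ('v \<Rightarrow> real) \<Rightarrow> bool" where
  "is_cut E T \<sigma> \<kappa> \<longleftrightarrow> T \<noteq> {} \<and> T \<subseteq> chips E \<and> (\<forall>v. \<kappa> v = 0 \<or> \<kappa> v = 1) \<and> (\<forall>e\<in>edges G.
     ({x. (e, x) \<in> T} = {} \<and> \<kappa> (fst e) = \<kappa> (snd e)) \<or>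
     (\<exists>x. {x. (e, x) \<in> T} = {x} \<and> \<kappa> (fst e) \<noteq> \<kappa> (snd e) \<and> \<sigma> (e, x) = \<kappa> (snd e) - \<kappa> (fst e)) \<or>
     (\<exists>x y. x < y \<and> {x. (e, x) \<in> T} = {x, y} \<and> \<kappa> (fst e) = \<kappa> (snd e) \<and>
        \<sigma> (e, x) = 1 - 2 * \<kappa> (fst e) \<and> \<sigma> (e, y) = 2 * \<kappa> (fst e) - 1))"

definition target :: "'v divisor \<Rightarrow> (('v \<times> 'v) \<times> real \<Rightarrow> real) \<Rightarrow> real \<Rightarrow> ('v \<times> 'v) \<times> real \<Rightarrow> real" where
  "target E \<sigma> \<delta> = (\<lambda>(e, x). x + \<sigma> (e, x) * \<delta> / of_int (E (pt e x)))"

text \<open>Weak inequalities: moving chips may just have reached an end of their edge or each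
  other, but nothing has been crossed. The strict version describes the positions before a
  collision.\<close>

definition admissible :: "'v divisor \<Rightarrow> (('v \<times> 'v) \<times> real) set \<Rightarrow> (('v \<times> 'v) \<times> real \<Rightarrow> real) \<Rightarrow> real \<Rightarrow> bool" where
  "admissible E T \<sigma> \<delta> \<longleftrightarrow> 0 \<le> \<delta> \<and> (\<forall>e x. (e, x) \<in> T \<longrightarrow> 0 \<le> target E \<sigma> \<delta> (e, x) \<and> target E \<sigma> \<delta> (e, x) \<le> L e) \<and>
     (\<forall>e x y. (e, x) \<in> T \<longrightarrow> (e, y) \<in> T \<longrightarrow> x < y \<longrightarrow> target E \<sigma> \<delta> (e, x) \<le> target E \<sigma> \<delta> (e, y))"

definition strictly_admissible :: "'v divisor \<Rightarrow> (('v \<times> 'v) \<times> real) set \<Rightarrow> (('v \<times> 'v) \<times> real \<Rightarrow> real) \<Rightarrow> real \<Rightarrow> bool" where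
  "strictly_admissible E T \<sigma> \<delta> \<longleftrightarrow> 0 \<le> \<delta> \<and> (\<forall>e x. (e, x) \<in> T \<longrightarrow> 0 < target E \<sigma> \<delta> (e, x) \<and> target E \<sigma> \<delta> (e, x) < L e) \<and>
     (\<forall>e x y. (e, x) \<in> T \<longrightarrow> (e, y) \<in> T \<longrightarrow> x < y \<longrightarrow> target E \<sigma> \<delta> (e, x) < target E \<sigma> \<delta> (e, y))"

text \<open>Subtracting this function moves the chips of \<open>T\<close> into the side \<open>\<kappa> = 1\<close>, where it equals \<open>\<delta>\<close>
  away from \<open>T\<close>.  Its slope at a chip is the multiplicity \<open>m\<close>, so that all \<open>m\<close> chips travel together
  over the distance \<open>\<delta> / m\<close>.\<close>

definition cut_fun :: "'v divisor \<Rightarrow> (('v \<times> 'v) \<times> real) set \<Rightarrow> (('v \<times> 'v) \<times> real \<Rightarrow> real) \<Rightarrow> ('v \<Rightarrow> real) \<Rightarrow> real \<Rightarrow> 'v \<times> 'v \<Rightarrow> real \<Rightarrow> real" where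
  "cut_fun E T \<sigma> \<kappa> \<delta> e t = \<delta> * \<kappa> (fst e) +
     (\<Sum>x | (e, x) \<in> T. of_int (E (pt e x)) * (max 0 (t - x) - max 0 (t - target E \<sigma> \<delta> (e, x))))"

text \<open>The divisor \<open>E - div b\<close> for the function \<open>b\<close> given on edges by
  \<open>cut_fun\<close>: each chip of \<open>T\<close> is taken away and put back at its
  target.\<close>

definition moved :: "'v divisor \<Rightarrow> (('v \<times> 'v) \<times> real) set \<Rightarrow> (('v \<times> 'v) \<times> real \<Rightarrow> real) \<Rightarrow> real \<Rightarrow> 'v divisor" where
  "moved E T \<sigma> \<delta> z = E z - (\<Sum>(e, x)\<in>T. E (pt e x) * (of_bool (pt e x = z) - of_bool (pt e (target E \<sigma> \<delta> (e, x)) = z)))"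

lemma strictly_admissible_admissible: "strictly_admissible E T \<sigma> \<delta> \<Longrightarrow> admissible E T \<sigma> \<delta>"
  unfolding strictly_admissible_def admissible_def by (simp add: less_imp_le)

lemma chips_pt_inj: "inj_on (\<lambda>(e, t). pt e t) (chips E)"
proof (rule inj_onI)
  fix k k' assume *: "k \<in> chips E" "k' \<in> chips E" "(case k of (e,t) \<Rightarrow> pt e t) = (case k' of (e,t) \<Rightarrow> pt e t)"
  obtain e t e' t' where k: "k = (e,t)" "k' = (e',t')" by (metis surj_pair)
  show "k = k'" using pt_interior_eq[of e e' t t'] * unfolding k chips_def by auto
qed

lemma chips_finite: assumes "is_divisor G E" shows "finite (chips E)"
proof (rule finite_imageD[OF _ chips_pt_inj])
  have "(\<lambda>(e, t). pt e t) ` chips E \<subseteq> {x. E x \<noteq> 0}" unfolding chips_def by auto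
  then show "finite ((\<lambda>(e, t). pt e t) ` chips E)"
    using assms unfolding is_divisor_def by (meson finite_subset)
qed

lemma is_cut_opp: "is_cut E T \<sigma> \<kappa> \<Longrightarrow> is_cut E T (\<lambda>k. - \<sigma> k) (\<lambda>v. 1 - \<kappa> v)"
  unfolding is_cut_def
  apply (elim conjE, intro conjI)
     apply assumption
    apply assumption
   apply force
  apply (rule ballI, drule bspec, assumption)
  apply (elim disjE)
    apply simp
   apply fastforce
  apply (rule disjI2, rule disjI2)
  apply (elim exE)
  subgoal for e x y by (rule exI[of _ x], rule exI[of _ y]) auto
  done

text \<open>The possible shapes of a cut on one edge. With one chip the function is a single ramp
  towards the end where \<open>\<kappa>\<close> is 1. With two chips, \<open>inn\<close> has the
  segment between them on the side \<open>\<kappa> = 1\<close>, and \<open>out\<close> has it on the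
  other side. The functions for both directions of movement are given, so that they can be
  compared.\<close>

lemma cut_edge_cases:
  assumes cut: "is_cut E T \<sigma> \<kappa>" and E: "effective G E" and e: "e \<in> edges G"
  obtains
    (none) "{x. (e, x) \<in> T} = {}" "\<kappa> (fst e) = \<kappa> (snd e)"
      "\<And>\<delta> t. 0 \<le> \<delta> \<Longrightarrow> cut_fun E T \<sigma> \<kappa> \<delta> e t = \<delta> * \<kappa> (fst e)"
      "\<And>\<delta> t. 0 \<le> \<delta> \<Longrightarrow> cut_fun E T (\<lambda>k. - \<sigma> k) (\<lambda>v. 1 - \<kappa> v) \<delta> e t = \<delta> * (1 - \<kappa> (fst e))"
  | (up) x m where "{x. (e, x) \<in> T} = {x}" "0 < m" "m = of_int (E (pt e x))" "\<kappa> (fst e) = 0" "\<kappa> (snd e) = 1" "\<sigma> (e, x) = 1"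
      "\<And>\<delta> t. 0 \<le> \<delta> \<Longrightarrow> cut_fun E T \<sigma> \<kappa> \<delta> e t = min \<delta> (m * max 0 (t - x))"
      "\<And>\<delta> t. 0 \<le> \<delta> \<Longrightarrow> cut_fun E T (\<lambda>k. - \<sigma> k) (\<lambda>v. 1 - \<kappa> v) \<delta> e t = min \<delta> (m * max 0 (x - t))"
  | (down) x m where "{x. (e, x) \<in> T} = {x}" "0 < m" "m = of_int (E (pt e x))" "\<kappa> (fst e) = 1" "\<kappa> (snd e) = 0" "\<sigma> (e, x) = -1"
      "\<And>\<delta> t. 0 \<le> \<delta> \<Longrightarrow> cut_fun E T \<sigma> \<kappa> \<delta> e t = min \<delta> (m * max 0 (x - t))"
      "\<And>\<delta> t. 0 \<le> \<delta> \<Longrightarrow> cut_fun E T (\<lambda>k. - \<sigma> k) (\<lambda>v. 1 - \<kappa> v) \<delta> e t = min \<delta> (m * max 0 (t - x))"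
  | (inn) x y m n where "x < y" "{x. (e, x) \<in> T} = {x, y}" "0 < m" "0 < n" "m = of_int (E (pt e x))" "n = of_int (E (pt e y))"
      "\<kappa> (fst e) = 0" "\<kappa> (snd e) = 0" "\<sigma> (e, x) = 1" "\<sigma> (e, y) = -1"
      "\<And>\<delta> t. 0 \<le> \<delta> \<Longrightarrow> cut_fun E T \<sigma> \<kappa> \<delta> e t = min \<delta> (m * max 0 (t - x)) + min \<delta> (n * max 0 (y - t)) - \<delta>"
      "\<And>\<delta> t. 0 \<le> \<delta> \<Longrightarrow> cut_fun E T (\<lambda>k. - \<sigma> k) (\<lambda>v. 1 - \<kappa> v) \<delta> e t = min \<delta> (m * max 0 (x - t)) + min \<delta> (n * max 0 (t - y))"
  | (out) x y m n where "x < y" "{x. (e, x) \<in> T} = {x, y}" "0 < m" "0 < n" "m = of_int (E (pt e x))" "n = of_int (E (pt e y))"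
      "\<kappa> (fst e) = 1" "\<kappa> (snd e) = 1" "\<sigma> (e, x) = -1" "\<sigma> (e, y) = 1"
      "\<And>\<delta> t. 0 \<le> \<delta> \<Longrightarrow> cut_fun E T \<sigma> \<kappa> \<delta> e t = min \<delta> (m * max 0 (x - t)) + min \<delta> (n * max 0 (t - y))"
      "\<And>\<delta> t. 0 \<le> \<delta> \<Longrightarrow> cut_fun E T (\<lambda>k. - \<sigma> k) (\<lambda>v. 1 - \<kappa> v) \<delta> e t = min \<delta> (m * max 0 (t - x)) + min \<delta> (n * max 0 (y - t)) - \<delta>"
proof -
  have pos: "0 < (of_int (E (pt e x)) :: real)" if "(e, x) \<in> T" for x
  proof -
    have "(e, x) \<in> chips E" using that cut unfolding is_cut_def by blast
    then have "E (pt e x) \<noteq> 0" unfolding chips_def by simp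
    moreover have "0 \<le> E (pt e x)" using E unfolding effective_def by blast
    ultimately show ?thesis by simp
  qed
  have chi: "\<kappa> v = 0 \<or> \<kappa> v = 1" for v using cut unfolding is_cut_def by blast
  have "({x. (e, x) \<in> T} = {} \<and> \<kappa> (fst e) = \<kappa> (snd e)) \<or>
     (\<exists>x. {x. (e, x) \<in> T} = {x} \<and> \<kappa> (fst e) \<noteq> \<kappa> (snd e) \<and> \<sigma> (e, x) = \<kappa> (snd e) - \<kappa> (fst e)) \<or>
     (\<exists>x y. x < y \<and> {x. (e, x) \<in> T} = {x, y} \<and> \<kappa> (fst e) = \<kappa> (snd e) \<and>
        \<sigma> (e, x) = 1 - 2 * \<kappa> (fst e) \<and> \<sigma> (e, y) = 2 * \<kappa> (fst e) - 1)"
    using cut e unfolding is_cut_def by blast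
  then show thesis
  proof (elim disjE exE conjE)
    assume "{x. (e, x) \<in> T} = {}" "\<kappa> (fst e) = \<kappa> (snd e)"
    then show thesis by (intro none) (auto simp: cut_fun_def)
  next
    fix x assume a: "{x. (e, x) \<in> T} = {x}" "\<kappa> (fst e) \<noteq> \<kappa> (snd e)" "\<sigma> (e, x) = \<kappa> (snd e) - \<kappa> (fst e)"
    have xT: "(e, x) \<in> T" using a(1) by auto
    note r = ramp_up[OF pos[OF xT]] ramp_down[OF pos[OF xT]]
    consider "\<kappa> (fst e) = 0" "\<kappa> (snd e) = 1" | "\<kappa> (fst e) = 1" "\<kappa> (snd e) = 0" using chi a(2) by metis
    then show thesis
    proof cases
      case 1
      show thesis by (rule up[OF a(1) pos[OF xT] refl 1]) (use a 1 r in \<open>simp_all add: cut_fun_def target_def\<close>)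
    next
      case 2
      show thesis by (rule down[OF a(1) pos[OF xT] refl 2]) (use a 2 r in \<open>simp_all add: cut_fun_def target_def\<close>)
    qed
  next
    fix x y assume a: "x < y" "{x. (e, x) \<in> T} = {x, y}" "\<kappa> (fst e) = \<kappa> (snd e)"
        "\<sigma> (e, x) = 1 - 2 * \<kappa> (fst e)" "\<sigma> (e, y) = 2 * \<kappa> (fst e) - 1"
    have xT: "(e, x) \<in> T" "(e, y) \<in> T" using a(2) by auto
    have ne: "x \<noteq> y" using a(1) by simp
    note r = ramp_up[OF pos[OF xT(1)]] ramp_down[OF pos[OF xT(1)]] ramp_up[OF pos[OF xT(2)]] ramp_down[OF pos[OF xT(2)]]
    show thesis
    proof (cases "\<kappa> (fst e) = 0")
      case True
      show thesis by (rule inn[OF a(1,2) pos[OF xT(1)] pos[OF xT(2)] refl refl])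
         (use a(3-5) True r ne in \<open>simp_all add: cut_fun_def target_def a(2)\<close>)
    next
      case False
      then have c: "\<kappa> (fst e) = 1" using chi by blast
      show thesis by (rule out[OF a(1,2) pos[OF xT(1)] pos[OF xT(2)] refl refl])
         (use a(3-5) c r ne in \<open>simp_all add: cut_fun_def target_def a(2)\<close>)
    qed
  qed
qed

text \<open>The ramps from \<open>x\<close> and \<open>y\<close> end before they cross, so at every
  \<open>t\<close> at least one of them has full height \<open>\<delta>\<close>. Outside the segment
  one has full height and the other is 0.\<close>

lemma inn_nonneg:
  fixes m n :: real
  assumes "0 < m" "0 < n" "x + \<delta> / m \<le> y - \<delta> / n" "0 \<le> \<delta>"
  shows "0 \<le> min \<delta> (m * max 0 (t - x)) + min \<delta> (n * max 0 (y - t)) - \<delta>"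
    "t \<le> x \<or> y \<le> t \<Longrightarrow> min \<delta> (m * max 0 (t - x)) + min \<delta> (n * max 0 (y - t)) - \<delta> = 0"
proof -
  have a: "0 \<le> \<delta> / m" "0 \<le> \<delta> / n" using assms by auto
  have up: "min \<delta> (m * max 0 (t - x)) = \<delta>" if "x + \<delta> / m \<le> t" for t
  proof -
    have "\<delta> / m \<le> t - x" using that by simp
    then have "\<delta> \<le> m * (t - x)" using assms(1) by (simp add: field_simps)
    moreover have "max 0 (t - x) = t - x" using that a by linarith
    ultimately show ?thesis by simp
  qed
  have dn: "min \<delta> (n * max 0 (y - t)) = \<delta>" if "t \<le> y - \<delta> / n" for t
  proof -
    have "\<delta> / n \<le> y - t" using that by simp
    then have "\<delta> \<le> n * (y - t)" using assms(2) by (simp add: field_simps)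
    moreover have "max 0 (y - t) = y - t" using that a by linarith
    ultimately show ?thesis by simp
  qed
  have nn: "0 \<le> min \<delta> (m * max 0 (t - x))" "0 \<le> min \<delta> (n * max 0 (y - t))" for t using assms by auto
  show "0 \<le> min \<delta> (m * max 0 (t - x)) + min \<delta> (n * max 0 (y - t)) - \<delta>"
  proof (cases "t \<le> y - \<delta> / n")
    case True then show ?thesis using dn[OF True] nn[of t] by linarith
  next
    case False then show ?thesis using up[of t] nn[of t] assms(3) by linarith
  qed
  show "min \<delta> (m * max 0 (t - x)) + min \<delta> (n * max 0 (y - t)) - \<delta> = 0" if "t \<le> x \<or> y \<le> t"
    using that
  proof
    assume t: "t \<le> x"
    then have z: "max 0 (t - x) = 0" by simp
    have "t \<le> y - \<delta> / n" using t assms(3) a by linarith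
    from dn[OF this] show ?thesis unfolding z using assms(4) by simp
  next
    assume t: "y \<le> t"
    then have z: "max 0 (y - t) = 0" by simp
    have "x + \<delta> / m \<le> t" using t assms(3) a by linarith
    from up[OF this] show ?thesis unfolding z using assms(4) by simp
  qed
qed

lemma cut_fun_range:
  assumes cut: "is_cut E T \<sigma> \<kappa>" and E: "effective G E" and e: "e \<in> edges G" and admissible: "admissible E T \<sigma> \<delta>"
  shows "0 \<le> cut_fun E T \<sigma> \<kappa> \<delta> e t \<and> cut_fun E T \<sigma> \<kappa> \<delta> e t \<le> \<delta>"
proof -
  have d: "0 \<le> \<delta>" using admissible unfolding admissible_def by simp
  from cut E e show ?thesis
  proof (cases rule: cut_edge_cases)
    case none
    have "\<kappa> (fst e) = 0 \<or> \<kappa> (fst e) = 1" using cut unfolding is_cut_def by blast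
    then show ?thesis using none(3)[OF d] d by auto
  next
    case (up x m) then show ?thesis using up(7)[OF d] d by simp
  next
    case (down x m) then show ?thesis using down(7)[OF d] d by simp
  next
    case (inn x y m n)
    have "(e,x) \<in> T" "(e,y) \<in> T" using inn(2) by auto
    then have "target E \<sigma> \<delta> (e,x) \<le> target E \<sigma> \<delta> (e,y)" using admissible inn(1) unfolding admissible_def by blast
    then have "x + \<delta> / m \<le> y - \<delta> / n" using inn unfolding target_def by simp
    then show ?thesis using inn_nonneg(1)[OF inn(3,4)] inn(11)[OF d] d by auto
  next
    case (out x y m n)
    have "m * max 0 (x - t) = 0 \<or> n * max 0 (t - y) = 0" using out(1) by auto
    then show ?thesis using out(3,4) out(11)[OF d, of t] d by auto
  qed
qed

text \<open>Each of the two functions is positive only on its own side of the cut. Hence at every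
  point one of the two moved functions still agrees with the old one, and the old one is their
  maximum.\<close>

lemma cut_fun_disjoint:
  assumes cut: "is_cut E T \<sigma> \<kappa>" and E: "effective G E" and e: "e \<in> edges G"
    and admissible: "admissible E T \<sigma> \<delta>" "admissible E T (\<lambda>k. - \<sigma> k) \<delta>'"
  shows "cut_fun E T \<sigma> \<kappa> \<delta> e t = 0 \<or> cut_fun E T (\<lambda>k. - \<sigma> k) (\<lambda>v. 1 - \<kappa> v) \<delta>' e t = 0"
proof -
  have d: "0 \<le> \<delta>" "0 \<le> \<delta>'" using admissible unfolding admissible_def by simp_all
  from cut E e show ?thesis
  proof (cases rule: cut_edge_cases)
    case none
    have "\<kappa> (fst e) = 0 \<or> \<kappa> (fst e) = 1" using cut unfolding is_cut_def by blast
    then show ?thesis using none(3)[OF d(1)] none(4)[OF d(2)] by auto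
  next
    case (up x m) then show ?thesis using up(7)[OF d(1)] up(8)[OF d(2)] d by (cases "t \<le> x") auto
  next
    case (down x m) then show ?thesis using down(7)[OF d(1)] down(8)[OF d(2)] d by (cases "t \<le> x") auto
  next
    case (inn x y m n)
    have "(e,x) \<in> T" "(e,y) \<in> T" using inn(2) by auto
    then have "target E \<sigma> \<delta> (e,x) \<le> target E \<sigma> \<delta> (e,y)" using admissible inn(1) unfolding admissible_def by blast
    then have "x + \<delta> / m \<le> y - \<delta> / n" using inn unfolding target_def by simp
    note z = inn_nonneg(2)[OF inn(3,4) this d(1), of t]
    show ?thesis
    proof (cases "t \<le> x \<or> y \<le> t")
      case True
      then show ?thesis using z unfolding inn(11)[OF d(1)] by (intro disjI1)
    next
      case False
      then have "max 0 (x - t) = 0" "max 0 (t - y) = 0" by auto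
      then show ?thesis using inn(11)[OF d(1), of t] inn(12)[OF d(2), of t] d by simp
    qed
  next
    case (out x y m n)
    have "(e,x) \<in> T" "(e,y) \<in> T" using out(2) by auto
    then have "target E (\<lambda>k. - \<sigma> k) \<delta>' (e,x) \<le> target E (\<lambda>k. - \<sigma> k) \<delta>' (e,y)" using admissible out(1) unfolding admissible_def by blast
    then have "x + \<delta>' / m \<le> y - \<delta>' / n" using out unfolding target_def by simp
    note z = inn_nonneg(2)[OF out(3,4) this d(2), of t]
    show ?thesis
    proof (cases "t \<le> x \<or> y \<le> t")
      case True
      then show ?thesis using z unfolding out(12)[OF d(2)] by (intro disjI2)
    next
      case False
      then have "max 0 (x - t) = 0" "max 0 (t - y) = 0" by auto
      then show ?thesis using out(11)[OF d(1), of t] out(12)[OF d(2), of t] d by simp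
    qed
  qed
qed

lemma cut_fun_T_zero:
  assumes cut: "is_cut E T \<sigma> \<kappa>" and E: "effective G E" and z: "(e, z) \<in> T" and admissible: "admissible E T \<sigma> \<delta>"
  shows "cut_fun E T \<sigma> \<kappa> \<delta> e z = 0"
proof -
  have d: "0 \<le> \<delta>" using admissible unfolding admissible_def by simp
  have e: "e \<in> edges G" using cut z unfolding is_cut_def chips_def by auto
  have z': "z \<in> {x. (e, x) \<in> T}" using z by simp
  from cut E e show ?thesis
  proof (cases rule: cut_edge_cases)
    case none then show ?thesis using z' by simp
  next
    case (up x m) then show ?thesis using z' up(7)[OF d, of z] d by simp
  next
    case (down x m) then show ?thesis using z' down(7)[OF d, of z] d by simp
  next
    case (inn x y m n)
    have "(e,x) \<in> T" "(e,y) \<in> T" using inn(2) by auto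
    then have "target E \<sigma> \<delta> (e,x) \<le> target E \<sigma> \<delta> (e,y)" using admissible inn(1) unfolding admissible_def by blast
    then have "x + \<delta> / m \<le> y - \<delta> / n" using inn unfolding target_def by simp
    from inn_nonneg(2)[OF inn(3,4) this d, of z] show ?thesis using inn(11)[OF d, of z] z' inn(2) by auto
  next
    case (out x y m n)
    then show ?thesis using out(11)[OF d, of z] z' d by auto
  qed
qed

lemma cut_finite: "is_cut E T \<sigma> \<kappa> \<Longrightarrow> is_divisor G E \<Longrightarrow> finite T"
  using chips_finite finite_subset unfolding is_cut_def by blast

lemma cut_fibre_finite: "finite T \<Longrightarrow> finite {x. (e, x) \<in> T}"
  by (rule finite_subset[of _ "snd ` T"]) force+

lemma cut_sigma_sum:
  assumes cut: "is_cut E T \<sigma> \<kappa>" and E: "effective G E" and e: "e \<in> edges G"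
  shows "(\<Sum>x | (e, x) \<in> T. \<sigma> (e, x)) = \<kappa> (snd e) - \<kappa> (fst e)"
  using cut E e by (cases rule: cut_edge_cases) auto

lemma cut_chip:
  assumes cut: "is_cut E T \<sigma> \<kappa>" and E: "effective G E" and k: "(e, x) \<in> T"
  shows "e \<in> edges G" "0 < x" "x < L e" "0 < E (pt e x)" "\<sigma> (e, x) = 1 \<or> \<sigma> (e, x) = -1"
proof -
  have c: "(e, x) \<in> chips E" using cut k unfolding is_cut_def by blast
  then show e: "e \<in> edges G" and "0 < x" "x < L e" unfolding chips_def by auto
  have "0 \<le> E (pt e x)" using E unfolding effective_def by blast
  then show "0 < E (pt e x)" using c unfolding chips_def by auto
  have k': "x \<in> {x. (e, x) \<in> T}" using k by simp
  from cut E e show "\<sigma> (e, x) = 1 \<or> \<sigma> (e, x) = -1"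
    by (cases rule: cut_edge_cases) (use k' in auto)
qed

section \<open>The divisor after a move\<close>

text \<open>On an edge the signed heights \<open>\<delta> * \<sigma>\<close> of the ramps add up to
  \<open>\<delta>\<close> times the change of \<open>\<kappa>\<close>, so the edge functions fit
  together at the vertices. A ramp, being a difference of hinges, contributes its multiplicity
  positively at the chip and negatively at the target.\<close>

lemma move_fun:
  assumes cut: "is_cut E T \<sigma> \<kappa>" and E: "effective G E" and admissible: "admissible E T \<sigma> \<delta>"
  obtains b where "rational_fun G b" "\<And>v. b (vx v) = \<delta> * \<kappa> v"
    "\<And>e t. e \<in> edges G \<Longrightarrow> 0 \<le> t \<Longrightarrow> t \<le> L e \<Longrightarrow> b (pt e t) = cut_fun E T \<sigma> \<kappa> \<delta> e t"
    "\<And>z. E z - ord G b z = moved E T \<sigma> \<delta> z"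
proof -
  note T = cut_chip[OF cut E]
  have finT: "finite T" using cut_finite[OF cut] E unfolding effective_def by simp
  have mvr: "0 \<le> target E \<sigma> \<delta> (e, x)" "target E \<sigma> \<delta> (e, x) \<le> L e" if "(e,x) \<in> T" for e x
    using admissible that unfolding admissible_def by blast+
  have loc: "locally_linear l (cut_fun E T \<sigma> \<kappa> \<delta> e)" for l e
    unfolding cut_fun_def by (intro locally_linear_intros)
  obtain b where b: "rational_fun G b" "\<And>v. b (vx v) = \<delta> * \<kappa> v"
    "\<And>e t. e \<in> edges G \<Longrightarrow> 0 \<le> t \<Longrightarrow> t \<le> L e \<Longrightarrow> b (pt e t) = cut_fun E T \<sigma> \<kappa> \<delta> e t"
  proof (rule rational_glue[of "cut_fun E T \<sigma> \<kappa> \<delta>" "\<lambda>v. \<delta> * \<kappa> v"])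
    fix e assume e: "e \<in> edges G"
    have "(\<Sum>x | (e, x) \<in> T. of_int (E (pt e x)) * (max 0 (0 - x) - max 0 (0 - target E \<sigma> \<delta> (e, x)))) = 0"
    proof (rule sum.neutral, rule ballI)
      fix x assume "x \<in> {x. (e, x) \<in> T}"
      then have x: "(e, x) \<in> T" by simp
      then have "0 < x" "0 \<le> target E \<sigma> \<delta> (e, x)" using T(2) mvr(1) by auto
      then show "of_int (E (pt e x)) * (max 0 (0 - x) - max 0 (0 - target E \<sigma> \<delta> (e, x))) = 0" by simp
    qed
    then show "cut_fun E T \<sigma> \<kappa> \<delta> e 0 = \<delta> * \<kappa> (fst e)" unfolding cut_fun_def by simp
    have "(\<Sum>x | (e, x) \<in> T. of_int (E (pt e x)) * (max 0 (L e - x) - max 0 (L e - target E \<sigma> \<delta> (e, x))))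
       = (\<Sum>x | (e, x) \<in> T. \<delta> * \<sigma> (e, x))"
    proof (rule sum.cong[OF refl])
      fix x assume "x \<in> {x. (e, x) \<in> T}"
      then have x: "(e, x) \<in> T" by simp
      have "max 0 (L e - x) - max 0 (L e - target E \<sigma> \<delta> (e, x)) = \<sigma> (e, x) * \<delta> / of_int (E (pt e x))"
        using T(3)[OF x] mvr[OF x] unfolding target_def by simp
      then show "of_int (E (pt e x)) * (max 0 (L e - x) - max 0 (L e - target E \<sigma> \<delta> (e, x))) = \<delta> * \<sigma> (e, x)"
        using T(4)[OF x] by (simp add: field_simps)
    qed
    also have "\<dots> = \<delta> * (\<kappa> (snd e) - \<kappa> (fst e))"
      unfolding sum_distrib_left[symmetric] cut_sigma_sum[OF cut E e] ..
    finally show "cut_fun E T \<sigma> \<kappa> \<delta> e (L e) = \<delta> * \<kappa> (snd e)" unfolding cut_fun_def by (simp add: algebra_simps)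
  qed (use loc in auto)
  define c where "c e t x = E (pt e x) * (of_bool (t = x) - of_bool (t = target E \<sigma> \<delta> (e, x)))" for e t x
  have "E z - ord G b z = moved E T \<sigma> \<delta> z" for z
  proof -
    have "ord G b z = (\<Sum>(e,t)\<in>params z. \<Sum>k\<in>T. if fst k = e then c e t (snd k) else 0)"
    proof (rule ord_slope_sum_cong)
      fix e t assume e: "e \<in> edges G" "0 \<le> t" "t \<le> L e"
      have "slope_sum (L e) (\<lambda>t. b (pt e t)) t = slope_sum (L e) (cut_fun E T \<sigma> \<kappa> \<delta> e) t"
        by (rule slope_sum_cong) (use e b in auto)
      also have "\<dots> = slope_sum (L e) (\<lambda>t. \<delta> * \<kappa> (fst e)) t +
           slope_sum (L e) (\<lambda>t. \<Sum>x | (e, x) \<in> T. of_int (E (pt e x)) * (max 0 (t - x) - max 0 (t - target E \<sigma> \<delta> (e, x)))) t"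
        unfolding cut_fun_def by (rule slope_sum_add) (use e in \<open>auto intro!: locally_linear_intros\<close>)
      also have "\<dots> = (\<Sum>x | (e, x) \<in> T. slope_sum (L e) (\<lambda>t. of_int (E (pt e x)) * (max 0 (t - x) - max 0 (t - target E \<sigma> \<delta> (e, x)))) t)"
        unfolding slope_sum_const by (subst slope_sum_sum) (use e in \<open>auto intro!: locally_linear_intros\<close>)
      also have "\<dots> = (\<Sum>x | (e, x) \<in> T. c e t x)"
      proof (rule sum.cong[OF refl])
        fix x assume "x \<in> {x. (e, x) \<in> T}"
        then have x: "(e, x) \<in> T" by simp
        have "slope_sum (L e) (\<lambda>t. of_int (E (pt e x)) * (max 0 (t - x) - max 0 (t - target E \<sigma> \<delta> (e, x)))) t
          = E (pt e x) * slope_sum (L e) (\<lambda>t. max 0 (t - x) - max 0 (t - target E \<sigma> \<delta> (e, x))) t"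
          by (rule slope_sum_cmult) (use e in \<open>auto intro!: locally_linear_intros\<close>)
        also have "slope_sum (L e) (\<lambda>t. max 0 (t - x) - max 0 (t - target E \<sigma> \<delta> (e, x))) t
          = slope_sum (L e) (\<lambda>t. max 0 (t - x)) t - slope_sum (L e) (\<lambda>t. max 0 (t - target E \<sigma> \<delta> (e, x))) t"
          by (rule slope_sum_diff) (use e in \<open>auto intro!: locally_linear_intros\<close>)
        also have "\<dots> = of_bool (t = x) - of_bool (t = target E \<sigma> \<delta> (e, x))"
          using slope_sum_hinge[OF L_pos[OF e(1)] _ _ e(2,3)] T(2,3)[OF x] mvr[OF x] by simp
        finally show "slope_sum (L e) (\<lambda>t. of_int (E (pt e x)) * (max 0 (t - x) - max 0 (t - target E \<sigma> \<delta> (e, x)))) t = c e t x"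
          unfolding c_def .
      qed
      also have "\<dots> = (\<Sum>k\<in>Pair e ` {x. (e, x) \<in> T}. c e t (snd k))"
        by (subst sum.reindex) (auto simp: inj_on_def)
      also have "\<dots> = (\<Sum>k\<in>T. if fst k = e then c e t (snd k) else 0)"
        by (rule sum.mono_neutral_cong_left[OF finT]) force+
      finally show "slope_sum (L e) (\<lambda>t. b (pt e t)) t = (\<Sum>k\<in>T. if fst k = e then c e t (snd k) else 0)" .
    qed
    also have "\<dots> = (\<Sum>k\<in>T. \<Sum>(e,t)\<in>params z. if fst k = e then c e t (snd k) else 0)"
      unfolding split_def by (rule sum.swap)
    also have "\<dots> = (\<Sum>(e,x)\<in>T. E (pt e x) * (of_bool (pt e x = z) - of_bool (pt e (target E \<sigma> \<delta> (e, x)) = z)))"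
    proof (rule sum.cong[OF refl])
      fix k assume k: "k \<in> T"
      obtain e x where k': "k = (e,x)" by (metis surj_pair)
      have kT: "(e,x) \<in> T" using k k' by simp
      \<comment> \<open>A target may be a vertex, which has a parameter on each incident edge;
        exactly the parameter on \<open>e\<close> counts.\<close>
      have one: "(\<Sum>(e',t)\<in>params z. of_bool (e = e' \<and> t = y)) = (of_bool (pt e y = z) :: int)" if "0 \<le> y" "y \<le> L e" for y
      proof -
        have "(\<Sum>(e',t)\<in>params z. of_bool (e = e' \<and> t = y)) = (\<Sum>p\<in>params z. if p = (e, y) then 1 else (0::int))"
          by (rule sum.cong) auto
        also have "\<dots> = (if (e, y) \<in> params z then 1 else 0)" using finite_params by (simp add: sum.delta)
        also have "\<dots> = of_bool (pt e y = z)" using T(1)[OF kT] that unfolding params_def by simp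
        finally show ?thesis .
      qed
      have "(\<Sum>(e',t)\<in>params z. if fst k = e' then c e' t (snd k) else 0) =
        (\<Sum>(e',t)\<in>params z. E (pt e x) * (of_bool (e = e' \<and> t = x) - of_bool (e = e' \<and> t = target E \<sigma> \<delta> (e, x))))"
        unfolding k' c_def by (rule sum.cong) auto
      also have "\<dots> = E (pt e x) * ((\<Sum>(e',t)\<in>params z. of_bool (e = e' \<and> t = x)) - (\<Sum>(e',t)\<in>params z. of_bool (e = e' \<and> t = target E \<sigma> \<delta> (e, x))))"
        unfolding split_def sum_subtractf[symmetric] sum_distrib_left ..
      also have "\<dots> = E (pt e x) * (of_bool (pt e x = z) - of_bool (pt e (target E \<sigma> \<delta> (e, x)) = z))"
        using one T(2,3)[OF kT] mvr[OF kT] by simp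
      finally show "(\<Sum>(e',t)\<in>params z. if fst k = e' then c e' t (snd k) else 0) =
         (case k of (e,x) \<Rightarrow> E (pt e x) * (of_bool (pt e x = z) - of_bool (pt e (target E \<sigma> \<delta> (e, x)) = z)))"
        unfolding k' by simp
    qed
    finally show ?thesis unfolding moved_def by simp
  qed
  then show thesis using that b by blast
qed

text \<open>A form with visibly nonnegative terms for effective \<open>E\<close>: distinct chips are
  distinct points, and each is moved with its full multiplicity, so coefficient 0 remains at its old
  place.\<close>

lemma moved_eq:
  assumes cut: "is_cut E T \<sigma> \<kappa>" and E: "effective G E"
  shows "moved E T \<sigma> \<delta> z = (if z \<in> (\<lambda>(e,x). pt e x) ` T then 0 else E z) +
     (\<Sum>(e, x)\<in>T. E (pt e x) * of_bool (pt e (target E \<sigma> \<delta> (e, x)) = z))"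
proof -
  have finT: "finite T" using cut_finite[OF cut] E unfolding effective_def by simp
  have inj: "inj_on (\<lambda>(e,x). pt e x) T"
    using chips_pt_inj inj_on_subset cut unfolding is_cut_def by blast
  have "(\<Sum>(e,x)\<in>T. E (pt e x) * of_bool (pt e x = z)) = (\<Sum>k\<in>T. (\<lambda>y. E y * of_bool (y = z)) ((\<lambda>(e,x). pt e x) k))"
    by (rule sum.cong) auto
  also have "\<dots> = (\<Sum>y\<in>(\<lambda>(e,x). pt e x) ` T. E y * of_bool (y = z))"
    by (rule sum.reindex[OF inj, symmetric, unfolded comp_def])
  also have "\<dots> = (\<Sum>y\<in>(\<lambda>(e,x). pt e x) ` T. if y = z then E z else 0)" by (rule sum.cong) auto
  also have "\<dots> = (if z \<in> (\<lambda>(e,x). pt e x) ` T then E z else 0)" using finT by (simp add: sum.delta')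
  finally have "(\<Sum>(e,x)\<in>T. E (pt e x) * of_bool (pt e x = z)) = (if z \<in> (\<lambda>(e,x). pt e x) ` T then E z else 0)" .
  moreover have "(\<Sum>(e, x)\<in>T. E (pt e x) * (of_bool (pt e x = z) - of_bool (pt e (target E \<sigma> \<delta> (e, x)) = z)))
     = (\<Sum>(e,x)\<in>T. E (pt e x) * of_bool (pt e x = z)) - (\<Sum>(e, x)\<in>T. E (pt e x) * of_bool (pt e (target E \<sigma> \<delta> (e, x)) = z))"
    unfolding split_def sum_subtractf[symmetric] by (simp add: right_diff_distrib)
  ultimately show ?thesis unfolding moved_def by auto
qed

lemma moved_nonneg:
  assumes cut: "is_cut E T \<sigma> \<kappa>" and E: "effective G E"
  shows "0 \<le> moved E T \<sigma> \<delta> z"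
proof -
  have "0 \<le> E y" for y using E unfolding effective_def by blast
  then show ?thesis unfolding moved_eq[OF cut E] by (auto intro!: add_nonneg_nonneg sum_nonneg)
qed

lemma chips_moved:
  assumes cut: "is_cut E T \<sigma> \<kappa>" and E: "effective G E" and admissible: "admissible E T \<sigma> \<delta>"
  shows "chips (moved E T \<sigma> \<delta>) \<subseteq> (chips E - T) \<union> {(e, target E \<sigma> \<delta> (e, x)) | e x. (e, x) \<in> T \<and> 0 < target E \<sigma> \<delta> (e, x) \<and> target E \<sigma> \<delta> (e, x) < L e}"
proof
  fix k assume k: "k \<in> chips (moved E T \<sigma> \<delta>)"
  obtain e t where k': "k = (e,t)" by (metis surj_pair)
  have e: "e \<in> edges G" "0 < t" "t < L e" "moved E T \<sigma> \<delta> (pt e t) \<noteq> 0" using k unfolding k' chips_def by auto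
  show "k \<in> (chips E - T) \<union> {(e, target E \<sigma> \<delta> (e, x)) | e x. (e, x) \<in> T \<and> 0 < target E \<sigma> \<delta> (e, x) \<and> target E \<sigma> \<delta> (e, x) < L e}"
  proof (cases "\<exists>e' x. (e',x) \<in> T \<and> pt e' (target E \<sigma> \<delta> (e', x)) = pt e t")
    case True
    then obtain e' x where x: "(e',x) \<in> T" "pt e' (target E \<sigma> \<delta> (e', x)) = pt e t" by blast
    have "e = e' \<and> t = target E \<sigma> \<delta> (e', x)"
    proof (rule pt_interior_eq[OF e(1) cut_chip(1)[OF cut E x(1)] e(2,3)])
      show "0 \<le> target E \<sigma> \<delta> (e', x)" "target E \<sigma> \<delta> (e', x) \<le> L e'" using admissible x(1) unfolding admissible_def by blast+
    qed (use x(2) in simp)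
    then show ?thesis using x(1) e(2,3) unfolding k' by blast
  next
    case False
    then have "(\<Sum>(e', x)\<in>T. E (pt e' x) * of_bool (pt e' (target E \<sigma> \<delta> (e', x)) = pt e t)) = 0"
      by (intro sum.neutral) auto
    then have "pt e t \<notin> (\<lambda>(e,x). pt e x) ` T" "E (pt e t) \<noteq> 0"
      using e(4) unfolding moved_eq[OF cut E] by (auto split: if_splits)
    then show ?thesis unfolding k' chips_def using e by force
  qed
qed

section \<open>The first collision\<close>

text \<open>Only the ends of the edges and the chips of \<open>T\<close> themselves count; running
  into a resting chip is no event.\<close>

definition event :: "'v divisor \<Rightarrow> (('v \<times> 'v) \<times> real) set \<Rightarrow> (('v \<times> 'v) \<times> real \<Rightarrow> real) \<Rightarrow> real \<Rightarrow> bool" where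
  "event E T \<sigma> \<delta> \<longleftrightarrow> (\<exists>e x. (e, x) \<in> T \<and> (target E \<sigma> \<delta> (e, x) = 0 \<or> target E \<sigma> \<delta> (e, x) = L e)) \<or>
     (\<exists>e x y. (e, x) \<in> T \<and> (e, y) \<in> T \<and> x < y \<and> target E \<sigma> \<delta> (e, x) = target E \<sigma> \<delta> (e, y))"

lemma cut_event:
  assumes cut: "is_cut E T \<sigma> \<kappa>" and E: "effective G E"
  obtains \<delta> where "0 < \<delta>" "admissible E T \<sigma> \<delta>" "\<And>\<delta>'. 0 \<le> \<delta>' \<Longrightarrow> \<delta>' < \<delta> \<Longrightarrow> strictly_admissible E T \<sigma> \<delta>'" "event E T \<sigma> \<delta>"
proof -
  note T = cut_chip[OF cut E]
  have finT: "finite T" using cut_finite[OF cut] E unfolding effective_def by simp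
  define r where "r k = \<sigma> k / of_int (E (pt (fst k) (snd k)))" for k
  have mvr: "target E \<sigma> \<delta> k = snd k + r k * \<delta>" for k \<delta> unfolding target_def r_def by (cases k) simp
  \<comment> \<open>Pairs encoding affine functions of the time: the distances of a chip from the
    two ends of its edge, and the gap between two chips of the cut on a common edge.\<close>
  define I1 where "I1 = (\<lambda>k. (snd k, r k)) ` T"
  define I2 where "I2 = (\<lambda>k. (L (fst k) - snd k, - r k)) ` T"
  define I3 where "I3 = (\<lambda>(k,k'). (snd k' - snd k, r k' - r k)) ` {(k,k') \<in> T \<times> T. fst k = fst k' \<and> snd k < snd k'}"
  have "finite {(k,k') \<in> T \<times> T. fst k = fst k' \<and> snd k < snd k'}"
    by (rule finite_subset[of _ "T \<times> T"]) (use finT in auto)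
  then have fin: "finite (I1 \<union> I2 \<union> I3)" unfolding I1_def I2_def I3_def using finT by simp
  have pos: "0 < a" if "(a,k) \<in> I1 \<union> I2 \<union> I3" for a k
    using that T(2,3) unfolding I1_def I2_def I3_def by auto
  \<comment> \<open>Any chip of the cut approaches one of the two ends of its edge.\<close>
  have neg: "\<exists>(a,k)\<in>I1 \<union> I2 \<union> I3. k < 0"
  proof -
    obtain e x where k: "(e,x) \<in> T" using cut unfolding is_cut_def by auto
    have "r (e,x) < 0 \<or> - r (e,x) < 0" using T(4,5)[OF k] unfolding r_def by (auto simp: field_simps)
    then show ?thesis unfolding I1_def I2_def using k by force
  qed
  obtain \<delta> where \<delta>: "\<delta> > 0" "\<And>a k. (a,k)\<in>I1 \<union> I2 \<union> I3 \<Longrightarrow> 0 \<le> a + k * \<delta>"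
     "\<And>\<delta>' a k. 0 \<le> \<delta>' \<Longrightarrow> \<delta>' < \<delta> \<Longrightarrow> (a,k)\<in>I1 \<union> I2 \<union> I3 \<Longrightarrow> 0 < a + k * \<delta>'"
     "\<exists>(a,k)\<in>I1 \<union> I2 \<union> I3. a + k * \<delta> = 0"
  proof -
    have "\<exists>\<delta>>0. (\<forall>(a,k)\<in>I1 \<union> I2 \<union> I3. 0 \<le> a + k * \<delta>) \<and>
       (\<forall>\<delta>'. 0 \<le> \<delta>' \<longrightarrow> \<delta>' < \<delta> \<longrightarrow> (\<forall>(a,k)\<in>I1 \<union> I2 \<union> I3. 0 < a + k * \<delta>')) \<and>
       (\<exists>(a,k)\<in>I1 \<union> I2 \<union> I3. a + k * \<delta> = 0)"
      by (rule first_event[OF fin _ neg]) (rule pos)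
    then show thesis using that by blast
  qed
  have i1: "(x, r (e,x)) \<in> I1 \<union> I2 \<union> I3" "(L e - x, - r (e,x)) \<in> I1 \<union> I2 \<union> I3" if "(e,x) \<in> T" for e x
    using that unfolding I1_def I2_def by force+
  have i3: "(y - x, r (e,y) - r (e,x)) \<in> I1 \<union> I2 \<union> I3" if "(e,x) \<in> T" "(e,y) \<in> T" "x < y" for e x y
    using that unfolding I3_def by force
  show thesis
  proof (rule that[OF \<delta>(1)])
    show "admissible E T \<sigma> \<delta>"
      unfolding admissible_def mvr using \<delta>(1) \<delta>(2)[OF i1(1)] \<delta>(2)[OF i1(2)] \<delta>(2)[OF i3]
      by (fastforce simp: algebra_simps)
    show "strictly_admissible E T \<sigma> \<delta>'" if "0 \<le> \<delta>'" "\<delta>' < \<delta>" for \<delta>'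
      unfolding strictly_admissible_def mvr using that \<delta>(3)[OF that i1(1)] \<delta>(3)[OF that i1(2)] \<delta>(3)[OF that i3]
      by (fastforce simp: algebra_simps)
    obtain a k where ak: "(a,k)\<in>I1 \<union> I2 \<union> I3" "a + k * \<delta> = 0" using \<delta>(4) by blast
    then consider "(a,k) \<in> I1" | "(a,k) \<in> I2" | "(a,k) \<in> I3" by blast
    then show "event E T \<sigma> \<delta>"
    proof cases
      case 1
      then obtain e x where x: "(e,x) \<in> T" "a = x" "k = r (e,x)" unfolding I1_def by auto
      then have "x + r (e,x) * \<delta> = 0" using ak(2) by simp
      then show ?thesis unfolding event_def mvr using x(1) by (intro disjI1 exI[of _ e] exI[of _ x]) simp
    next
      case 2
      then obtain e x where x: "(e,x) \<in> T" "a = L e - x" "k = - r (e,x)" unfolding I2_def by auto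
      then have "x + r (e,x) * \<delta> = L e" using ak(2) by simp
      then show ?thesis unfolding event_def mvr using x(1) by (intro disjI1 exI[of _ e] exI[of _ x]) simp
    next
      case 3
      then obtain e x y where x: "(e,x) \<in> T" "(e,y) \<in> T" "x < y" "a = y - x" "k = r (e,y) - r (e,x)" unfolding I3_def by auto
      have "k * \<delta> = r (e,y) * \<delta> - r (e,x) * \<delta>" unfolding x(5) by (simp add: algebra_simps)
      then have "x + r (e,x) * \<delta> = y + r (e,y) * \<delta>" using ak(2) x(4) by linarith
      then show ?thesis unfolding event_def mvr using x(1-3)
        by (intro disjI2 exI[of _ e] exI[of _ x] exI[of _ y]) simp
    qed
  qed
qed

text \<open>At an event either a chip of \<open>T\<close> leaves the interior of its edge or two of
  them merge, while moving never creates chips. This number is the measure for splitting functions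
  repeatedly.\<close>

lemma card_chips_event:
  assumes cut: "is_cut E T \<sigma> \<kappa>" and E: "effective G E" and admissible: "admissible E T \<sigma> \<delta>" and ev: "event E T \<sigma> \<delta>"
  shows "card (chips (moved E T \<sigma> \<delta>)) < card (chips E)"
proof -
  have finC: "finite (chips E)" using chips_finite E unfolding effective_def by blast
  have TC: "T \<subseteq> chips E" using cut unfolding is_cut_def by blast
  then have finT: "finite T" using finC finite_subset by blast
  define F where "F = (\<lambda>(e,x). (e, target E \<sigma> \<delta> (e, x)))"
  define N where "N = {(e, target E \<sigma> \<delta> (e, x)) | e x. (e, x) \<in> T \<and> 0 < target E \<sigma> \<delta> (e, x) \<and> target E \<sigma> \<delta> (e, x) < L e}"
  have NF: "N \<subseteq> F ` T" unfolding N_def F_def by force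
  have "card N < card T"
  proof -
    consider e x where "(e,x) \<in> T" "target E \<sigma> \<delta> (e, x) = 0 \<or> target E \<sigma> \<delta> (e, x) = L e"
      | e x y where "(e,x) \<in> T" "(e,y) \<in> T" "x < y" "target E \<sigma> \<delta> (e, x) = target E \<sigma> \<delta> (e, y)"
      using ev unfolding event_def by blast
    then show ?thesis
  proof cases
    case x: (1 e x)
    have "N \<subseteq> F ` (T - {(e,x)})" unfolding N_def F_def using x by force
    then have "card N \<le> card (F ` (T - {(e,x)}))" using finT by (intro card_mono) auto
    also have "\<dots> \<le> card (T - {(e,x)})" using finT by (intro card_image_le) auto
    also have "\<dots> < card T" using finT x(1) by (rule card_Diff1_less)
    finally show ?thesis .
  next
    case x: (2 e x y)
    have "F ` T \<subseteq> F ` (T - {(e,x)})"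
    proof
      fix z assume "z \<in> F ` T"
      then obtain k where k: "k \<in> T" "z = F k" by blast
      show "z \<in> F ` (T - {(e,x)})"
      proof (cases "k = (e,x)")
        case True
        then have "z = F (e,y)" using k(2) x(4) unfolding F_def by simp
        then show ?thesis using x by auto
      qed (use k in auto)
    qed
    then have "card N \<le> card (F ` (T - {(e,x)}))" using finT NF by (intro card_mono) auto
    also have "\<dots> \<le> card (T - {(e,x)})" using finT by (intro card_image_le) auto
    also have "\<dots> < card T" using finT x(1) by (rule card_Diff1_less)
    finally show ?thesis .
  qed
  qed
  moreover have "card (chips (moved E T \<sigma> \<delta>)) \<le> card ((chips E - T) \<union> N)"
    using chips_moved[OF cut E admissible] finC finT NF unfolding N_def[symmetric]
    by (intro card_mono) (auto intro: finite_subset)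
  moreover have "card ((chips E - T) \<union> N) \<le> card (chips E - T) + card N" by (rule card_Un_le)
  moreover have "card (chips E - T) = card (chips E) - card T" using TC finT by (simp add: card_Diff_subset)
  moreover have "card T \<le> card (chips E)" using TC finC by (rule card_mono[rotated])
  ultimately show ?thesis by linarith
qed

lemma cut_step:
  assumes D: "is_divisor G D" and f: "in_R D f" and cut: "is_cut (plus_div D f) T \<sigma> \<kappa>"
    and admissible: "admissible (plus_div D f) T \<sigma> \<delta>"
  obtains h where "in_R D h" "\<And>v. h (vx v) = f (vx v) - \<delta> * \<kappa> v"
    "\<And>e t. e \<in> edges G \<Longrightarrow> 0 \<le> t \<Longrightarrow> t \<le> L e \<Longrightarrow> h (pt e t) = f (pt e t) - cut_fun (plus_div D f) T \<sigma> \<kappa> \<delta> e t"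
    "(plus_div D h) = moved (plus_div D f) T \<sigma> \<delta>"
    "\<And>x. x \<in> curve G \<Longrightarrow> h x \<le> f x"
proof -
  let ?E = "plus_div D f"
  have E: "effective G ?E" and rf: "rational_fun G f" using f unfolding in_R_def by auto
  obtain b where b: "rational_fun G b" "\<And>v. b (vx v) = \<delta> * \<kappa> v"
    "\<And>e t. e \<in> edges G \<Longrightarrow> 0 \<le> t \<Longrightarrow> t \<le> L e \<Longrightarrow> b (pt e t) = cut_fun ?E T \<sigma> \<kappa> \<delta> e t"
    "\<And>z. ?E z - ord G b z = moved ?E T \<sigma> \<delta> z"
    by (rule move_fun[OF cut E admissible]) (rule that)
  let ?h = "\<lambda>x\<in>curve G. f x - b x"
  have rat: "rational_fun G ?h" by (rule rational_diff[OF rf b(1)])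
  have o: "D x + ord G ?h x = moved ?E T \<sigma> \<delta> x" for x
    unfolding ord_diff[OF rf b(1)] b(4)[symmetric] by simp
  have R: "in_R D ?h" by (rule in_RI[OF D rat]) (simp add: o moved_nonneg[OF cut E])
  have d: "0 \<le> \<delta>" using admissible unfolding admissible_def by blast
  have "0 \<le> b x" if "x \<in> curve G" for x
    using that
  proof (cases rule: curve_cases)
    case (vertex v)
    have "\<kappa> v = 0 \<or> \<kappa> v = 1" using cut unfolding is_cut_def by blast
    then show ?thesis using b(2) vertex d by auto
  next
    case (interior e t)
    then show ?thesis using b(3)[of e t] cut_fun_range[OF cut E interior(1) admissible] by simp
  qed
  then show thesis using that[OF R] b(2,3) o vx_curve pt_curve by auto
qed

section \<open>Finding cuts\<close>

lemma crossing_edge: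
  assumes "C \<noteq> {}" "C \<noteq> UNIV" shows "\<exists>e\<in>edges G. (fst e \<in> C) \<noteq> (snd e \<in> C)"
proof -
  obtain u w where uw: "u \<in> C" "w \<notin> C" using assms by blast
  have "(u, w) \<in> (edges G \<union> (edges G)\<inverse>)\<^sup>*" using tc unfolding tropical_curve_def by blast
  then have "w \<in> C \<or> (\<exists>e\<in>edges G. (fst e \<in> C) \<noteq> (snd e \<in> C))"
  proof (induction rule: rtrancl_induct)
    case (step y z)
    from step(3) show ?case
    proof
      assume y: "y \<in> C"
      show ?thesis
      proof (cases "z \<in> C")
        case False
        have "(y, z) \<in> edges G \<or> (z, y) \<in> edges G" using step(2) by auto
        then have "\<exists>e\<in>edges G. (fst e \<in> C) \<noteq> (snd e \<in> C)"
        proof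
          assume "(y, z) \<in> edges G" then show ?thesis using y False by (intro bexI[of _ "(y, z)"]) simp_all
        next
          assume "(z, y) \<in> edges G" then show ?thesis using y False by (intro bexI[of _ "(z, y)"]) simp_all
        qed
        then show ?thesis ..
      qed simp
    qed simp
  qed (use uw in simp)
  then show ?thesis using uw by simp
qed

text \<open>One side is the open segment between the two chips. It contains no vertex, so
  \<open>\<kappa>\<close> is 0 throughout.\<close>

lemma pair_cut:
  assumes "(e, x) \<in> chips E" "(e, y) \<in> chips E" "x < y"
  shows "is_cut E {(e,x),(e,y)} (\<lambda>k. if k = (e,x) then 1 else -1) (\<lambda>v. 0)"
  unfolding is_cut_def
proof (intro conjI ballI)
  fix e' assume "e' \<in> edges G"
  show "({xa. (e', xa) \<in> {(e, x), (e, y)}} = {} \<and> (0::real) = 0) \<or>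
       (\<exists>xa. {xa. (e', xa) \<in> {(e, x), (e, y)}} = {xa} \<and> (0::real) \<noteq> 0 \<and> (if (e', xa) = (e, x) then 1 else - 1) = (0::real) - 0) \<or>
       (\<exists>xa ya. xa < ya \<and> {xa. (e', xa) \<in> {(e, x), (e, y)}} = {xa, ya} \<and> (0::real) = 0 \<and>
          (if (e', xa) = (e, x) then 1 else - 1) = 1 - 2 * (0::real) \<and> (if (e', ya) = (e, x) then 1 else - 1) = 2 * (0::real) - 1)"
  proof (cases "e' = e")
    case True
    have "{xa. (e', xa) \<in> {(e, x), (e, y)}} = {x, y}" using True by auto
    then show ?thesis using assms(3) True by (intro disjI2) (auto intro!: exI[of _ x] exI[of _ y])
  qed auto
qed (use assms in auto)

text \<open>Connectedness of the graph provides a crossing edge, so \<open>T\<close> is nonempty. On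
  an edge with several chips any single one may serve; this freedom is used to avoid a prescribed
  point.\<close>

lemma vertex_cut:
  assumes "C \<noteq> {}" "C \<noteq> UNIV" "\<And>e. e \<in> edges G \<Longrightarrow> (fst e \<in> C) \<noteq> (snd e \<in> C) \<Longrightarrow> (e, c e) \<in> chips E"
  shows "is_cut E {(e, c e) | e. e \<in> edges G \<and> (fst e \<in> C) \<noteq> (snd e \<in> C)}
     (\<lambda>(e,x). of_bool (snd e \<in> C) - of_bool (fst e \<in> C)) (\<lambda>v. of_bool (v \<in> C))"
    (is "is_cut E ?T ?\<sigma> ?\<kappa>")
  unfolding is_cut_def
proof (intro conjI ballI allI)
  show "?T \<noteq> {}"
  proof -
    obtain e where "e \<in> edges G" "(fst e \<in> C) \<noteq> (snd e \<in> C)" using crossing_edge[OF assms(1,2)] by blast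
    then have "(e, c e) \<in> ?T" by blast
    then show ?thesis by blast
  qed
  show "?T \<subseteq> chips E" using assms(3) by auto
  fix e assume e: "e \<in> edges G"
  show "({x. (e, x) \<in> ?T} = {} \<and> ?\<kappa> (fst e) = ?\<kappa> (snd e)) \<or>
     (\<exists>x. {x. (e, x) \<in> ?T} = {x} \<and> ?\<kappa> (fst e) \<noteq> ?\<kappa> (snd e) \<and> ?\<sigma> (e, x) = ?\<kappa> (snd e) - ?\<kappa> (fst e)) \<or>
     (\<exists>x y. x < y \<and> {x. (e, x) \<in> ?T} = {x, y} \<and> ?\<kappa> (fst e) = ?\<kappa> (snd e) \<and>
        ?\<sigma> (e, x) = 1 - 2 * ?\<kappa> (fst e) \<and> ?\<sigma> (e, y) = 2 * ?\<kappa> (fst e) - 1)"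
  proof (cases "(fst e \<in> C) = (snd e \<in> C)")
    case True
    then have "{x. (e, x) \<in> ?T} = {}" by auto
    then show ?thesis using True by (intro disjI1) simp
  next
    case False
    then have "{x. (e, x) \<in> ?T} = {c e}" using e by blast
    then show ?thesis using False by (intro disjI2 disjI1 exI[of _ "c e"]) auto
  qed
qed auto

lemma not_rigid_cut:
  assumes "\<not> rigid E"
  obtains T \<sigma> \<kappa> where "is_cut E T \<sigma> \<kappa>"
proof -
  consider e x y where "(e,x) \<in> chips E" "(e,y) \<in> chips E" "x \<noteq> y"
    | C where "C \<noteq> {}" "C \<noteq> UNIV" "\<forall>e\<in>edges G. (fst e \<in> C) \<noteq> (snd e \<in> C) \<longrightarrow> (\<exists>t. (e, t) \<in> chips E)"
    using assms unfolding rigid_def by metis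
  then show thesis
  proof cases
    case (1 e x y)
    then show ?thesis using that pair_cut by (metis linorder_neqE_linordered_idom)
  next
    case (2 C)
    then obtain c where "\<And>e. e \<in> edges G \<Longrightarrow> (fst e \<in> C) \<noteq> (snd e \<in> C) \<Longrightarrow> (e, c e) \<in> chips E" by metis
    then show ?thesis using that vertex_cut[OF 2(1,2)] by blast
  qed
qed

section \<open>Domination by rigid elements, and cuts of a maximal function\<close>

text \<open>Induction on the number of chips inside edges. Of the two functions obtained from a cut,
  one agrees with \<open>f\<close> at \<open>x\<close>, and neither exceeds \<open>f\<close> at
  \<open>P\<close>; so that one has at least the same difference between \<open>x\<close> and
  \<open>P\<close>.\<close>

lemma rigid_dominates:
  assumes D: "is_divisor G D" and "in_R D f" and x: "x \<in> curve G" and P: "P \<in> curve G"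
  shows "\<exists>h. in_R D h \<and> rigid (plus_div D h) \<and> f x - f P \<le> h x - h P"
  using assms(2)
proof (induction "card (chips (plus_div D f))" arbitrary: f rule: less_induct)
  case less
  let ?E = "plus_div D f"
  show ?case
  proof (cases "rigid ?E")
    case True then show ?thesis using less.prems by blast
  next
    case False
    then obtain T \<sigma> \<kappa> where cut: "is_cut ?E T \<sigma> \<kappa>" using not_rigid_cut by blast
    have E: "effective G ?E" using less.prems unfolding in_R_def by simp
    note cut' = is_cut_opp[OF cut]
    let ?s = "\<lambda>k. - \<sigma> k" and ?c = "\<lambda>v. 1 - \<kappa> v"
    obtain \<delta> where \<delta>: "admissible ?E T \<sigma> \<delta>" "event ?E T \<sigma> \<delta>" using cut_event[OF cut E] by metis
    obtain \<delta>' where \<delta>': "admissible ?E T ?s \<delta>'" "event ?E T ?s \<delta>'" using cut_event[OF cut' E] by metis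
    obtain h where h: "in_R D h" "\<And>v. h (vx v) = f (vx v) - \<delta> * \<kappa> v"
      "\<And>e t. e \<in> edges G \<Longrightarrow> 0 \<le> t \<Longrightarrow> t \<le> L e \<Longrightarrow> h (pt e t) = f (pt e t) - cut_fun ?E T \<sigma> \<kappa> \<delta> e t"
      "(plus_div D h) = moved ?E T \<sigma> \<delta>" "\<And>x. x \<in> curve G \<Longrightarrow> h x \<le> f x"
      by (rule cut_step[OF D less.prems cut \<delta>(1)]) (rule that)
    obtain h' where h': "in_R D h'" "\<And>v. h' (vx v) = f (vx v) - \<delta>' * ?c v"
      "\<And>e t. e \<in> edges G \<Longrightarrow> 0 \<le> t \<Longrightarrow> t \<le> L e \<Longrightarrow> h' (pt e t) = f (pt e t) - cut_fun ?E T ?s ?c \<delta>' e t"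
      "(plus_div D h') = moved ?E T ?s \<delta>'" "\<And>x. x \<in> curve G \<Longrightarrow> h' x \<le> f x"
      by (rule cut_step[OF D less.prems cut' \<delta>'(1)]) (rule that)
    have "h x = f x \<or> h' x = f x"
      using x
    proof (cases rule: curve_cases)
      case (vertex v)
      have "\<kappa> v = 0 \<or> \<kappa> v = 1" using cut unfolding is_cut_def by blast
      then show ?thesis using h(2)[of v] h'(2)[of v] vertex by auto
    next
      case (interior e t)
      then show ?thesis using h(3)[of e t] h'(3)[of e t] cut_fun_disjoint[OF cut E interior(1) \<delta>(1) \<delta>'(1), of t] by auto
    qed
    then show ?thesis
    proof
      assume *: "h x = f x"
      have "card (chips (plus_div D h)) < card (chips ?E)"
        unfolding h(4) by (rule card_chips_event[OF cut E \<delta>])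
      from less.hyps[OF this h(1)] show ?thesis using * h(5)[OF P] by force
    next
      assume *: "h' x = f x"
      have "card (chips (plus_div D h')) < card (chips ?E)"
        unfolding h'(4) by (rule card_chips_event[OF cut' E \<delta>'])
      from less.hyps[OF this h'(1)] show ?thesis using * h'(5)[OF P] by force
    qed
  qed
qed

text \<open>If \<open>P\<close> were strictly on one side of a cut, then firing that side a little would
  contradict maximality.\<close>

lemma maximal_cut:
  assumes D: "is_divisor G D" and f: "maximal D P f" and P: "P \<in> curve G"
    and cut: "is_cut (plus_div D f) T \<sigma> \<kappa>"
  shows "\<exists>(e, x)\<in>T. P = pt e x"
proof (rule ccontr)
  let ?E = "plus_div D f"
  assume "\<not> ?thesis"
  then have PT: "P \<noteq> pt e x" if "(e,x) \<in> T" for e x using that by blast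
  have fR: "in_R D f" using f unfolding maximal_def by simp
  then have E: "effective G ?E" unfolding in_R_def by simp
  \<comment> \<open>The moved function drops by \<open>\<delta>\<close> at \<open>P\<close> and
    keeps its value at the chips of \<open>T\<close>, so its difference between such a chip and
    \<open>P\<close> exceeds the largest one allowed.\<close>
  have key: False if c: "is_cut ?E T s c" and a: "admissible ?E T s \<delta>" "0 < \<delta>"
    and bP: "\<And>v. P = vx v \<Longrightarrow> c v = 1" "\<And>e t. e \<in> edges G \<Longrightarrow> 0 < t \<Longrightarrow> t < L e \<Longrightarrow> P = pt e t \<Longrightarrow> cut_fun ?E T s c \<delta> e t = \<delta>" for s c \<delta>
  proof -
    obtain h where h: "in_R D h" "\<And>v. h (vx v) = f (vx v) - \<delta> * c v"
      "\<And>e t. e \<in> edges G \<Longrightarrow> 0 \<le> t \<Longrightarrow> t \<le> L e \<Longrightarrow> h (pt e t) = f (pt e t) - cut_fun ?E T s c \<delta> e t"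
      "(plus_div D h) = moved ?E T s \<delta>" "\<And>x. x \<in> curve G \<Longrightarrow> h x \<le> f x"
      by (rule cut_step[OF D fR c a(1)]) (rule that)
    have hP: "h P = f P - \<delta>" using P
    proof (cases rule: curve_cases)
      case (vertex v) then show ?thesis using h(2) bP(1) by simp
    next
      case (interior e t) then show ?thesis using h(3)[of e t] bP(2)[of e t] by simp
    qed
    obtain e x where x: "(e,x) \<in> T" using c unfolding is_cut_def by auto
    note Tx = cut_chip[OF c E x]
    have "h (pt e x) = f (pt e x)" using h(3)[OF Tx(1)] Tx cut_fun_T_zero[OF c E x a(1)] by simp
    moreover have "h (pt e x) - h P \<le> f (pt e x) - f P"
      using f h(1) pt_curve[OF Tx(1)] Tx unfolding maximal_def by simp
    ultimately show False using hP a(2) by simp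
  qed
  obtain \<delta>0 where \<delta>0: "0 < \<delta>0" "\<And>\<delta>'. 0 \<le> \<delta>' \<Longrightarrow> \<delta>' < \<delta>0 \<Longrightarrow> strictly_admissible ?E T \<sigma> \<delta>'" using cut_event[OF cut E] by metis
  note cut' = is_cut_opp[OF cut]
  obtain \<delta>1 where \<delta>1: "0 < \<delta>1" "\<And>\<delta>'. 0 \<le> \<delta>' \<Longrightarrow> \<delta>' < \<delta>1 \<Longrightarrow> strictly_admissible ?E T (\<lambda>k. - \<sigma> k) \<delta>'" using cut_event[OF cut' E] by metis
  have chi: "\<kappa> v = 0 \<or> \<kappa> v = 1" for v using cut unfolding is_cut_def by blast
  show False using P
  proof (cases rule: curve_cases)
    case (vertex v)
    have nv: False if "e \<in> edges G" "0 < t" "t < L e" "P = pt e t" for e t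
      using pt_vertex[of e t v] that vertex by auto
    show False
    proof (cases "\<kappa> v = 1")
      case True
      show False by (rule key[OF cut strictly_admissible_admissible[OF \<delta>0(2)[of "\<delta>0/2"]]]) (use \<delta>0(1) True vertex nv vx_inj in auto)
    next
      case False
      then have "1 - \<kappa> v = 1" using chi[of v] by simp
      then show False by (intro key[OF cut' strictly_admissible_admissible[OF \<delta>1(2)[of "\<delta>1/2"]]]) (use \<delta>1(1) vertex nv vx_inj in auto)
    qed
  next
    case (interior e t)
    have nv: False if "P = vx v" for v
      using pt_vertex[of e t v] that interior by auto
    have uniq: "e' = e \<and> t' = t" if "e' \<in> edges G" "0 < t'" "t' < L e'" "P = pt e' t'" for e' t'
      using pt_interior_eq[of e' e t' t] that interior by auto
    \<comment> \<open>A point strictly inside a side lies on the plateau of the cut function as soon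
      as \<open>\<delta>\<close> is small enough.\<close>
    have k1: False if "0 < d" "\<And>\<delta>. 0 < \<delta> \<Longrightarrow> \<delta> \<le> d \<Longrightarrow> cut_fun ?E T \<sigma> \<kappa> \<delta> e t = \<delta>" for d
    proof -
      define \<delta> where "\<delta> = min d (\<delta>0/2)"
      have dd: "0 < \<delta>" "\<delta> \<le> d" "\<delta> < \<delta>0" unfolding \<delta>_def using that(1) \<delta>0(1) by auto
      show False by (rule key[OF cut strictly_admissible_admissible[OF \<delta>0(2)[of \<delta>]] dd(1)]) (use dd that(2)[of \<delta>] nv uniq in auto)
    qed
    have k2: False if "0 < d" "\<And>\<delta>. 0 < \<delta> \<Longrightarrow> \<delta> \<le> d \<Longrightarrow> cut_fun ?E T (\<lambda>k. - \<sigma> k) (\<lambda>v. 1 - \<kappa> v) \<delta> e t = \<delta>" for d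
    proof -
      define \<delta> where "\<delta> = min d (\<delta>1/2)"
      have dd: "0 < \<delta>" "\<delta> \<le> d" "\<delta> < \<delta>1" unfolding \<delta>_def using that(1) \<delta>1(1) by auto
      show False by (rule key[OF cut' strictly_admissible_admissible[OF \<delta>1(2)[of \<delta>]] dd(1)]) (use dd that(2)[of \<delta>] nv uniq in auto)
    qed
    have Tt: "(e, t) \<notin> T" using PT interior(4) by blast
    from cut E interior(1) show False
    proof (cases rule: cut_edge_cases)
      case none
      show False using k1[of 1] k2[of 1] none(3)[of _ t] none(4)[of _ t] chi[of "fst e"] by auto
    next
      case (up x m)
      have "t \<noteq> x" using Tt up(1) by blast
      then consider "t < x" | "x < t" by linarith
      then show False
      proof cases
        case 1 show False by (rule k2[of "m * (x - t)"]) (use 1 up(2) up(8)[of _ t] in auto)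
      next
        case 2 show False by (rule k1[of "m * (t - x)"]) (use 2 up(2) up(7)[of _ t] in auto)
      qed
    next
      case (down x m)
      have "t \<noteq> x" using Tt down(1) by blast
      then consider "t < x" | "x < t" by linarith
      then show False
      proof cases
        case 1 show False by (rule k1[of "m * (x - t)"]) (use 1 down(2) down(7)[of _ t] in auto)
      next
        case 2 show False by (rule k2[of "m * (t - x)"]) (use 2 down(2) down(8)[of _ t] in auto)
      qed
    next
      case (inn x y m n)
      have "t \<noteq> x" "t \<noteq> y" using Tt inn(2) by blast+
      then consider "t < x" | "x < t" "t < y" | "y < t" by linarith
      then show False
      proof cases
        case 1 show False by (rule k2[of "m * (x - t)"]) (use 1 inn(1,3) inn(12)[of _ t] in auto)
      next
        case 2 show False by (rule k1[of "min (m * (t - x)) (n * (y - t))"]) (use 2 inn(1,3,4) inn(11)[of _ t] in auto)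
      next
        case 3 show False by (rule k2[of "n * (t - y)"]) (use 3 inn(1,4) inn(12)[of _ t] in auto)
      qed
    next
      case (out x y m n)
      have "t \<noteq> x" "t \<noteq> y" using Tt out(2) by blast+
      then consider "t < x" | "x < t" "t < y" | "y < t" by linarith
      then show False
      proof cases
        case 1 show False by (rule k1[of "m * (x - t)"]) (use 1 out(1,3) out(11)[of _ t] in auto)
      next
        case 2 show False by (rule k2[of "min (m * (t - x)) (n * (y - t))"]) (use 2 out(1,3,4) out(12)[of _ t] in auto)
      next
        case 3 show False by (rule k1[of "n * (t - y)"]) (use 3 out(1,4) out(11)[of _ t] in auto)
      qed
    qed
  qed
qed


section \<open>Rigidity and finiteness\<close>

text \<open>\<open>m = 0\<close> covers an edge without chips, the positions being arbitrary then.
  The bound on the displacement leaves no room for a nonzero integral slope along the edge.\<close>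

definition close_on_edge :: "'v divisor \<Rightarrow> 'v divisor \<Rightarrow> 'v \<times> 'v \<Rightarrow> bool" where
  "close_on_edge E E' e \<longleftrightarrow> (\<exists>x x' m. 0 < x \<and> x < L e \<and> 0 < x' \<and> x' < L e \<and> 0 \<le> m \<and>
     (\<forall>t. 0 < t \<longrightarrow> t < L e \<longrightarrow> E (pt e t) = (if t = x then m else 0) \<and> E' (pt e t) = (if t = x' then m else 0)) \<and>
     of_int m * \<bar>x - x'\<bar> < L e)"

lemma ord_interior: "e \<in> edges G \<Longrightarrow> 0 < t \<Longrightarrow> t < L e \<Longrightarrow> ord G f (pt e t) = slope_sum (L e) (\<lambda>t. f (pt e t)) t"
  unfolding ord_eq by (simp add: params_interior)

lemma ord_vertex: "ord G f (vx v) = (\<Sum>e\<in>{e\<in>edges G. fst e = v}. slope_sum (L e) (\<lambda>t. f (pt e t)) 0) +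
   (\<Sum>e\<in>{e\<in>edges G. snd e = v}. slope_sum (L e) (\<lambda>t. f (pt e t)) (L e))"
proof -
  have d: "(\<lambda>e. (e, 0::real)) ` {e\<in>edges G. fst e = v} \<inter> (\<lambda>e. (e, L e)) ` {e\<in>edges G. snd e = v} = {}"
    using L_pos by force
  show ?thesis unfolding ord_eq params_vertex
    by (subst sum.union_disjoint[OF _ _ d]) (auto simp: sum.reindex inj_on_def)
qed

text \<open>The slopes of a function with divisor \<open>E' - E\<close> at the ends of the edges form a flow without
  sources, and the edges are too long for the small displacements to compensate a nonzero flow.\<close>

lemma close_on_edge_rigid:
  assumes rg: "rational_fun G g" and g: "\<And>z. ord G g z = E' z - E z"
    and v: "\<And>v. E (vx v) = E' (vx v)" and vl: "rigid E" and cl: "\<And>e. e \<in> edges G \<Longrightarrow> close_on_edge E E' e"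
  shows "\<exists>c. \<forall>z\<in>curve G. g z = c"
proof -
  have "\<forall>e\<in>edges G. \<exists>x x' m. 0 < x \<and> x < L e \<and> 0 < x' \<and> x' < L e \<and> 0 \<le> m \<and>
     (\<forall>t. 0 < t \<longrightarrow> t < L e \<longrightarrow> E (pt e t) = (if t = x then m else 0) \<and> E' (pt e t) = (if t = x' then m else 0)) \<and>
     of_int m * \<bar>x - x'\<bar> < L e"
    using cl unfolding close_on_edge_def by blast
  then obtain X X' M where X0: "\<forall>e\<in>edges G. 0 < X e \<and> X e < L e \<and> 0 < X' e \<and> X' e < L e \<and> 0 \<le> M e \<and>
     (\<forall>t. 0 < t \<longrightarrow> t < L e \<longrightarrow> E (pt e t) = (if t = X e then M e else 0) \<and> E' (pt e t) = (if t = X' e then M e else 0)) \<and>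
     of_int (M e) * \<bar>X e - X' e\<bar> < L e"
    by (subst (asm) bchoice_iff) (elim exE, subst (asm) bchoice_iff, elim exE, subst (asm) bchoice_iff, blast)
  note X = bspec[OF X0]
  define \<phi> where "\<phi> e t = g (pt e t)" for e t
  define s where "s e = slope_sum (L e) (\<phi> e) 0" for e
  have edge: "slope_sum (L e) (\<phi> e) (L e) = - s e \<and> (\<forall>t\<in>{0..L e}. \<phi> e t = \<phi> e 0 + of_int (s e) * t + of_int (M e) * (max 0 (t - X' e) - max 0 (t - X e)))"
    if e: "e \<in> edges G" for e
  proof -
    have l: "locally_linear (L e) (\<phi> e)" unfolding \<phi>_def by (rule rational_locally_linear[OF rg e])
    obtain C where C: "finite C" "C \<subseteq> {0<..<L e}"
      "\<And>t. 0 < t \<Longrightarrow> t < L e \<Longrightarrow> t \<notin> C \<Longrightarrow> slope_sum (L e) (\<phi> e) t = 0"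
      "slope_sum (L e) (\<phi> e) (L e) = - slope_sum (L e) (\<phi> e) 0 - (\<Sum>c\<in>C. slope_sum (L e) (\<phi> e) c)"
      "\<And>t. t \<in> {0..L e} \<Longrightarrow> \<phi> e t = \<phi> e 0 + of_int (slope_sum (L e) (\<phi> e) 0) * t + (\<Sum>c\<in>C. of_int (slope_sum (L e) (\<phi> e) c) * max 0 (t - c))"
      by (rule locally_linear_slope_sum_rep[OF l L_pos[OF e]]) (rule that)
    \<comment> \<open>Adding both chip positions to the break points changes no sum, as the order
      vanishes at interior parameters outside \<open>C\<close>.\<close>
    let ?C = "C \<union> {X e, X' e}"
    have C': "finite ?C" "?C \<subseteq> {0<..<L e}" using C X[OF e] by auto
    have j: "slope_sum (L e) (\<phi> e) t = (if t = X' e then M e else 0) - (if t = X e then M e else 0)" if "0 < t" "t < L e" for t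
      using ord_interior[OF e that, of g] X[OF e] that unfolding g \<phi>_def by simp
    have S: "(\<Sum>c\<in>C. of_int (slope_sum (L e) (\<phi> e) c) * w c) = of_int (M e) * (w (X' e) - w (X e))" for w :: "real \<Rightarrow> real"
    proof -
      have "(\<Sum>c\<in>C. of_int (slope_sum (L e) (\<phi> e) c) * w c) = (\<Sum>c\<in>?C. of_int (slope_sum (L e) (\<phi> e) c) * w c)"
        by (rule sum.mono_neutral_left[OF C'(1)]) (use C' C(3) in auto)
      also have "\<dots> = (\<Sum>c\<in>?C. (if c = X' e then of_int (M e) * w (X' e) else 0) - (if c = X e then of_int (M e) * w (X e) else 0))"
        by (rule sum.cong[OF refl]) (use C'(2) in \<open>auto simp: j subset_iff\<close>)
      also have "\<dots> = of_int (M e) * (w (X' e) - w (X e))"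
        unfolding sum_subtractf using C'(1) by (simp add: sum.delta right_diff_distrib)
      finally show ?thesis .
    qed
    have "of_int (\<Sum>c\<in>C. slope_sum (L e) (\<phi> e) c) = (0::real)" using S[of "\<lambda>_. 1"] by simp
    then have "(\<Sum>c\<in>C. slope_sum (L e) (\<phi> e) c) = 0" by (simp only: of_int_eq_0_iff)
    then have "slope_sum (L e) (\<phi> e) (L e) = - s e" using C(4) unfolding s_def by simp
    moreover have "\<phi> e t = \<phi> e 0 + of_int (s e) * t + of_int (M e) * (max 0 (t - X' e) - max 0 (t - X e))" if "t \<in> {0..L e}" for t
      using C(5)[OF that] unfolding S[of "\<lambda>c. max 0 (t - c)"] s_def .
    ultimately show ?thesis by blast
  qed
  note edge1 = conjunct1[OF edge]
  have edge2: "\<phi> e t = \<phi> e 0 + of_int (s e) * t + of_int (M e) * (max 0 (t - X' e) - max 0 (t - X e))"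
    if "e \<in> edges G" "0 \<le> t" "t \<le> L e" for e t
    by (rule bspec[OF conjunct2[OF edge]]) (use that in auto)
  define \<gamma> where "\<gamma> v = g (vx v)" for v
  have \<phi>0: "\<phi> e 0 = \<gamma> (fst e)" and \<phi>L: "\<phi> e (L e) = \<gamma> (snd e)" if "e \<in> edges G" for e
    unfolding \<phi>_def \<gamma>_def using pt_0[OF that] pt_L[OF that] by simp_all
  have diff: "\<gamma> (snd e) - \<gamma> (fst e) = of_int (s e) * L e + of_int (M e) * (X e - X' e)" if e: "e \<in> edges G" for e
  proof -
    have "max 0 (L e - X' e) - max 0 (L e - X e) = X e - X' e" using X[OF e] by simp
    then have "\<phi> e (L e) = \<phi> e 0 + of_int (s e) * L e + of_int (M e) * (X e - X' e)"
      using edge2[OF e, of "L e"] L_pos[OF e] by simp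
    then show ?thesis unfolding \<phi>0[OF e] \<phi>L[OF e] by simp
  qed
  have cons: "(\<Sum>e\<in>{e\<in>edges G. fst e = u}. s e) = (\<Sum>e\<in>{e\<in>edges G. snd e = u}. s e)" for u
  proof -
    have "(\<Sum>e\<in>{e\<in>edges G. snd e = u}. slope_sum (L e) (\<phi> e) (L e)) = (\<Sum>e\<in>{e\<in>edges G. snd e = u}. - s e)"
      using edge1 by (intro sum.cong) auto
    then show ?thesis using ord_vertex[of g u] v[of u] unfolding g s_def \<phi>_def[symmetric] by (simp add: sum_negf)
  qed
  \<comment> \<open>Summation by parts: the flow \<open>s\<close> is conserved at every vertex,
    hence orthogonal to the differences of the potential \<open>\<gamma>\<close>.\<close>
  have "(\<Sum>e\<in>edges G. of_int (s e) * (\<gamma> (snd e) - \<gamma> (fst e))) = 0"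
  proof -
    have a: "(\<Sum>e\<in>edges G. of_int (s e) * \<gamma> (p e)) = (\<Sum>u\<in>UNIV. \<gamma> u * of_int (\<Sum>e\<in>{e\<in>edges G. p e = u}. s e))" for p
    proof -
      have "(\<Sum>u\<in>UNIV. \<gamma> u * of_int (\<Sum>e\<in>{e\<in>edges G. p e = u}. s e)) =
          (\<Sum>u\<in>UNIV. \<Sum>e\<in>{e\<in>edges G. p e = u}. of_int (s e) * \<gamma> (p e))"
        by (intro sum.cong) (auto simp: sum_distrib_left mult.commute)
      also have "\<dots> = (\<Sum>e\<in>edges G. of_int (s e) * \<gamma> (p e))"
        by (rule sum.group) auto
      finally show ?thesis by simp
    qed
    show ?thesis unfolding right_diff_distrib sum_subtractf a cons by simp
  qed
  \<comment> \<open>A nonzero integer times the length of the edge is at least the length in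
    absolute value and beats the displacement term \<open>d\<close>, so the difference of
    \<open>\<gamma>\<close> has the sign of \<open>s e\<close>. All terms of the vanishing sum are
    then nonnegative.\<close>
  moreover have pos: "0 \<le> of_int (s e) * (\<gamma> (snd e) - \<gamma> (fst e)) \<and> (of_int (s e) * (\<gamma> (snd e) - \<gamma> (fst e)) = 0 \<longrightarrow> s e = 0)"
    if e: "e \<in> edges G" for e
  proof (cases "s e = 0")
    case False
    define d where "d = of_int (M e) * (X e - X' e)"
    have d: "\<bar>d\<bar> < L e" unfolding d_def using X[OF e] by (simp add: abs_mult)
    have "of_int (s e) * (of_int (s e) * L e + d) > 0"
    proof (cases "0 < s e")
      case True
      then have "1 \<le> (of_int (s e) :: real)" by simp
      then have "L e \<le> of_int (s e) * L e" using L_pos[OF e] by simp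
      then show ?thesis using d True by (intro mult_pos_pos) auto
    next
      case False
      then have "(of_int (s e) :: real) \<le> -1" using \<open>s e \<noteq> 0\<close> by linarith
      then have "of_int (s e) * L e \<le> - L e" using L_pos[OF e] mult_right_mono[of "of_int (s e)" "-1" "L e"] by simp
      then show ?thesis using d False \<open>s e \<noteq> 0\<close> by (intro mult_neg_neg) auto
    qed
    then show ?thesis unfolding diff[OF e] d_def[symmetric] by (metis less_imp_le order_less_irrefl)
  qed simp
  ultimately have "\<forall>e\<in>edges G. of_int (s e) * (\<gamma> (snd e) - \<gamma> (fst e)) = 0"
    using sum_nonneg_eq_0_iff[OF finite_edges, of "\<lambda>e. of_int (s e) * (\<gamma> (snd e) - \<gamma> (fst e))"] by blast
  then have s0: "s e = 0" if "e \<in> edges G" for e using pos that by blast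
  \<comment> \<open>With zero slopes, \<open>\<gamma>\<close> can change along an edge only if the
    edge carries a chip. So every edge at the boundary of the set of maxima has a chip, and rigidity
    forces this set to contain all vertices.\<close>
  define C where "C = {u. \<gamma> u = Max (range \<gamma>)}"
  have "Max (range \<gamma>) \<in> range \<gamma>" by (rule Max_in) auto
  then obtain u where "Max (range \<gamma>) = \<gamma> u" by (rule imageE)
  then have "C \<noteq> {}" unfolding C_def by auto
  moreover have False if e: "e \<in> edges G" "(fst e \<in> C) \<noteq> (snd e \<in> C)" "\<forall>t. (e, t) \<notin> chips E" for e
  proof -
    have "(e, X e) \<notin> chips E" using e(3) by blast
    then have "E (pt e (X e)) = 0" unfolding chips_def using X[OF e(1)] e(1) by simp
    then have "M e = 0" using X[OF e(1)] by simp
    then have "\<gamma> (snd e) = \<gamma> (fst e)" using diff[OF e(1)] s0[OF e(1)] by simp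
    then show False using e(2) unfolding C_def by simp
  qed
  ultimately have "C = UNIV" using vl unfolding rigid_def by metis
  then have gc: "\<gamma> u = Max (range \<gamma>)" for u unfolding C_def by blast
  have "g z = Max (range \<gamma>)" if "z \<in> curve G" for z
    using that
  proof (cases rule: curve_cases)
    case (vertex v) then show ?thesis using gc[of v] unfolding \<gamma>_def by (simp only:)
  next
    case (interior e t)
    have "\<gamma> (snd e) = \<gamma> (fst e)" using gc[of "fst e"] gc[of "snd e"] by (rule trans[OF _ sym, rotated])
    then have "of_int (M e) * (X e - X' e) = 0" using diff[OF interior(1)] s0[OF interior(1)] by simp
    then have "M e = 0 \<or> X e = X' e" by simp
    then have "of_int (M e) * (max 0 (t - X' e) - max 0 (t - X e)) = 0" by auto
    then have "\<phi> e t = \<phi> e 0"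
      using edge2[OF interior(1) less_imp_le[OF interior(2)] less_imp_le[OF interior(3)]]
      unfolding s0[OF interior(1)] by simp
    then show ?thesis using \<phi>0[OF interior(1)] gc[of "fst e"] interior(4) unfolding \<phi>_def by (simp only:)
  qed
  then show ?thesis by blast
qed

lemma rigid_edge:
  assumes "rigid E" "e \<in> edges G"
  shows "(\<forall>t. 0 < t \<longrightarrow> t < L e \<longrightarrow> E (pt e t) = 0) \<or> (\<exists>x. (e, x) \<in> chips E \<and> (\<forall>t. 0 < t \<longrightarrow> t < L e \<longrightarrow> t \<noteq> x \<longrightarrow> E (pt e t) = 0))"
proof (cases "\<exists>x. (e, x) \<in> chips E")
  case True
  then obtain x where x: "(e, x) \<in> chips E" by blast
  have "E (pt e t) = 0" if "0 < t" "t < L e" "t \<noteq> x" for t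
  proof (rule ccontr)
    assume "E (pt e t) \<noteq> 0"
    then have "(e, t) \<in> chips E" unfolding chips_def using that assms by simp
    then show False using x that assms(1) unfolding rigid_def by blast
  qed
  then show ?thesis using x by blast
next
  case False then show ?thesis unfolding chips_def using assms(2) by auto
qed

lemma close_on_edgeI:
  assumes "(\<forall>t. 0 < t \<longrightarrow> t < L e \<longrightarrow> E (pt e t) = 0 \<and> E' (pt e t) = 0) \<or>
    (\<exists>x x'. (e, x) \<in> chips E \<and> (e, x') \<in> chips E' \<and> 0 \<le> E (pt e x) \<and> E (pt e x) = E' (pt e x') \<and>
      (\<forall>t. 0 < t \<longrightarrow> t < L e \<longrightarrow> t \<noteq> x \<longrightarrow> E (pt e t) = 0) \<and> (\<forall>t. 0 < t \<longrightarrow> t < L e \<longrightarrow> t \<noteq> x' \<longrightarrow> E' (pt e t) = 0) \<and>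
      of_int (E (pt e x)) * \<bar>x - x'\<bar> < L e)" and e: "e \<in> edges G"
  shows "close_on_edge E E' e"
  using assms(1)
proof
  assume "\<forall>t. 0 < t \<longrightarrow> t < L e \<longrightarrow> E (pt e t) = 0 \<and> E' (pt e t) = 0"
  then show ?thesis unfolding close_on_edge_def using L_pos[OF e]
    by (intro exI[of _ "L e / 2"] exI[of _ 0]) auto
next
  assume "\<exists>x x'. (e, x) \<in> chips E \<and> (e, x') \<in> chips E' \<and> 0 \<le> E (pt e x) \<and> E (pt e x) = E' (pt e x') \<and>
      (\<forall>t. 0 < t \<longrightarrow> t < L e \<longrightarrow> t \<noteq> x \<longrightarrow> E (pt e t) = 0) \<and> (\<forall>t. 0 < t \<longrightarrow> t < L e \<longrightarrow> t \<noteq> x' \<longrightarrow> E' (pt e t) = 0) \<and>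
      of_int (E (pt e x)) * \<bar>x - x'\<bar> < L e"
  then obtain x x' where "(e, x) \<in> chips E" "(e, x') \<in> chips E'" "0 \<le> E (pt e x)" "E (pt e x) = E' (pt e x')"
      "\<forall>t. 0 < t \<longrightarrow> t < L e \<longrightarrow> t \<noteq> x \<longrightarrow> E (pt e t) = 0" "\<forall>t. 0 < t \<longrightarrow> t < L e \<longrightarrow> t \<noteq> x' \<longrightarrow> E' (pt e t) = 0"
      "of_int (E (pt e x)) * \<bar>x - x'\<bar> < L e" by blast
  then show ?thesis unfolding close_on_edge_def chips_def
    by (intro exI[of _ x] exI[of _ x'] exI[of _ "E (pt e x)"]) auto
qed

lemma in_R_close_on_edge:
  assumes f: "in_R D f" and f': "in_R D f'" and vl: "rigid (plus_div D f)"
    and v: "\<And>v. D (vx v) + ord G f (vx v) = D (vx v) + ord G f' (vx v)"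
    and cl: "\<And>e. e \<in> edges G \<Longrightarrow> close_on_edge (plus_div D f) (plus_div D f') e"
  shows "\<exists>c. f' = (\<lambda>x\<in>curve G. f x + c)" "(plus_div D f') = (plus_div D f)"
proof -
  have rf: "rational_fun G f" "rational_fun G f'" using f f' unfolding in_R_def by auto
  let ?g = "\<lambda>x\<in>curve G. f' x - f x"
  have "\<exists>c. \<forall>z\<in>curve G. ?g z = c"
    by (rule close_on_edge_rigid[OF rational_diff[OF rf(2,1)] _ v vl cl]) (simp add: ord_diff[OF rf(2,1)])
  then obtain c where c: "\<And>z. z \<in> curve G \<Longrightarrow> f' z = f z + c" by (force simp: algebra_simps)
  then have e: "f' = (\<lambda>x\<in>curve G. f x + c)"
    using rf(2) unfolding rational_iff extensional_def by auto
  then show "\<exists>c. f' = (\<lambda>x\<in>curve G. f x + c)" by blast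
  show "(plus_div D f') = (plus_div D f)" unfolding e ord_shift ..
qed

section \<open>Finiteness of the set of rigid divisors\<close>

lemma effective_le_deg:
  assumes "effective G E" shows "E x \<le> deg E"
proof -
  have fin: "finite {x. E x \<noteq> 0}" and nn: "\<And>x. 0 \<le> E x" using assms unfolding effective_def is_divisor_def by auto
  show ?thesis
  proof (cases "E x = 0")
    case True then show ?thesis unfolding deg_def using nn by (simp add: sum_nonneg)
  next
    case False
    then show ?thesis unfolding deg_def using member_le_sum[of x "{x. E x \<noteq> 0}" E] fin nn by auto
  qed
qed

definition rigid_divisors :: "'v divisor \<Rightarrow> 'v divisor set" where
  "rigid_divisors D = {(plus_div D f) | f. in_R D f \<and> rigid (plus_div D f)}"

text \<open>A rigid divisor is encoded by its vertex coefficients and, for each edge, by the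
  multiplicity of its chip and the position rounded to a grid. Two divisors with the same code are
  close on every edge, hence equal, and there are finitely many codes.\<close>

lemma rigid_divisors_finite:
  assumes D: "is_divisor G D"
  shows "finite (rigid_divisors D)"
proof -
  define d where "d = deg D"
  have ED: "effective G E" "\<And>x. 0 \<le> E x" "\<And>x. E x \<le> d" "rigid E" if EV: "E \<in> rigid_divisors D" for E
  proof -
    obtain f where f: "E = (plus_div D f)" "in_R D f" "rigid E" using EV unfolding rigid_divisors_def by blast
    then show e: "effective G E" "rigid E" unfolding in_R_def by auto
    then show "\<And>x. 0 \<le> E x" unfolding effective_def by blast
    have "deg E = d" unfolding f(1) d_def using deg_add_div[OF D] f(2) unfolding in_R_def by blast
    then show "\<And>x. E x \<le> d" using effective_le_deg[OF e(1)] by simp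
  qed
  define X where "X E e = (THE x. (e, x) \<in> chips E)" for E e
  define c1 where "c1 E = (\<lambda>v. E (vx v))" for E :: "'v divisor"
  \<comment> \<open>A cell of the grid has length \<open>L e / (d + 1)\<close> and multiplicities
    are at most \<open>d\<close>, so two chips in the same cell satisfy the bound in
    \<open>close_on_edge\<close>. Multiplicity 0 marks an edge without chips.\<close>
  define c2 where "c2 E = (\<lambda>e. if \<exists>x. (e, x) \<in> chips E then (E (pt e (X E e)), \<lfloor>X E e * of_int (d + 1) / L e\<rfloor>) else (0, 0))" for E
  have XE: "X E e = x" if "rigid E" "(e, x) \<in> chips E" for E e x
    unfolding X_def
  proof (rule the_equality)
    show "(e, x) \<in> chips E" by (rule that(2))
    fix y assume "(e, y) \<in> chips E"
    then show "y = x" using that unfolding rigid_def by blast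
  qed
  have "finite ((\<lambda>E. (c1 E, c2 E)) ` rigid_divisors D)"
  proof (rule finite_subset)
    let ?F1 = "{f :: 'v \<Rightarrow> int. \<forall>x. (x \<in> UNIV \<longrightarrow> f x \<in> {0..d}) \<and> (x \<notin> UNIV \<longrightarrow> f x = 0)}"
    let ?F2 = "{f :: 'v \<times> 'v \<Rightarrow> int \<times> int. \<forall>x. (x \<in> UNIV \<longrightarrow> f x \<in> {0..d} \<times> {0..d+1}) \<and> (x \<notin> UNIV \<longrightarrow> f x = (0,0))}"
    show "finite (?F1 \<times> ?F2)" by (intro finite_cartesian_product finite_set_of_finite_funs) auto
    show "(\<lambda>E. (c1 E, c2 E)) ` rigid_divisors D \<subseteq> ?F1 \<times> ?F2"
    proof (rule image_subsetI)
      fix E assume E: "E \<in> rigid_divisors D"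
      note E' = ED[OF E]
      have d0: "0 \<le> d" using E'(2,3) order_trans by blast
      have "c2 E e \<in> {0..d} \<times> {0..d+1}" for e
      proof (cases "\<exists>x. (e, x) \<in> chips E")
        case True
        then obtain x where x: "(e, x) \<in> chips E" by blast
        then have xe: "e \<in> edges G" "0 < x" "x < L e" unfolding chips_def by auto
        have "0 \<le> x * of_int (d + 1) / L e" using xe d0 by simp
        moreover have "x * of_int (d + 1) / L e \<le> of_int (d + 1)"
          using xe d0 by (simp add: divide_le_eq mult.commute mult_left_mono)
        ultimately have "0 \<le> \<lfloor>x * of_int (d + 1) / L e\<rfloor>" "\<lfloor>x * of_int (d + 1) / L e\<rfloor> \<le> d + 1"
          by (auto simp: floor_le_iff)
        then show ?thesis unfolding c2_def XE[OF E'(4) x] using True E' by auto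
      next
        case False then show ?thesis unfolding c2_def using d0 by auto
      qed
      then show "(c1 E, c2 E) \<in> ?F1 \<times> ?F2" using E' unfolding c1_def by auto
    qed
  qed
  moreover have "inj_on (\<lambda>E. (c1 E, c2 E)) (rigid_divisors D)"
  proof (rule inj_onI)
    fix E E' assume E: "E \<in> rigid_divisors D" "E' \<in> rigid_divisors D" "(c1 E, c2 E) = (c1 E', c2 E')"
    obtain f where f: "E = (plus_div D f)" "in_R D f" using E(1) unfolding rigid_divisors_def by blast
    obtain f' where f': "E' = (plus_div D f')" "in_R D f'" using E(2) unfolding rigid_divisors_def by blast
    have v: "E (vx v) = E' (vx v)" for v using E(3) unfolding c1_def by (auto dest: fun_cong)
    have "close_on_edge E E' e" if e: "e \<in> edges G" for e
    proof (rule close_on_edgeI[OF _ e])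
      have c: "c2 E e = c2 E' e" using E(3) by auto
      have none: "\<not> (\<exists>x. (e, x) \<in> chips E'')" if "E'' \<in> rigid_divisors D" "fst (c2 E'' e) = 0" for E''
      proof
        assume "\<exists>x. (e, x) \<in> chips E''"
        then obtain x where x: "(e, x) \<in> chips E''" by blast
        then have "fst (c2 E'' e) = E'' (pt e x)" unfolding c2_def using XE[OF ED(4)[OF that(1)] x] by auto
        then show False using that(2) x unfolding chips_def by simp
      qed
      show "(\<forall>t. 0 < t \<longrightarrow> t < L e \<longrightarrow> E (pt e t) = 0 \<and> E' (pt e t) = 0) \<or>
    (\<exists>x x'. (e, x) \<in> chips E \<and> (e, x') \<in> chips E' \<and> 0 \<le> E (pt e x) \<and> E (pt e x) = E' (pt e x') \<and>
      (\<forall>t. 0 < t \<longrightarrow> t < L e \<longrightarrow> t \<noteq> x \<longrightarrow> E (pt e t) = 0) \<and> (\<forall>t. 0 < t \<longrightarrow> t < L e \<longrightarrow> t \<noteq> x' \<longrightarrow> E' (pt e t) = 0) \<and>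
      of_int (E (pt e x)) * \<bar>x - x'\<bar> < L e)"
      proof (cases "fst (c2 E e) = 0")
        case True
        then have "\<not> (\<exists>x. (e, x) \<in> chips E)" "\<not> (\<exists>x. (e, x) \<in> chips E')" using none E(1,2) c by metis+
        then show ?thesis unfolding chips_def using e by auto
      next
        case False
        then have "\<exists>x. (e, x) \<in> chips E" "\<exists>x. (e, x) \<in> chips E'" using c unfolding c2_def by (auto split: if_splits)
        then obtain x x' where x: "(e, x) \<in> chips E" "(e, x') \<in> chips E'" by blast
        have c2x: "c2 E e = (E (pt e x), \<lfloor>x * of_int (d + 1) / L e\<rfloor>)" "c2 E' e = (E' (pt e x'), \<lfloor>x' * of_int (d + 1) / L e\<rfloor>)"
          unfolding c2_def using x XE[OF ED(4)[OF E(1)] x(1)] XE[OF ED(4)[OF E(2)] x(2)] by auto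
        have m: "E (pt e x) = E' (pt e x')" "\<lfloor>x * of_int (d + 1) / L e\<rfloor> = \<lfloor>x' * of_int (d + 1) / L e\<rfloor>"
          using c c2x by auto
        define q where "q = of_int (d + 1) / L e"
        have d0: "0 \<le> d" using ED(2,3)[OF E(1)] order_trans by blast
        have q: "0 < q" unfolding q_def using d0 L_pos[OF e] by simp
        have "\<bar>x * q - x' * q\<bar> < 1" using m(2) unfolding q_def by (simp add: floor_eq_iff) linarith
        then have "\<bar>x - x'\<bar> * q < 1" using q by (simp add: abs_mult left_diff_distrib[symmetric])
        then have "of_int (d + 1) * \<bar>x - x'\<bar> < L e" unfolding q_def using L_pos[OF e] by (simp add: field_simps)
        moreover have "of_int (E (pt e x)) * \<bar>x - x'\<bar> \<le> of_int (d + 1) * \<bar>x - x'\<bar>"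
        proof (rule mult_right_mono)
          have "E (pt e x) \<le> d + 1" using ED(3)[OF E(1), of "pt e x"] by simp
          then show "real_of_int (E (pt e x)) \<le> of_int (d + 1)" by (simp only: of_int_le_iff)
        qed simp
        ultimately have lt: "of_int (E (pt e x)) * \<bar>x - x'\<bar> < L e" by linarith
        have u: "E'' (pt e t) = 0" if "E'' \<in> rigid_divisors D" "(e, y) \<in> chips E''" "0 < t" "t < L e" "t \<noteq> y" for E'' y t
        proof (rule ccontr)
          assume "E'' (pt e t) \<noteq> 0"
          then have "(e, t) \<in> chips E''" unfolding chips_def using that e by simp
          then show False using that ED(4)[OF that(1)] unfolding rigid_def by blast
        qed
        show ?thesis using x ED(2)[OF E(1)] m(1) lt u[OF E(1) x(1)] u[OF E(2) x(2)]
          by - (rule disjI2, rule exI[of _ x], rule exI[of _ x'], blast)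
      qed
    qed
    then show "E = E'" using in_R_close_on_edge(2)[OF f(2) f'(2)] v ED(4)[OF E(1)] unfolding f(1) f'(1) by metis
  qed
  ultimately show ?thesis by (rule finite_imageD)
qed

text \<open>A rigid divisor is compared with itself: all displacements are 0, so the flow argument
  applies.\<close>

lemma rigid_unique:
  assumes f: "in_R D f" and f': "in_R D f'" and vl: "rigid (plus_div D f)"
    and eq: "(plus_div D f') = (plus_div D f)"
  shows "\<exists>c. f' = (\<lambda>x\<in>curve G. f x + c)"
proof (rule in_R_close_on_edge(1)[OF f f' vl])
  let ?E = "plus_div D f"
  show "D (vx v) + ord G f (vx v) = D (vx v) + ord G f' (vx v)" for v using eq by metis
  show "close_on_edge ?E (plus_div D f') e" if e: "e \<in> edges G" for e
    unfolding eq
  proof (rule close_on_edgeI[OF _ e])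
    from rigid_edge[OF vl e]
    show "(\<forall>t. 0 < t \<longrightarrow> t < L e \<longrightarrow> ?E (pt e t) = 0 \<and> ?E (pt e t) = 0) \<or>
    (\<exists>x x'. (e, x) \<in> chips ?E \<and> (e, x') \<in> chips ?E \<and> 0 \<le> ?E (pt e x) \<and> ?E (pt e x) = ?E (pt e x') \<and>
      (\<forall>t. 0 < t \<longrightarrow> t < L e \<longrightarrow> t \<noteq> x \<longrightarrow> ?E (pt e t) = 0) \<and> (\<forall>t. 0 < t \<longrightarrow> t < L e \<longrightarrow> t \<noteq> x' \<longrightarrow> ?E (pt e t) = 0) \<and>
      of_int (?E (pt e x)) * \<bar>x - x'\<bar> < L e)"
    proof
      assume "\<exists>x. (e, x) \<in> chips ?E \<and> (\<forall>t. 0 < t \<longrightarrow> t < L e \<longrightarrow> t \<noteq> x \<longrightarrow> ?E (pt e t) = 0)"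
      then obtain x where "(e, x) \<in> chips ?E" "\<forall>t. 0 < t \<longrightarrow> t < L e \<longrightarrow> t \<noteq> x \<longrightarrow> ?E (pt e t) = 0" by blast
      then show ?thesis using in_R_nonneg[OF f] L_pos[OF e] by (intro disjI2 exI[of _ x]) auto
    qed auto
  qed
qed

section \<open>Existence and uniqueness of reduced divisors\<close>

text \<open>Where \<open>f\<close> attains the maximum, every outgoing slope of the maximum is at
  least that of \<open>f\<close>; hence the order is at least that of \<open>f\<close>, and likewise
  for \<open>g\<close>.\<close>

lemma in_R_max:
  assumes D: "is_divisor G D" and f: "in_R D f" and g: "in_R D g"
  shows "in_R D (\<lambda>x\<in>curve G. max (f x) (g x))"
proof -
  have rf: "rational_fun G f" "rational_fun G g" using f g unfolding in_R_def by auto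
  let ?h = "\<lambda>x\<in>curve G. max (f x) (g x)"
  have rh: "rational_fun G ?h" by (rule rational_max[OF rf])
  show ?thesis
  proof (rule in_RI[OF D rh])
    fix x assume x: "x \<in> curve G"
    have sl: "outgoing_slope G ?h (e,t,s) =
        (if g x < f x then outgoing_slope G f (e,t,s) else if f x < g x then outgoing_slope G g (e,t,s)
         else max (outgoing_slope G f (e,t,s)) (outgoing_slope G g (e,t,s)))"
      if k: "(e,t,s) \<in> directions G x" for e t s
    proof -
      have e: "e \<in> edges G" "valid_dir (L e) t s" "pt e t = x" using k unfolding directions_iff by auto
      have "has_slope (\<lambda>t. max (f (pt e t)) (g (pt e t))) t s
        (if g x < f x then outgoing_slope G f (e,t,s) else if f x < g x then outgoing_slope G g (e,t,s)
         else max (outgoing_slope G f (e,t,s)) (outgoing_slope G g (e,t,s)))"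
        using has_slope_max[OF has_slope_dir[OF rf(1) k] has_slope_dir[OF rf(2) k]] unfolding e(3) .
      then have "has_slope (\<lambda>t. ?h (pt e t)) t s
        (if g x < f x then outgoing_slope G f (e,t,s) else if f x < g x then outgoing_slope G g (e,t,s)
         else max (outgoing_slope G f (e,t,s)) (outgoing_slope G g (e,t,s)))"
        by (rule has_slope_cong[OF _ e(2)]) (use pt_curve[OF e(1)] in auto)
      then show ?thesis unfolding outgoing_slope_eq by (rule the_slopeI)
    qed
    have "ord G f x \<le> ord G ?h x" if "g x \<le> f x"
      unfolding ord_def by (rule sum_mono) (use that sl in \<open>auto split: prod.splits\<close>)
    moreover have "ord G g x \<le> ord G ?h x" if "f x \<le> g x"
      unfolding ord_def by (rule sum_mono) (use that sl in \<open>auto split: prod.splits\<close>)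
    ultimately show "0 \<le> D x + ord G ?h x"
      using in_R_nonneg[OF f, of x] in_R_nonneg[OF g, of x] by (cases "g x \<le> f x") auto
  qed
qed

lemma in_R_shift:
  assumes "in_R D f" shows "in_R D (\<lambda>x\<in>curve G. f x + c)"
  using assms unfolding in_R_def ord_shift by (simp add: rational_shift)

lemma in_R_Max:
  assumes D: "is_divisor G D" and "finite H" "H \<noteq> {}" "\<And>h. h \<in> H \<Longrightarrow> in_R D h"
  shows "in_R D (\<lambda>x\<in>curve G. Max ((\<lambda>h. h x + c h) ` H))"
  using assms(2-4)
proof (induction rule: finite_ne_induct)
  case (singleton h)
  then show ?case using in_R_shift[of D h "c h"] by (simp add: restrict_def)
next
  case (insert h H)
  have "in_R D (\<lambda>x\<in>curve G. max ((\<lambda>x\<in>curve G. h x + c h) x) ((\<lambda>x\<in>curve G. Max ((\<lambda>h. h x + c h) ` H)) x))"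
    by (rule in_R_max[OF D in_R_shift]) (use insert in auto)
  moreover have "(\<lambda>x\<in>curve G. max ((\<lambda>x\<in>curve G. h x + c h) x) ((\<lambda>x\<in>curve G. Max ((\<lambda>h. h x + c h) ` H)) x))
     = (\<lambda>x\<in>curve G. Max ((\<lambda>h. h x + c h) ` insert h H))"
    using insert by (intro restrict_ext) simp
  ultimately show ?case by (simp only:)
qed

text \<open>The maximum over one function for each rigid divisor, all normalized to vanish at
  \<open>P\<close>. By \<open>rigid_unique\<close> a chosen representative differs only by a
  constant from the function produced by \<open>rigid_dominates\<close>.\<close>

lemma maximal_exists:
  assumes D: "is_divisor G D" and ne: "in_R D f0" and P: "P \<in> curve G"
  obtains f where "maximal D P f" "f P = 0"
proof -
  define rep where "rep E = (SOME f. in_R D f \<and> E = (plus_div D f))" for E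
  have rep: "in_R D (rep E) \<and> E = (\<lambda>x. D x + ord G (rep E) x)" if "E \<in> rigid_divisors D" for E
  proof -
    have "\<exists>f. in_R D f \<and> E = (plus_div D f)" using that unfolding rigid_divisors_def by blast
    then show ?thesis unfolding rep_def by (rule someI_ex)
  qed
  define H where "H = rep ` rigid_divisors D"
  define F where "F = (\<lambda>x\<in>curve G. Max ((\<lambda>h. h x + (- h P)) ` H))"
  have finH: "finite H" unfolding H_def using rigid_divisors_finite[OF D] by simp
  have dom: "\<exists>h\<in>H. f x - f P \<le> h x - h P" if f: "in_R D f" and x: "x \<in> curve G" for f x
  proof -
    obtain h where h: "in_R D h" "rigid (plus_div D h)" "f x - f P \<le> h x - h P"
      using rigid_dominates[OF D f x P] by blast
    let ?E = "plus_div D h"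
    have E: "?E \<in> rigid_divisors D" unfolding rigid_divisors_def using h by blast
    have "\<exists>c. rep ?E = (\<lambda>x\<in>curve G. h x + c)"
      by (rule rigid_unique[OF h(1) _ h(2)]) (use rep[OF E] in auto)
    then obtain c where "rep ?E = (\<lambda>x\<in>curve G. h x + c)" ..
    then have "rep ?E x - rep ?E P = h x - h P" using x P by simp
    then show ?thesis using h(3) E unfolding H_def by (intro bexI[of _ "rep ?E"]) auto
  qed
  have neH: "H \<noteq> {}" using dom[OF ne P] by blast
  have "in_R D F" unfolding F_def by (rule in_R_Max[OF D finH neH]) (use rep in \<open>auto simp: H_def\<close>)
  moreover have F0: "F P = 0" unfolding F_def using P neH by (simp add: image_constant_conv)
  moreover have "f x - f P \<le> F x - F P" if f: "in_R D f" and x: "x \<in> curve G" for f x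
  proof -
    obtain h where h: "h \<in> H" "f x - f P \<le> h x - h P" using dom[OF f x] by blast
    have "h x + (- h P) \<le> F x" unfolding F_def using x finH h(1) by (auto intro: Max_ge)
    then show ?thesis using h(2) F0 by simp
  qed
  ultimately have "maximal D P F" unfolding maximal_def by blast
  then show thesis using that F0 by blast
qed

lemma maximal_unique:
  assumes "maximal D P f" "maximal D P f'" "x \<in> curve G"
  shows "f' x - f' P = f x - f P"
  using assms unfolding maximal_def by (meson order_antisym)

lemma maximal_unique_fun:
  assumes "maximal D P f" "maximal D P f'"
  shows "f' = (\<lambda>x\<in>curve G. f x + (f' P - f P))"
proof -
  have "f' x = f x + (f' P - f P)" if "x \<in> curve G" for x
    using maximal_unique[OF assms that] by simp
  then show ?thesis using assms(2) unfolding maximal_def in_R_def rational_iff extensional_def by auto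
qed

text \<open>Justifies the definite description: every reduced divisor in the class comes from a
  maximal function, and maximal functions at the same point differ by a constant.\<close>

lemma Red_maximal:
  assumes D: "is_divisor G D" and P: "P \<in> curve G" and f: "maximal D P f"
  shows "Red G D P = (plus_div D f)"
  unfolding Red_def
proof (rule the_equality)
  have rf: "rational_fun G f" "in_R D f" using f unfolding maximal_def in_R_def by auto
  show "reduced G P (plus_div D f) \<and> lin_equiv G (plus_div D f) D"
    using maximal_imp_reduced[OF D P f] rf(1) unfolding lin_equiv_def div_fun_def by auto
  fix D' assume *: "reduced G P D' \<and> lin_equiv G D' D"
  then obtain g where g: "rational_fun G g" "(\<lambda>x. D' x - D x) = ord G g"
    unfolding lin_equiv_def div_fun_def by auto
  have D': "D' = (plus_div D g)" using g(2) by (auto simp: fun_eq_iff algebra_simps)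
  have "maximal D P g"
    by (rule reduced_imp_maximal[OF D P g(1)]) (use * D' rf(2) in auto)
  then show "D' = (plus_div D f)"
    unfolding D' using maximal_unique_fun[OF f] ord_shift by metis
qed

lemma red_fun_maximal:
  assumes D: "is_divisor G D" and P: "P \<in> curve G" and f: "maximal D P f" "f P = 0"
  shows "red_fun G D P = f"
  unfolding red_fun_def
proof (rule the_equality)
  have rf: "rational_fun G f" "in_R D f" using f unfolding maximal_def in_R_def by auto
  show "rational_fun G f \<and> (\<lambda>x. D x + div_fun G f x) = Red G D P \<and> f P = 0"
    using rf Red_maximal[OF D P f(1)] f(2) unfolding div_fun_def by simp
  fix g assume g: "rational_fun G g \<and> (\<lambda>x. D x + div_fun G g x) = Red G D P \<and> g P = 0"
  then have "(plus_div D g) = (plus_div D f)"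
    unfolding Red_maximal[OF D P f(1)] div_fun_def by simp
  then have "maximal D P g"
    by (intro reduced_imp_maximal[OF D P]) (use g maximal_imp_reduced[OF D P f(1)] rf(2) in auto)
  from maximal_unique_fun[OF f(1) this] show "g = f"
    using g f(2) rf(1) unfolding rational_iff by (auto simp: restrict_def extensional_def fun_eq_iff)
qed

end

text \<open>The piecewise linear map with slopes \<open>a\<close>, \<open>b\<close>,
  \<open>c\<close> on the three parts. The smallest slope \<open>\<mu>\<close> bounds all increments
  from below, which gives strict monotonicity.\<close>

lemma stretch2:
  fixes x y x' y' l :: real
  assumes "0 < x" "x < y" "y < l" "0 < x'" "x' < y'" "y' < l"
  obtains \<psi> where "continuous_on {0..l} \<psi>" "\<psi> 0 = 0" "\<psi> l = l" "\<psi> x = x'" "\<psi> y = y'"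
    "\<And>u t. u < t \<Longrightarrow> \<psi> u < \<psi> t"
proof -
  define a b c where "a = x' / x" and "b = (y' - x') / (y - x)" and "c = (l - y') / (l - y)"
  have pos: "0 < a" "0 < b" "0 < c" unfolding a_def b_def c_def using assms by auto
  have e: "a * x = x'" "b * (y - x) = y' - x'" "c * (l - y) = l - y'"
    unfolding a_def b_def c_def using assms by auto
  define \<psi> where "\<psi> t = a * min t x + b * (min (max t x) y - x) + c * (max t y - y)" for t
  have "\<psi> u < \<psi> t" if "u < t" for u t
  proof -
    define A B C where "A = min t x - min u x" and "B = min (max t x) y - min (max u x) y" and "C = max t y - max u y"
    have nn: "0 \<le> A" "0 \<le> B" "0 \<le> C" "A + B + C = t - u"
      unfolding A_def B_def C_def using that assms by (auto simp: min_def max_def)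
    define \<mu> where "\<mu> = min a (min b c)"
    have mu: "0 < \<mu>" "\<mu> \<le> a" "\<mu> \<le> b" "\<mu> \<le> c" unfolding \<mu>_def using pos by auto
    have "\<mu> * (t - u) = \<mu> * A + \<mu> * B + \<mu> * C" unfolding nn(4)[symmetric] by (simp add: algebra_simps)
    also have "\<dots> \<le> a * A + b * B + c * C"
      using nn mu by (intro add_mono mult_right_mono) auto
    also have "\<dots> = \<psi> t - \<psi> u" unfolding \<psi>_def A_def B_def C_def by (simp add: algebra_simps)
    finally have "\<mu> * (t - u) \<le> \<psi> t - \<psi> u" .
    moreover have "0 < \<mu> * (t - u)" using mu(1) that by simp
    ultimately show ?thesis by simp
  qed
  moreover have "continuous_on {0..l} \<psi>" unfolding \<psi>_def by (intro continuous_intros)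
  moreover have "\<psi> 0 = 0" "\<psi> l = l" "\<psi> x = x'" "\<psi> y = y'"
    unfolding \<psi>_def using assms e by (auto simp: min_def max_def)
  ultimately show thesis using that by blast
qed

context tcurve
begin

section \<open>Homeomorphisms moving chips along edges\<close>

lemma edge_homeomorphism:
  assumes "\<And>e. e \<in> edges G \<Longrightarrow> continuous_on {0..L e} (\<Phi> e)" "\<And>e. e \<in> edges G \<Longrightarrow> \<Phi> e 0 = 0"
    "\<And>e. e \<in> edges G \<Longrightarrow> \<Phi> e (L e) = L e" "\<And>e u t. e \<in> edges G \<Longrightarrow> u < t \<Longrightarrow> \<Phi> e u < \<Phi> e t"
  obtains \<phi> \<psi> where "homeomorphism (curve G) (curve G) \<phi> \<psi>" "\<And>v. \<phi> (vx v) = vx v"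
    "\<And>e t. e \<in> edges G \<Longrightarrow> 0 \<le> t \<Longrightarrow> t \<le> L e \<Longrightarrow> \<phi> (pt e t) = pt e (\<Phi> e t)"
proof -
  obtain \<phi> where \<phi>: "\<And>v. \<phi> (vx v) = vx v" "\<And>e t. e \<in> edges G \<Longrightarrow> 0 \<le> t \<Longrightarrow> t \<le> L e \<Longrightarrow> \<phi> (pt e t) = pt e (\<Phi> e t)"
    by (rule glue_ex[of "\<lambda>e t. pt e (\<Phi> e t)" vx]) (use assms(2,3) pt_0 pt_L in auto)
  have rng: "0 \<le> \<Phi> e t" "\<Phi> e t \<le> L e" if "e \<in> edges G" "0 \<le> t" "t \<le> L e" for e t
    using assms(2,3)[OF that(1)] assms(4)[OF that(1), of 0 t] assms(4)[OF that(1), of t "L e"] that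
    by (cases "t = 0"; cases "t = L e"; force)+
  have srng: "0 < \<Phi> e t" "\<Phi> e t < L e" if "e \<in> edges G" "0 < t" "t < L e" for e t
    using assms(2,3)[OF that(1)] assms(4)[OF that(1), of 0 t] assms(4)[OF that(1), of t "L e"] that by auto
  have inj: "t = u" if "e \<in> edges G" "\<Phi> e t = \<Phi> e u" for e t u
    using assms(4)[OF that(1), of t u] assms(4)[OF that(1), of u t] that(2) by (cases t u rule: linorder_cases) auto
  have cont: "continuous_on (curve G) \<phi>"
  proof (rule continuous_on_curve)
    fix e assume e: "e \<in> edges G"
    have "continuous_on {0..L e} (\<lambda>t. pt e (\<Phi> e t))"
      by (rule continuous_on_compose2[OF pt_continuous[of UNIV] assms(1)[OF e]]) auto
    then show "continuous_on {0..L e} (\<lambda>t. \<phi> (pt e t))"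
      by (rule continuous_on_eq) (use \<phi>(2)[OF e] in auto)
  qed
  have im: "\<phi> ` curve G = curve G"
  proof (intro equalityI subsetI)
    fix y assume "y \<in> \<phi> ` curve G"
    then obtain x where x: "x \<in> curve G" "y = \<phi> x" by blast
    from x(1) show "y \<in> curve G"
      by (cases rule: curve_cases) (use x(2) \<phi> vx_curve pt_curve rng in auto)
  next
    fix y assume "y \<in> curve G"
    then show "y \<in> \<phi> ` curve G"
    proof (cases rule: curve_cases)
      case (vertex v) then show ?thesis using \<phi>(1)[of v] vx_curve[of v] by force
    next
      case (interior e t)
      have "\<exists>u\<ge>0. u \<le> L e \<and> \<Phi> e u = t"
        by (rule IVT') (use interior assms(1-3) in auto)
      then obtain u where "0 \<le> u" "u \<le> L e" "\<Phi> e u = t" by blast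
      then show ?thesis using \<phi>(2)[OF interior(1)] pt_curve[OF interior(1)] interior(4) by force
    qed
  qed
  have "inj_on \<phi> (curve G)"
  proof (rule inj_onI)
    fix x y assume xy: "x \<in> curve G" "y \<in> curve G" "\<phi> x = \<phi> y"
    have vi: False if "e \<in> edges G" "0 < t" "t < L e" "\<phi> (vx v) = \<phi> (pt e t)" for e t v
      using pt_vertex[of e "\<Phi> e t" v] \<phi>(1)[of v] \<phi>(2)[of e t] srng[of e t] that by auto
    from xy(1) show "x = y"
    proof (cases rule: curve_cases)
      case v: (vertex v)
      from xy(2) show ?thesis
      proof (cases rule: curve_cases)
        case (vertex w) then show ?thesis using v xy(3) \<phi>(1) by simp
      next
        case (interior e t) then show ?thesis using v xy(3) vi by blast
      qed
    next
      case i: (interior e t)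
      from xy(2) show ?thesis
      proof (cases rule: curve_cases)
        case (vertex w) then show ?thesis using i xy(3) vi by metis
      next
        case (interior e' t')
        have "e = e' \<and> \<Phi> e t = \<Phi> e' t'"
          by (rule pt_interior_eq) (use i interior srng rng xy(3) \<phi>(2) in \<open>auto simp: less_imp_le\<close>)
        then show ?thesis using inj i interior by blast
      qed
    qed
  qed
  then obtain \<psi> where "homeomorphism (curve G) (curve G) \<phi> \<psi>"
    using homeomorphism_compact[OF compact_curve cont im] by blast
  then show thesis using that \<phi> by blast
qed

lemma out_degree_homeomorphism:
  assumes h: "homeomorphism (curve G) (curve G) \<phi> \<psi>" and v: "v \<in> curve G" and X: "X \<subseteq> curve G"
  shows "out_degree G X v \<le> out_degree G (\<phi> ` X) (\<phi> v)"
proof -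
  have inj: "inj_on \<phi> (curve G)" and im: "\<phi> ` curve G = curve G" and cont: "continuous_on (curve G) \<phi>"
    using h unfolding homeomorphism_def by (auto intro: inj_on_inverseI)
  obtain S where S: "segment_family X v S" "card S = out_degree G X v" using out_degree_witness[OF v] by blast
  have gS: "arc g" "pathstart g = v" "path_image g \<subseteq> curve G" "path_image g \<subseteq> curve G - (X - {v})" if "g \<in> S" for g
    using S(1) that unfolding segment_family_def by auto
  have img: "g t \<in> curve G" if "g \<in> S" "0 \<le> t" "t \<le> 1" for g t
    using gS(3)[OF that(1)] that(2,3) unfolding path_image_def by auto
  have dj: "disjnt ((\<phi> \<circ> g) ` {0<..<1}) ((\<phi> \<circ> g') ` {0<..<1})" if "g \<in> S" "g' \<in> S" "g \<noteq> g'" for g g'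
  proof -
    have d: "disjnt (g ` {0<..<1}) (g' ` {0<..<1})" using S(1) that unfolding segment_family_def pairwise_def by blast
    show ?thesis unfolding disjnt_iff
    proof (intro allI notI, elim conjE imageE)
      fix y a b assume ab: "y = (\<phi> \<circ> g) a" "y = (\<phi> \<circ> g') b" "a \<in> {0<..<1}" "b \<in> {0<..<1}"
      then have "g a = g' b" using inj img[OF that(1), of a] img[OF that(2), of b] by (auto simp: inj_on_def)
      then show False using d ab(3,4) unfolding disjnt_iff by (metis imageI)
    qed
  qed
  have "inj_on (\<lambda>g. \<phi> \<circ> g) S"
  proof (rule inj_onI, rule ccontr)
    fix g g' assume g: "g \<in> S" "g' \<in> S" "\<phi> \<circ> g = \<phi> \<circ> g'" "g \<noteq> g'"
    have "(\<phi> \<circ> g) (1/2) \<in> (\<phi> \<circ> g) ` {0<..<1}" by (rule imageI) simp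
    then show False using dj[OF g(1,2,4)] g(3) unfolding disjnt_iff by auto
  qed
  then have "card ((\<lambda>g. \<phi> \<circ> g) ` S) = out_degree G X v" using S(2) by (simp add: card_image)
  moreover have "segment_family (\<phi> ` X) (\<phi> v) ((\<lambda>g. \<phi> \<circ> g) ` S)"
    unfolding segment_family_def
  proof (intro conjI ballI)
    show "finite ((\<lambda>g. \<phi> \<circ> g) ` S)" using S(1) unfolding segment_family_def by simp
    show "pairwise (\<lambda>g h. disjnt (g ` {0<..<1}) (h ` {0<..<1})) ((\<lambda>g. \<phi> \<circ> g) ` S)"
      by (rule pairwiseI) (use dj in blast)
    fix q assume "q \<in> (\<lambda>g. \<phi> \<circ> g) ` S"
    then obtain g where g: "g \<in> S" "q = \<phi> \<circ> g" by blast
    note a = gS[OF g(1)]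
    have "path q" unfolding g(2) using a(1,3) cont
      by (intro path_continuous_image) (auto simp: arc_def intro: continuous_on_subset)
    moreover have "inj_on q {0..1}" unfolding g(2)
      using a(1,3) inj by (intro comp_inj_on) (auto simp: arc_def path_image_def intro: inj_on_subset)
    ultimately show "arc q" unfolding arc_def by simp
    show "pathstart q = \<phi> v" unfolding g(2) pathstart_compose using a(2) by simp
    show "path_image q \<subseteq> curve G - (\<phi> ` X - {\<phi> v})"
    proof
      fix y assume "y \<in> path_image q"
      then obtain x where x: "x \<in> path_image g" "y = \<phi> x" unfolding g(2) path_image_compose by blast
      have "x \<in> curve G" "x \<notin> X - {v}" using a(4) x(1) by auto
      then show "y \<in> curve G - (\<phi> ` X - {\<phi> v})" using x(2) im inj X v by (auto simp: inj_on_def)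
    qed
  qed
  moreover have "\<phi> v \<in> curve G" using v im by blast
  ultimately show ?thesis using out_degree_ge by metis
qed

lemma reduced_homeomorphism:
  assumes h: "homeomorphism (curve G) (curve G) \<phi> \<psi>" and P: "P \<in> curve G"
    and E: "\<And>x. x \<in> curve G \<Longrightarrow> E' (\<phi> x) = E x" and red: "reduced G P E" and E': "is_divisor G E'"
  shows "reduced G (\<phi> P) E'"
  unfolding reduced_def
proof (intro conjI allI impI)
  note hom = h[unfolded homeomorphism_def]
  show "is_divisor G E'" by fact
  show "0 \<le> E' v" if "v \<noteq> \<phi> P" for v
  proof (cases "v \<in> curve G")
    case True
    then have "\<psi> v \<in> curve G" "\<phi> (\<psi> v) = v" using hom by auto
    moreover from this have "\<psi> v \<noteq> P" using that by auto
    ultimately show ?thesis using E[of "\<psi> v"] red unfolding reduced_def by metis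
  next
    case False
    then have "E' v = 0" using E' unfolding is_divisor_def by blast
    then show ?thesis by simp
  qed
  fix X assume X: "X \<subseteq> curve G \<and> closed X \<and> connected X \<and> X \<noteq> {} \<and> \<phi> P \<notin> X"
  define Y where "Y = \<psi> ` X"
  have "compact X" using X compact_curve by (metis compact_Int_closed inf.absorb2)
  have cont: "continuous_on X \<psi>" using hom X continuous_on_subset by blast
  have Y: "Y \<subseteq> curve G" "closed Y" "connected Y" "Y \<noteq> {}" "P \<notin> Y"
  proof -
    show "Y \<subseteq> curve G" unfolding Y_def using hom X by blast
    show "closed Y" unfolding Y_def by (intro compact_imp_closed compact_continuous_image cont) fact
    show "connected Y" unfolding Y_def using cont X by (intro connected_continuous_image) auto
    show "Y \<noteq> {}" unfolding Y_def using X by auto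
    show "P \<notin> Y" unfolding Y_def using X hom by (auto simp: subset_iff)
  qed
  have fY: "\<phi> ` Y = X" unfolding Y_def image_image using X hom by (force simp: subset_iff image_iff)
  obtain v where v: "v \<in> top_of_set (curve G) frontier_of Y" "E v < int (out_degree G Y v)"
    using red Y unfolding reduced_def by blast
  have vG: "v \<in> curve G" using v(1) by (auto simp: frontier_of_def closure_of_def)
  have "homeomorphic_map (top_of_set (curve G)) (top_of_set (curve G)) \<phi>"
  proof -
    have "homeomorphic_maps (top_of_set (curve G)) (top_of_set (curve G)) \<phi> \<psi>"
      using hom unfolding homeomorphic_maps_def by (auto simp: continuous_map_subtopology_eu)
    then show ?thesis by (simp add: homeomorphic_maps_map)
  qed
  then have "top_of_set (curve G) frontier_of (\<phi> ` Y) = \<phi> ` (top_of_set (curve G) frontier_of Y)"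
    using Y(1) by (intro homeomorphic_map_frontier_of) auto
  then have "\<phi> v \<in> top_of_set (curve G) frontier_of X" using v(1) fY by blast
  moreover have "E' (\<phi> v) < int (out_degree G X (\<phi> v))"
    using v(2) E[OF vG] out_degree_homeomorphism[OF h vG Y(1)] fY by simp
  ultimately show "\<exists>v\<in>top_of_set (curve G) frontier_of X. E' v < int (out_degree G X v)" by blast
qed

section \<open>Following a reduced divisor along an edge\<close>

text \<open>Stretching an edge displaces every chip in its interior, so on an edge with a moving
  chip all chips have to take part.\<close>

definition saturated :: "'v divisor \<Rightarrow> (('v \<times> 'v) \<times> real) set \<Rightarrow> bool" where
  "saturated E T \<longleftrightarrow> (\<forall>e x t. (e, x) \<in> T \<longrightarrow> (e, t) \<in> chips E \<longrightarrow> (e, t) \<in> T)"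

lemma edge_stretch:
  assumes cut: "is_cut E T \<sigma> \<kappa>" and E: "effective G E" and s: "strictly_admissible E T \<sigma> \<delta>" and e: "e \<in> edges G"
  shows "\<exists>\<psi>. continuous_on {0..L e} \<psi> \<and> \<psi> 0 = 0 \<and> \<psi> (L e) = L e \<and> (\<forall>u t. u < t \<longrightarrow> \<psi> u < \<psi> t) \<and>
     (\<forall>x. (e, x) \<in> T \<longrightarrow> \<psi> x = target E \<sigma> \<delta> (e, x)) \<and> ({x. (e, x) \<in> T} = {} \<longrightarrow> \<psi> = (\<lambda>t. t))"
proof -
  have r: "0 < x" "x < L e" "0 < target E \<sigma> \<delta> (e, x)" "target E \<sigma> \<delta> (e, x) < L e" if "(e,x) \<in> T" for x
    using cut_chip[OF cut E that] s that unfolding strictly_admissible_def by blast+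
  have one: ?thesis if T: "{x. (e, x) \<in> T} = {x}" for x
  proof -
    have xT: "(e,x) \<in> T" using T by auto
    note rx = r[OF xT]
    \<comment> \<open>With a single chip the second node is a dummy: the midpoint between chip and
      end goes to the midpoint between target and end.\<close>
    obtain \<psi> where "continuous_on {0..L e} \<psi>" "\<psi> 0 = 0" "\<psi> (L e) = L e" "\<psi> x = target E \<sigma> \<delta> (e, x)"
      "\<psi> ((x + L e) / 2) = (target E \<sigma> \<delta> (e, x) + L e) / 2" "\<And>u t. u < t \<Longrightarrow> \<psi> u < \<psi> t"
      by (rule stretch2[of x "(x + L e) / 2" "L e" "target E \<sigma> \<delta> (e, x)" "(target E \<sigma> \<delta> (e, x) + L e) / 2"]) (use rx in auto)
    moreover have "z = x" if "(e,z) \<in> T" for z using T that by blast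
    ultimately show ?thesis using T by (intro exI[of _ \<psi>]) auto
  qed
  have two: ?thesis if T: "{x. (e, x) \<in> T} = {x, y}" "x < y" for x y
  proof -
    have xT: "(e,x) \<in> T" "(e,y) \<in> T" using T by auto
    have "target E \<sigma> \<delta> (e, x) < target E \<sigma> \<delta> (e, y)" using s xT T(2) unfolding strictly_admissible_def by blast
    then obtain \<psi> where "continuous_on {0..L e} \<psi>" "\<psi> 0 = 0" "\<psi> (L e) = L e" "\<psi> x = target E \<sigma> \<delta> (e, x)"
      "\<psi> y = target E \<sigma> \<delta> (e, y)" "\<And>u t. u < t \<Longrightarrow> \<psi> u < \<psi> t"
      using stretch2[of x y "L e" "target E \<sigma> \<delta> (e, x)" "target E \<sigma> \<delta> (e, y)"] r[OF xT(1)] r[OF xT(2)] T(2) by metis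
    moreover have "z = x \<or> z = y" if "(e,z) \<in> T" for z using T that by blast
    ultimately show ?thesis using T by (intro exI[of _ \<psi>]) auto
  qed
  from cut E e show ?thesis
  proof (cases rule: cut_edge_cases)
    case none
    then show ?thesis by (intro exI[of _ "\<lambda>t. t"]) auto
  next
    case (up x m) then show ?thesis using one by blast
  next
    case (down x m) then show ?thesis using one by blast
  next
    case (inn x y m n) then show ?thesis using two by blast
  next
    case (out x y m n) then show ?thesis using two by blast
  qed
qed

text \<open>Stretching the edges so that every chip of \<open>T\<close> goes to its target is a
  homeomorphism of the curve. It carries \<open>E\<close> to the moved divisor, and reducedness is a
  topological property of the curve with its divisor and base point.\<close>

lemma reduced_moved:
  assumes cut: "is_cut E T \<sigma> \<kappa>" and E: "effective G E" and saturated: "saturated E T" and s: "strictly_admissible E T \<sigma> \<delta>"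
    and div: "is_divisor G (moved E T \<sigma> \<delta>)" and k0: "(e0, x0) \<in> T" and red: "reduced G (pt e0 x0) E"
  shows "reduced G (pt e0 (target E \<sigma> \<delta> (e0, x0))) (moved E T \<sigma> \<delta>)"
proof -
  have "\<forall>e\<in>edges G. \<exists>\<psi>. continuous_on {0..L e} \<psi> \<and> \<psi> 0 = 0 \<and> \<psi> (L e) = L e \<and> (\<forall>u t. u < t \<longrightarrow> \<psi> u < \<psi> t) \<and>
     (\<forall>x. (e, x) \<in> T \<longrightarrow> \<psi> x = target E \<sigma> \<delta> (e, x)) \<and> ({x. (e, x) \<in> T} = {} \<longrightarrow> \<psi> = (\<lambda>t. t))"
    using edge_stretch[OF cut E s] by blast
  then obtain \<Phi> where \<Phi>0: "\<forall>e\<in>edges G. continuous_on {0..L e} (\<Phi> e) \<and> \<Phi> e 0 = 0 \<and> \<Phi> e (L e) = L e \<and> (\<forall>u t. u < t \<longrightarrow> \<Phi> e u < \<Phi> e t) \<and>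
     (\<forall>x. (e, x) \<in> T \<longrightarrow> \<Phi> e x = target E \<sigma> \<delta> (e, x)) \<and> ({x. (e, x) \<in> T} = {} \<longrightarrow> \<Phi> e = (\<lambda>t. t))"
    by (rule bchoice[THEN exE])
  note \<Phi> = bspec[OF \<Phi>0]
  obtain \<phi> \<psi> where h: "homeomorphism (curve G) (curve G) \<phi> \<psi>" and \<phi>: "\<And>v. \<phi> (vx v) = vx v"
    "\<And>e t. e \<in> edges G \<Longrightarrow> 0 \<le> t \<Longrightarrow> t \<le> L e \<Longrightarrow> \<phi> (pt e t) = pt e (\<Phi> e t)"
    by (rule edge_homeomorphism[of \<Phi>]) (use \<Phi> in blast)+
  note Tk = cut_chip[OF cut E]
  have finT: "finite T" using cut_finite[OF cut] E unfolding effective_def by simp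
  have mvr: "0 < target E \<sigma> \<delta> (e, x)" "target E \<sigma> \<delta> (e, x) < L e" if "(e,x) \<in> T" for e x
    using s that unfolding strictly_admissible_def by blast+
  have "moved E T \<sigma> \<delta> (\<phi> x) = E x" if "x \<in> curve G" for x
    using that
  proof (cases rule: curve_cases)
    case (vertex v)
    have nv: "pt e t \<noteq> vx v" if "e \<in> edges G" "0 < t" "t < L e" for e t
      using pt_vertex[of e t v] that by auto
    have "vx v \<notin> (\<lambda>(e,x). pt e x) ` T"
    proof
      assume "vx v \<in> (\<lambda>(e,x). pt e x) ` T"
      then obtain e x where "(e, x) \<in> T" "vx v = pt e x" by auto
      then show False using nv[of e x] Tk(1-3)[of e x] by simp
    qed
    moreover have "(\<Sum>(e, x)\<in>T. E (pt e x) * of_bool (pt e (target E \<sigma> \<delta> (e, x)) = vx v)) = 0"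
      using nv Tk(1) mvr by (intro sum.neutral) auto
    ultimately show ?thesis unfolding moved_eq[OF cut E] vertex \<phi>(1) by simp
  next
    case (interior e t)
    note \<Phi>e = \<Phi>[OF interior(1)]
    have rng: "0 < \<Phi> e t" "\<Phi> e t < L e" using \<Phi>e interior(2,3) by metis+
    have \<phi>x: "\<phi> x = pt e (\<Phi> e t)" using \<phi>(2)[OF interior(1)] interior by simp
    have "(\<Sum>(e', x)\<in>T. E (pt e' x) * of_bool (pt e' (target E \<sigma> \<delta> (e', x)) = pt e (\<Phi> e t))) =
       (\<Sum>k\<in>T. if k = (e, t) then E (pt e t) else 0)"
    proof (rule sum.cong[OF refl])
      fix k assume k: "k \<in> T"
      obtain e' x' where k': "k = (e',x')" by (metis surj_pair)
      have kT: "(e',x') \<in> T" using k k' by simp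
      have "pt e' (target E \<sigma> \<delta> (e', x')) = pt e (\<Phi> e t) \<longleftrightarrow> (e', x') = (e, t)"
      proof
        assume "pt e' (target E \<sigma> \<delta> (e', x')) = pt e (\<Phi> e t)"
        then have "e' = e \<and> target E \<sigma> \<delta> (e', x') = \<Phi> e t"
          by (intro pt_interior_eq) (use Tk(1)[OF kT] mvr[OF kT] interior(1) rng in auto)
        then have "e' = e" "\<Phi> e x' = \<Phi> e t" using \<Phi>e kT by auto
        then show "(e', x') = (e, t)" using \<Phi>e by (metis linorder_neqE_linordered_idom order_less_irrefl)
      next
        assume "(e', x') = (e, t)"
        then show "pt e' (target E \<sigma> \<delta> (e', x')) = pt e (\<Phi> e t)" using \<Phi>e kT by auto
      qed
      then show "(case k of (e', x) \<Rightarrow> E (pt e' x) * of_bool (pt e' (target E \<sigma> \<delta> (e', x)) = pt e (\<Phi> e t))) =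
        (if k = (e, t) then E (pt e t) else 0)" unfolding k' by auto
    qed
    also have "\<dots> = (if (e, t) \<in> T then E (pt e t) else 0)" using finT by (simp add: sum.delta)
    finally have S: "(\<Sum>(e', x)\<in>T. E (pt e' x) * of_bool (pt e' (target E \<sigma> \<delta> (e', x)) = pt e (\<Phi> e t)))
      = (if (e, t) \<in> T then E (pt e t) else 0)" .
    have inT: "pt e u \<in> (\<lambda>(e,x). pt e x) ` T \<longleftrightarrow> (e, u) \<in> T" if "0 < u" "u < L e" for u
    proof
      assume "pt e u \<in> (\<lambda>(e,x). pt e x) ` T"
      then obtain e' x' where x: "(e',x') \<in> T" "pt e u = pt e' x'" by auto
      have "e = e' \<and> u = x'" by (rule pt_interior_eq) (use x Tk[OF x(1)] interior(1) that in auto)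
      then show "(e, u) \<in> T" using x by simp
    qed force
    show ?thesis
    proof (cases "{x. (e, x) \<in> T} = {}")
      case True
      then have "\<Phi> e t = t" using \<Phi>e by simp
      moreover have "(e, t) \<notin> T" using True by blast
      ultimately show ?thesis unfolding moved_eq[OF cut E] \<phi>x S using inT interior by simp
    next
      case False
      then obtain x1 where x1: "(e, x1) \<in> T" by blast
      \<comment> \<open>By saturation all chips on this edge belong to \<open>T\<close>, so no other
        coefficient is displaced.\<close>
      have z: "E (pt e u) = 0" if "0 < u" "u < L e" "(e, u) \<notin> T" for u
      proof (rule ccontr)
        assume "E (pt e u) \<noteq> 0"
        then have "(e, u) \<in> chips E" unfolding chips_def using that interior(1) by simp
        then show False using saturated x1 that(3) unfolding saturated_def by blast
      qed
      have "(if pt e (\<Phi> e t) \<in> (\<lambda>(e,x). pt e x) ` T then 0 else E (pt e (\<Phi> e t))) = 0"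
        using inT[OF rng] z[OF rng] by simp
      then show ?thesis unfolding moved_eq[OF cut E] \<phi>x S using z[of t] interior by auto
    qed
  qed
  moreover have "\<phi> (pt e0 x0) = pt e0 (target E \<sigma> \<delta> (e0, x0))"
    using \<phi>(2)[of e0 x0] Tk[OF k0] \<Phi>[OF Tk(1)[OF k0]] k0 by simp
  ultimately show ?thesis
    using reduced_homeomorphism[OF h _ _ red div] pt_curve[of e0 x0] Tk[OF k0] by (metis less_imp_le)
qed

text \<open>Before the first event a homeomorphism carries the moved divisor back to the original one.
  Maximality is a closed condition, so it persists at the event itself.\<close>

lemma maximal_moved:
  assumes D: "is_divisor G D" and f: "maximal D (pt e0 x0) f" and cut: "is_cut (plus_div D f) T \<sigma> \<kappa>"
    and saturated: "saturated (plus_div D f) T" and k0: "(e0, x0) \<in> T"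
    and \<delta>: "0 < \<delta>" "admissible (plus_div D f) T \<sigma> \<delta>" "\<And>\<delta>'. 0 \<le> \<delta>' \<Longrightarrow> \<delta>' < \<delta> \<Longrightarrow> strictly_admissible (plus_div D f) T \<sigma> \<delta>'"
  obtains h where "maximal D (pt e0 (target (plus_div D f) \<sigma> \<delta> (e0, x0))) h"
    "\<And>v. h (vx v) = f (vx v) - \<delta> * \<kappa> v"
    "\<And>e t. e \<in> edges G \<Longrightarrow> 0 \<le> t \<Longrightarrow> t \<le> L e \<Longrightarrow> h (pt e t) = f (pt e t) - cut_fun (plus_div D f) T \<sigma> \<kappa> \<delta> e t"
    "(plus_div D h) = moved (plus_div D f) T \<sigma> \<delta>"
    "\<And>x. x \<in> curve G \<Longrightarrow> h x \<le> f x"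
proof -
  let ?E = "plus_div D f"
  have fR: "in_R D f" using f unfolding maximal_def by simp
  then have E: "effective G ?E" and rf: "rational_fun G f" unfolding in_R_def by auto
  note Tk = cut_chip[OF cut E k0]
  have P: "pt e0 x0 \<in> curve G" using pt_curve Tk by simp
  have red: "reduced G (pt e0 x0) ?E" by (rule maximal_imp_reduced[OF D P f])
  define \<mu> where "\<mu> \<delta>' = target ?E \<sigma> \<delta>' (e0, x0)" for \<delta>'
  \<comment> \<open>The value of the cut function at a fixed point of the curve, written out as a
    function of the time \<open>\<delta>'\<close> so that continuity in time becomes
    visible.\<close>
  define B where "B \<delta>' x = (if \<exists>v. x = vx v then \<delta>' * \<kappa> (THE v. x = vx v) else (case (THE p. p \<in> params x) of (e, t) \<Rightarrow> cut_fun ?E T \<sigma> \<kappa> \<delta>' e t))" for \<delta>' x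
  have Bv: "B \<delta>' (vx v) = \<delta>' * \<kappa> v" for \<delta>' v unfolding B_def by (simp add: vx_inj)
  have Bi: "B \<delta>' (pt e t) = cut_fun ?E T \<sigma> \<kappa> \<delta>' e t" if "e \<in> edges G" "0 < t" "t < L e" for \<delta>' e t
    unfolding B_def using pt_vertex[of e t] that by (auto simp: params_interior)
  have \<mu>r: "0 \<le> \<mu> \<delta>'" "\<mu> \<delta>' \<le> L e0" if "0 \<le> \<delta>'" "\<delta>' \<le> \<delta>" for \<delta>'
  proof -
    have "admissible ?E T \<sigma> \<delta>'" using \<delta>(2) \<delta>(3)[of \<delta>'] strictly_admissible_admissible that by (cases "\<delta>' = \<delta>") auto
    then show "0 \<le> \<mu> \<delta>'" "\<mu> \<delta>' \<le> L e0" unfolding admissible_def \<mu>_def using k0 by blast+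
  qed
  \<comment> \<open>Maximality before the collision, expressed by \<open>f\<close>,
    \<open>f'\<close> and cut functions alone. All terms are continuous in \<open>\<delta>'\<close>,
    so the inequality passes to the limit.\<close>
  have step: "f' x - f' (pt e0 (\<mu> \<delta>')) - (f x - B \<delta>' x) + (f (pt e0 (\<mu> \<delta>')) - cut_fun ?E T \<sigma> \<kappa> \<delta>' e0 (\<mu> \<delta>')) \<le> 0"
    if f': "in_R D f'" and x: "x \<in> curve G" and d: "0 \<le> \<delta>'" "\<delta>' < \<delta>" for f' x \<delta>'
  proof -
    note sd = \<delta>(3)[OF d]
    obtain h where h: "in_R D h" "\<And>v. h (vx v) = f (vx v) - \<delta>' * \<kappa> v"
    "\<And>e t. e \<in> edges G \<Longrightarrow> 0 \<le> t \<Longrightarrow> t \<le> L e \<Longrightarrow> h (pt e t) = f (pt e t) - cut_fun ?E T \<sigma> \<kappa> \<delta>' e t"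
    "(plus_div D h) = moved ?E T \<sigma> \<delta>'" "\<And>x. x \<in> curve G \<Longrightarrow> h x \<le> f x"
      by (rule cut_step[OF D fR cut strictly_admissible_admissible[OF sd]]) (rule that)
    have rh: "rational_fun G h" using h(1) unfolding in_R_def by simp
    have "is_divisor G (moved ?E T \<sigma> \<delta>')" unfolding h(4)[symmetric] by (rule is_divisor_add_div[OF D rh])
    from reduced_moved[OF cut E saturated sd this k0 red]
    have "maximal D (pt e0 (\<mu> \<delta>')) h"
      unfolding \<mu>_def h(4)[symmetric]
      by (intro reduced_imp_maximal[OF D _ rh]) (use \<mu>r d pt_curve Tk fR in \<open>auto simp: \<mu>_def\<close>)
    then have "f' x - f' (pt e0 (\<mu> \<delta>')) \<le> h x - h (pt e0 (\<mu> \<delta>'))" using f' x unfolding maximal_def by blast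
    moreover have "h (pt e0 (\<mu> \<delta>')) = f (pt e0 (\<mu> \<delta>')) - cut_fun ?E T \<sigma> \<kappa> \<delta>' e0 (\<mu> \<delta>')"
      using h(3) Tk(1) \<mu>r[of \<delta>'] d by simp
    moreover have "h x = f x - B \<delta>' x"
      using x by (cases rule: curve_cases) (use h(2,3) Bv Bi in auto)
    ultimately show ?thesis by simp
  qed
  have lim: "f' x - f' (pt e0 (\<mu> \<delta>)) - (f x - B \<delta> x) + (f (pt e0 (\<mu> \<delta>)) - cut_fun ?E T \<sigma> \<kappa> \<delta> e0 (\<mu> \<delta>)) \<le> 0"
    if f': "in_R D f'" and x: "x \<in> curve G" for f' x
  proof -
    have cl: "closure {0..<\<delta>} = {0..\<delta>}" using \<delta>(1) by simp
    have c\<mu>: "continuous_on {0..\<delta>} \<mu>" unfolding \<mu>_def target_def by (auto intro!: continuous_intros simp: divide_inverse)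
    have cf: "continuous_on {0..\<delta>} (\<lambda>\<delta>'. g (pt e0 (\<mu> \<delta>')))" if g: "rational_fun G g" for g
      by (rule continuous_on_compose2[OF locally_linear_continuous[OF rational_locally_linear[OF g Tk(1)] less_imp_le[OF L_pos[OF Tk(1)]]] c\<mu>])
        (use \<mu>r in auto)
    have cb: "continuous_on {0..\<delta>} (\<lambda>\<delta>'. cut_fun ?E T \<sigma> \<kappa> \<delta>' e (q \<delta>'))" if "continuous_on {0..\<delta>} q" for q e
      unfolding cut_fun_def target_def using that by (auto intro!: continuous_intros simp: divide_inverse)
    have cB: "continuous_on {0..\<delta>} (\<lambda>\<delta>'. B \<delta>' x)"
      using x
    proof (cases rule: curve_cases)
      case (vertex v) then show ?thesis by (auto simp: Bv intro!: continuous_intros)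
    next
      case (interior e t)
      show ?thesis unfolding interior(4) Bi[OF interior(1-3)] by (rule cb) (rule continuous_on_const)
    qed
    have "rational_fun G f'" using f' unfolding in_R_def by simp
    then have "continuous_on {0..\<delta>} (\<lambda>\<delta>'. f' x - f' (pt e0 (\<mu> \<delta>')) - (f x - B \<delta>' x) + (f (pt e0 (\<mu> \<delta>')) - cut_fun ?E T \<sigma> \<kappa> \<delta>' e0 (\<mu> \<delta>')))"
      by (intro continuous_on_add continuous_on_diff continuous_on_const cf cB cb c\<mu> rf)
    from continuous_le_on_closure[of "{0..<\<delta>}", unfolded cl, OF this, of \<delta> 0] show ?thesis
      using step[OF f' x] \<delta>(1) by simp
  qed
  obtain h where h: "in_R D h" "\<And>v. h (vx v) = f (vx v) - \<delta> * \<kappa> v"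
    "\<And>e t. e \<in> edges G \<Longrightarrow> 0 \<le> t \<Longrightarrow> t \<le> L e \<Longrightarrow> h (pt e t) = f (pt e t) - cut_fun ?E T \<sigma> \<kappa> \<delta> e t"
    "(plus_div D h) = moved ?E T \<sigma> \<delta>" "\<And>x. x \<in> curve G \<Longrightarrow> h x \<le> f x"
    by (rule cut_step[OF D fR cut \<delta>(2)]) (rule that)
  have "maximal D (pt e0 (\<mu> \<delta>)) h"
    unfolding maximal_def
  proof (intro conjI allI impI ballI h(1))
    fix f' x assume f': "in_R D f'" and x: "x \<in> curve G"
    have "h (pt e0 (\<mu> \<delta>)) = f (pt e0 (\<mu> \<delta>)) - cut_fun ?E T \<sigma> \<kappa> \<delta> e0 (\<mu> \<delta>)"
      using h(3) Tk(1) \<mu>r[of \<delta>] \<delta>(1) by simp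
    moreover have "h x = f x - B \<delta> x"
      using x by (cases rule: curve_cases) (use h(2,3) Bv Bi in auto)
    ultimately show "f' x - f' (pt e0 (\<mu> \<delta>)) \<le> h x - h (pt e0 (\<mu> \<delta>))" using lim[OF f' x] by simp
  qed
  then show thesis using that h unfolding \<mu>_def by blast
qed

section \<open>The divisor at the first collision is rigid\<close>

lemma moved_chip_cases:
  assumes cut: "is_cut E T \<sigma> \<kappa>" and E: "effective G E" and admissible: "admissible E T \<sigma> \<delta>"
    and k: "(e, t) \<in> chips (moved E T \<sigma> \<delta>)"
  shows "((e, t) \<in> chips E \<and> (e, t) \<notin> T) \<or> (\<exists>x. (e, x) \<in> T \<and> (e, x) \<in> chips E \<and> t = target E \<sigma> \<delta> (e, x) \<and> 0 < t \<and> t < L e)"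
proof -
  have TC: "T \<subseteq> chips E" using cut unfolding is_cut_def by blast
  have "(e, t) \<in> (chips E - T) \<union> {(e, target E \<sigma> \<delta> (e, x)) | e x. (e, x) \<in> T \<and> 0 < target E \<sigma> \<delta> (e, x) \<and> target E \<sigma> \<delta> (e, x) < L e}"
    using chips_moved[OF cut E admissible] k by (rule subsetD)
  then show ?thesis
  proof
    assume "(e, t) \<in> {(e, target E \<sigma> \<delta> (e, x)) | e x. (e, x) \<in> T \<and> 0 < target E \<sigma> \<delta> (e, x) \<and> target E \<sigma> \<delta> (e, x) < L e}"
    then obtain x where "(e, x) \<in> T" "t = target E \<sigma> \<delta> (e, x)" "0 < t" "t < L e" by auto
    then show ?thesis using TC by blast
  qed simp
qed

text \<open>Any two chips on one edge form a cut and therefore include \<open>P\<close>. So one of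
  the two given chips is \<open>P\<close>, the edge \<open>e\<close> has no third chip and every
  other edge has at most one. The event leaves at most one chip inside \<open>e\<close>. A vertex
  cut that survived could be rerouted on \<open>e\<close> through the chip different from
  \<open>P\<close>.\<close>

lemma rigid_moved_pair:
  assumes D: "is_divisor G D" and f: "maximal D P f" and P: "P \<in> curve G"
    and E_def: "E = (plus_div D f)"
    and xy: "(e, x) \<in> chips E" "(e, y) \<in> chips E" "x < y" and T: "T = {(e,x),(e,y)}"
  shows "saturated E T" "is_cut E T \<sigma> \<kappa> \<Longrightarrow> admissible E T \<sigma> \<delta> \<Longrightarrow> event E T \<sigma> \<delta> \<Longrightarrow> rigid (moved E T \<sigma> \<delta>)"
proof -
  have E: "effective G E" using f unfolding maximal_def in_R_def E_def by blast
  have pairs: "P = pt e' a \<or> P = pt e' b" if "(e',a) \<in> chips E" "(e',b) \<in> chips E" "a < b" for e' a b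
    using maximal_cut[OF D f P, folded E_def, OF pair_cut[OF that]] by auto
  have same: "e' = e'' \<and> a = b" if "(e',a) \<in> chips E" "(e'',b) \<in> chips E" "pt e' a = pt e'' b" for e' e'' a b
    using that pt_interior_eq[of e' e'' a b] unfolding chips_def by auto
  have two: "a = x \<or> a = y" if a: "(e,a) \<in> chips E" for a
  \<comment> \<open>Among three chips on one edge some pair avoids \<open>P\<close>.\<close>
  proof (rule ccontr)
    assume n: "\<not> (a = x \<or> a = y)"
    have ax: "P = pt e a \<or> P = pt e x" using n pairs[of e a x] pairs[of e x a] a xy by (cases a x rule: linorder_cases) auto
    have ay: "P = pt e a \<or> P = pt e y" using n pairs[of e a y] pairs[of e y a] a xy by (cases a y rule: linorder_cases) auto
    have "P = pt e x \<or> P = pt e y" using pairs xy by blast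
    then show False using ax ay same a xy n by (metis order_less_irrefl)
  qed
  then show "saturated E T" unfolding saturated_def T by blast
  assume cut: "is_cut E T \<sigma> \<kappa>" and admissible: "admissible E T \<sigma> \<delta>" and ev: "event E T \<sigma> \<delta>"
  note mc = moved_chip_cases[OF cut E admissible]
  have other: "a = b" if "e' \<noteq> e" "(e',a) \<in> chips E" "(e',b) \<in> chips E" for e' a b
  proof (rule ccontr)
    assume "a \<noteq> b"
    then have "P = pt e' a \<or> P = pt e' b" using pairs[of e' a b] pairs[of e' b a] that by (cases a b rule: linorder_cases) auto
    moreover have "P = pt e x \<or> P = pt e y" using pairs xy by blast
    ultimately show False using same that xy by metis
  qed
  show "rigid (moved E T \<sigma> \<delta>)"
    unfolding rigid_def
  proof (intro conjI allI impI)
    fix e' a b assume ab: "(e', a) \<in> chips (moved E T \<sigma> \<delta>)" "(e', b) \<in> chips (moved E T \<sigma> \<delta>)"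
    show "a = b"
    proof (cases "e' = e")
      case False
      then show ?thesis using mc[OF ab(1)] mc[OF ab(2)] other unfolding T by auto
    next
      case True
      have a: "(a = target E \<sigma> \<delta> (e,x) \<or> a = target E \<sigma> \<delta> (e,y)) \<and> 0 < a \<and> a < L e"
        using mc[OF ab(1)] two unfolding T True by auto
      have b: "(b = target E \<sigma> \<delta> (e,x) \<or> b = target E \<sigma> \<delta> (e,y)) \<and> 0 < b \<and> b < L e"
        using mc[OF ab(2)] two unfolding T True by auto
      have "target E \<sigma> \<delta> (e,x) = target E \<sigma> \<delta> (e,y) \<or> target E \<sigma> \<delta> (e,x) = 0 \<or> target E \<sigma> \<delta> (e,x) = L e \<or> target E \<sigma> \<delta> (e,y) = 0 \<or> target E \<sigma> \<delta> (e,y) = L e"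
        using ev unfolding event_def T by auto
      then show ?thesis using a b by auto
    qed
  next
    fix C :: "'v set" assume C: "C \<noteq> {}" "C \<noteq> UNIV"
    show "\<exists>e\<in>edges G. (fst e \<in> C) \<noteq> (snd e \<in> C) \<and> (\<forall>t. (e, t) \<notin> chips (moved E T \<sigma> \<delta>))"
    proof (rule ccontr)
      assume "\<not> ?thesis"
      then have ch: "\<exists>t. (e', t) \<in> chips E" if "e' \<in> edges G" "(fst e' \<in> C) \<noteq> (snd e' \<in> C)" for e'
        using mc that by blast
      \<comment> \<open>On \<open>e\<close> the chip different from \<open>P\<close> is taken. On
        other edges any chip will do, since \<open>P\<close> lies on \<open>e\<close>; the resulting
        cut avoids \<open>P\<close>.\<close>
      define c where "c e' = (if e' = e then (if P = pt e x then y else x) else (SOME t. (e', t) \<in> chips E))" for e'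
      have c: "(e', c e') \<in> chips E" if "e' \<in> edges G" "(fst e' \<in> C) \<noteq> (snd e' \<in> C)" for e'
        using ch[OF that] xy someI_ex[of "\<lambda>t. (e', t) \<in> chips E"] unfolding c_def by auto
      have "\<exists>(e', t)\<in>{(e, c e) | e. e \<in> edges G \<and> (fst e \<in> C) \<noteq> (snd e \<in> C)}. P = pt e' t"
        by (rule maximal_cut[OF D f P, folded E_def, OF vertex_cut[OF C]]) (use c in blast)
      then obtain e' where e': "e' \<in> edges G" "(fst e' \<in> C) \<noteq> (snd e' \<in> C)" "P = pt e' (c e')" by blast
      have "P = pt e x \<or> P = pt e y" using pairs xy by blast
      moreover have "pt e x \<noteq> pt e y" using same[OF xy(1,2)] xy(3) by auto
      moreover have "e' = e" using same[OF c[OF e'(1,2)]] xy calculation(1) e'(3) by metis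
      ultimately show False using e'(3) unfolding c_def by (auto split: if_splits)
    qed
  qed
qed

text \<open>With at most one chip per edge no two chips of \<open>T\<close> can meet, so the event
  empties an edge \<open>e1\<close> of the cut. A vertex set \<open>C'\<close> whose boundary edges
  all still carry chips cannot separate the ends of \<open>e1\<close>, and this distinguishes it
  from \<open>C\<close>.\<close>

lemma rigid_moved_vertex:
  assumes D: "is_divisor G D" and f: "maximal D P f" and P: "P \<in> curve G"
    and E_def: "E = (plus_div D f)"
    and uniq: "\<And>e x y. (e, x) \<in> chips E \<Longrightarrow> (e, y) \<in> chips E \<Longrightarrow> x = y"
    and C: "C \<noteq> {}" "C \<noteq> UNIV" and c: "\<And>e. e \<in> edges G \<Longrightarrow> (fst e \<in> C) \<noteq> (snd e \<in> C) \<Longrightarrow> (e, c e) \<in> chips E"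
    and T: "T = {(e, c e) | e. e \<in> edges G \<and> (fst e \<in> C) \<noteq> (snd e \<in> C)}"
  shows "saturated E T" "is_cut E T \<sigma> \<kappa> \<Longrightarrow> admissible E T \<sigma> \<delta> \<Longrightarrow> event E T \<sigma> \<delta> \<Longrightarrow> rigid (moved E T \<sigma> \<delta>)"
proof -
  have E: "effective G E" using f unfolding maximal_def in_R_def E_def by blast
  have TC: "T \<subseteq> chips E" unfolding T using c by blast
  show "saturated E T" unfolding saturated_def using uniq TC by (metis subsetD)
  assume cut: "is_cut E T \<sigma> \<kappa>" and admissible: "admissible E T \<sigma> \<delta>" and ev: "event E T \<sigma> \<delta>"
  note mc = moved_chip_cases[OF cut E admissible]
  have same: "e' = e'' \<and> a = b" if "(e',a) \<in> chips E" "(e'',b) \<in> chips E" "pt e' a = pt e'' b" for e' e'' a b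
    using that pt_interior_eq[of e' e'' a b] unfolding chips_def by auto
  define q where "q e = (SOME t. (e, t) \<in> chips E)" for e
  have q: "(e, q e) \<in> chips E" if "(e, t) \<in> chips E" for e t unfolding q_def by (rule someI) (rule that)
  have cutP: "\<exists>e\<in>edges G. (fst e \<in> C') \<noteq> (snd e \<in> C') \<and> (\<exists>t. (e, t) \<in> chips E \<and> P = pt e t)"
    if C': "C' \<noteq> {}" "C' \<noteq> UNIV" "\<And>e. e \<in> edges G \<Longrightarrow> (fst e \<in> C') \<noteq> (snd e \<in> C') \<Longrightarrow> \<exists>t. (e, t) \<in> chips E" for C'
  proof -
    have "\<exists>(e', t)\<in>{(e, q e) | e. e \<in> edges G \<and> (fst e \<in> C') \<noteq> (snd e \<in> C')}. P = pt e' t"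
      by (rule maximal_cut[OF D f P, folded E_def, OF vertex_cut[OF C'(1,2)]]) (use q C'(3) in blast)
    then show ?thesis using q C'(3) by blast
  qed
  show "rigid (moved E T \<sigma> \<delta>)"
    unfolding rigid_def
  proof (intro conjI allI impI)
    fix e a b assume ab: "(e, a) \<in> chips (moved E T \<sigma> \<delta>)" "(e, b) \<in> chips (moved E T \<sigma> \<delta>)"
    have val: "z = (if (e, q e) \<in> T then target E \<sigma> \<delta> (e, q e) else q e)" if "(e, z) \<in> chips (moved E T \<sigma> \<delta>)" for z
      using mc[OF that]
    proof (elim disjE exE conjE)
      assume z: "(e, z) \<in> chips E" "(e, z) \<notin> T"
      have "q e = z" by (rule uniq[OF q[OF z(1)] z(1)])
      then show ?thesis using z(2) by simp
    next
      fix x assume x: "(e, x) \<in> T" "(e, x) \<in> chips E" "z = target E \<sigma> \<delta> (e, x)"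
      have "q e = x" by (rule uniq[OF q[OF x(2)] x(2)])
      then show ?thesis using x by simp
    qed
    show "a = b" using val[OF ab(1)] val[OF ab(2)] by simp
  next
    fix C' :: "'v set" assume C': "C' \<noteq> {}" "C' \<noteq> UNIV"
    show "\<exists>e\<in>edges G. (fst e \<in> C') \<noteq> (snd e \<in> C') \<and> (\<forall>t. (e, t) \<notin> chips (moved E T \<sigma> \<delta>))"
    proof (rule ccontr)
      assume "\<not> ?thesis"
      then have ch': "\<exists>t. (e, t) \<in> chips (moved E T \<sigma> \<delta>)" if "e \<in> edges G" "(fst e \<in> C') \<noteq> (snd e \<in> C')" for e
        using that by blast
      then have ch: "\<exists>t. (e, t) \<in> chips E" if "e \<in> edges G" "(fst e \<in> C') \<noteq> (snd e \<in> C')" for e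
        using mc that by blast
      obtain e1 x1 where e1: "(e1, x1) \<in> T" "target E \<sigma> \<delta> (e1, x1) = 0 \<or> target E \<sigma> \<delta> (e1, x1) = L e1"
      proof -
        have "\<not> (\<exists>e x y. (e, x) \<in> T \<and> (e, y) \<in> T \<and> x < y \<and> target E \<sigma> \<delta> (e, x) = target E \<sigma> \<delta> (e, y))"
        proof
          assume "\<exists>e x y. (e, x) \<in> T \<and> (e, y) \<in> T \<and> x < y \<and> target E \<sigma> \<delta> (e, x) = target E \<sigma> \<delta> (e, y)"
          then obtain e x y where xy: "(e, x) \<in> T" "(e, y) \<in> T" "x < y" by blast
          have "x = y" by (rule uniq) (use xy TC in blast)+
          then show False using xy(3) by simp
        qed
        then show thesis using ev that unfolding event_def by blast
      qed
      have e1C: "e1 \<in> edges G" "(fst e1 \<in> C) \<noteq> (snd e1 \<in> C)" using e1(1) unfolding T by auto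
      have "(e1, t) \<notin> chips (moved E T \<sigma> \<delta>)" for t
      proof
        assume "(e1, t) \<in> chips (moved E T \<sigma> \<delta>)"
        from mc[OF this] show False
        proof (elim disjE exE conjE)
          assume "(e1, t) \<in> chips E" "(e1, t) \<notin> T"
          then show False using uniq[of e1 t x1] e1(1) TC by blast
        next
          fix x assume x: "(e1, x) \<in> T" "t = target E \<sigma> \<delta> (e1, x)" "0 < t" "t < L e1"
          have "x = x1" using uniq[of e1 x x1] x(1) e1(1) TC by blast
          then show False using x e1(2) by auto
        qed
      qed
      then have e1C': "(fst e1 \<in> C') = (snd e1 \<in> C')" using ch' e1C(1) by blast
      \<comment> \<open>The edge of \<open>P\<close> crosses both \<open>C\<close> and \<open>C'\<close>, while \<open>e1\<close> crosses only \<open>C\<close>, so the symmetric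
        difference of \<open>C\<close> and \<open>C'\<close> gives a cut of \<open>E\<close> that avoids \<open>P\<close>.\<close>
      define C'' where "C'' = {v. (v \<in> C) \<noteq> (v \<in> C')}"
      have e1C'': "(fst e1 \<in> C'') \<noteq> (snd e1 \<in> C'')" unfolding C''_def using e1C e1C' by auto
      have ch'': "\<exists>t. (e, t) \<in> chips E" if "e \<in> edges G" "(fst e \<in> C'') \<noteq> (snd e \<in> C'')" for e
        using that(2) c[OF that(1)] ch[OF that(1)] unfolding C''_def by blast
      obtain a where a: "a \<in> edges G" "(fst a \<in> C) \<noteq> (snd a \<in> C)" "\<exists>t. (a, t) \<in> chips E \<and> P = pt a t"
        using cutP[OF C] c by blast
      obtain a' where a': "a' \<in> edges G" "(fst a' \<in> C') \<noteq> (snd a' \<in> C')" "\<exists>t. (a', t) \<in> chips E \<and> P = pt a' t"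
        using cutP[OF C'] ch by blast
      have "C'' \<noteq> {}" "C'' \<noteq> UNIV" using e1C'' by auto
      then obtain a'' where a'': "a'' \<in> edges G" "(fst a'' \<in> C'') \<noteq> (snd a'' \<in> C'')" "\<exists>t. (a'', t) \<in> chips E \<and> P = pt a'' t"
        using cutP[of C''] ch'' by blast
      have "a = a'" "a = a''" using same a(3) a'(3) a''(3) by metis+
      then show False using a(2) a'(2) a''(2) unfolding C''_def by auto
    qed
  qed
qed

lemma maximal_decomposition:
  assumes D: "is_divisor G D" and f: "maximal D P f" and P: "P \<in> curve G" and nv: "\<not> rigid (plus_div D f)"
  obtains Q1 Q2 h1 h2 where "Q1 \<in> curve G" "Q2 \<in> curve G" "maximal D Q1 h1" "maximal D Q2 h2"
    "rigid (plus_div D h1)" "rigid (plus_div D h2)" "f = (\<lambda>x\<in>curve G. max (h1 x) (h2 x))"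
proof -
  define E where "E = (plus_div D f)"
  have fR: "in_R D f" using f unfolding maximal_def by simp
  have E: "effective G E" and rf: "rational_fun G f" using fR unfolding in_R_def E_def by auto
  \<comment> \<open>Two chips on a common edge are dealt with first, so that in the other case every
    edge has at most one chip.\<close>
  obtain T \<sigma> \<kappa> where cut: "is_cut E T \<sigma> \<kappa>" and saturated: "saturated E T"
    and vl: "\<And>\<sigma> \<kappa> \<delta>. is_cut E T \<sigma> \<kappa> \<Longrightarrow> admissible E T \<sigma> \<delta> \<Longrightarrow> event E T \<sigma> \<delta> \<Longrightarrow> rigid (moved E T \<sigma> \<delta>)"
  proof (cases "\<exists>e x y. (e, x) \<in> chips E \<and> (e, y) \<in> chips E \<and> x < y")
    case True
    then obtain e x y where xy: "(e, x) \<in> chips E" "(e, y) \<in> chips E" "x < y" by blast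
    show thesis
      by (rule that[OF pair_cut[OF xy] rigid_moved_pair(1)[OF D f P E_def xy refl]
          rigid_moved_pair(2)[OF D f P E_def xy refl]])
  next
    case False
    then have uniq: "x = y" if "(e, x) \<in> chips E" "(e, y) \<in> chips E" for e x y
      using that by (metis linorder_neqE_linordered_idom)
    then obtain C where C: "C \<noteq> {}" "C \<noteq> UNIV" "\<And>e. e \<in> edges G \<Longrightarrow> (fst e \<in> C) \<noteq> (snd e \<in> C) \<Longrightarrow> \<exists>t. (e, t) \<in> chips E"
    proof -
      have "\<exists>C. C \<noteq> {} \<and> C \<noteq> UNIV \<and> (\<forall>e\<in>edges G. (fst e \<in> C) \<noteq> (snd e \<in> C) \<longrightarrow> (\<exists>t. (e, t) \<in> chips E))"
      proof (rule ccontr)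
        assume n: "\<not> ?thesis"
        have "rigid E" unfolding rigid_def
        proof (intro conjI allI impI)
          show "x = y" if "(e, x) \<in> chips E" "(e, y) \<in> chips E" for e x y by (rule uniq[OF that])
          fix C :: "'v set" assume C: "C \<noteq> {}" "C \<noteq> UNIV"
          have "\<not> (\<forall>e\<in>edges G. (fst e \<in> C) \<noteq> (snd e \<in> C) \<longrightarrow> (\<exists>t. (e, t) \<in> chips E))"
            using n C by meson
          then show "\<exists>e\<in>edges G. (fst e \<in> C) \<noteq> (snd e \<in> C) \<and> (\<forall>t. (e, t) \<notin> chips E)" by simp
        qed
        then show False using nv[folded E_def] by simp
      qed
      then show thesis using that by blast
    qed
    define c where "c e = (SOME t. (e, t) \<in> chips E)" for e
    have c: "(e, c e) \<in> chips E" if "e \<in> edges G" "(fst e \<in> C) \<noteq> (snd e \<in> C)" for e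
      unfolding c_def by (rule someI_ex[OF C(3)[OF that]])
    show thesis
      by (rule that[OF vertex_cut[OF C(1,2) c] rigid_moved_vertex(1)[OF D f P E_def uniq C(1,2) c refl]
          rigid_moved_vertex(2)[OF D f P E_def uniq C(1,2) c refl]])
  qed
  obtain e0 x0 where k0: "(e0, x0) \<in> T" "P = pt e0 x0"
    using maximal_cut[OF D f P, folded E_def, OF cut] by blast
  note f0 = f[unfolded k0(2)]
  have side: "\<exists>\<delta> Q h. admissible E T \<sigma> \<delta> \<and> Q \<in> curve G \<and> maximal D Q h \<and> rigid (plus_div D h) \<and>
      (\<forall>v. h (vx v) = f (vx v) - \<delta> * \<kappa> v) \<and>
      (\<forall>e t. e \<in> edges G \<longrightarrow> 0 \<le> t \<longrightarrow> t \<le> L e \<longrightarrow> h (pt e t) = f (pt e t) - cut_fun E T \<sigma> \<kappa> \<delta> e t) \<and>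
      (\<forall>x\<in>curve G. h x \<le> f x)" if cut: "is_cut E T \<sigma> \<kappa>" for \<sigma> \<kappa>
  proof -
    obtain \<delta> where \<delta>: "0 < \<delta>" "admissible E T \<sigma> \<delta>" "\<And>\<delta>'. 0 \<le> \<delta>' \<Longrightarrow> \<delta>' < \<delta> \<Longrightarrow> strictly_admissible E T \<sigma> \<delta>'" "event E T \<sigma> \<delta>"
      by (rule cut_event[OF cut E]) (rule that)
    obtain h where h: "maximal D (pt e0 (target E \<sigma> \<delta> (e0, x0))) h"
    "\<And>v. h (vx v) = f (vx v) - \<delta> * \<kappa> v"
    "\<And>e t. e \<in> edges G \<Longrightarrow> 0 \<le> t \<Longrightarrow> t \<le> L e \<Longrightarrow> h (pt e t) = f (pt e t) - cut_fun E T \<sigma> \<kappa> \<delta> e t"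
    "(plus_div D h) = moved E T \<sigma> \<delta>"
    "\<And>x. x \<in> curve G \<Longrightarrow> h x \<le> f x"
      by (rule maximal_moved[OF D f0, folded E_def, OF cut saturated k0(1) \<delta>(1,2,3)]) (assumption | rule that)+
    have "pt e0 (target E \<sigma> \<delta> (e0, x0)) \<in> curve G"
      using \<delta>(2) k0(1) cut_chip(1)[OF cut E k0(1)] unfolding admissible_def by (intro pt_curve) blast+
    then show ?thesis using h \<delta>(2) vl[OF cut \<delta>(2,4)]
      by (intro exI[of _ \<delta>] exI[of _ "pt e0 (target E \<sigma> \<delta> (e0, x0))"] exI[of _ h]) simp
  qed
  obtain \<delta> Q h where 1: "admissible E T \<sigma> \<delta>" "Q \<in> curve G" "maximal D Q h" "rigid (plus_div D h)"
    "\<And>v. h (vx v) = f (vx v) - \<delta> * \<kappa> v"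
    "\<And>e t. e \<in> edges G \<Longrightarrow> 0 \<le> t \<Longrightarrow> t \<le> L e \<Longrightarrow> h (pt e t) = f (pt e t) - cut_fun E T \<sigma> \<kappa> \<delta> e t"
    "\<And>x. x \<in> curve G \<Longrightarrow> h x \<le> f x"
    using side[OF cut] by (elim exE conjE) blast
  obtain \<delta>' Q' h' where 2: "admissible E T (\<lambda>k. - \<sigma> k) \<delta>'" "Q' \<in> curve G" "maximal D Q' h'" "rigid (plus_div D h')"
    "\<And>v. h' (vx v) = f (vx v) - \<delta>' * (1 - \<kappa> v)"
    "\<And>e t. e \<in> edges G \<Longrightarrow> 0 \<le> t \<Longrightarrow> t \<le> L e \<Longrightarrow> h' (pt e t) = f (pt e t) - cut_fun E T (\<lambda>k. - \<sigma> k) (\<lambda>v. 1 - \<kappa> v) \<delta>' e t"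
    "\<And>x. x \<in> curve G \<Longrightarrow> h' x \<le> f x"
    using side[OF is_cut_opp[OF cut]] by (elim exE conjE) blast
  have "h x = f x \<or> h' x = f x" if "x \<in> curve G" for x
    using that
  proof (cases rule: curve_cases)
    case (vertex v)
    have "\<kappa> v = 0 \<or> \<kappa> v = 1" using cut unfolding is_cut_def by blast
    then show ?thesis using 1(5)[of v] 2(5)[of v] vertex by auto
  next
    case (interior e t)
    then show ?thesis using 1(6)[of e t] 2(6)[of e t] cut_fun_disjoint[OF cut E interior(1) 1(1) 2(1), of t] by auto
  qed
  then have "f x = max (h x) (h' x)" if "x \<in> curve G" for x
    using 1(7)[OF that] 2(7)[OF that] that by (force simp: max_def)
  then have "f = (\<lambda>x\<in>curve G. max (h x) (h' x))"
    using rf unfolding rational_iff extensional_def by auto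
  then show thesis using that 1(2-4) 2(2-4) by blast
qed

end

section \<open>Tropical spans\<close>

lemma trop_span_generator: "f \<in> F \<Longrightarrow> trop_scale G c f \<in> trop_span G F"
  unfolding trop_span_def mem_Collect_eq
  by (intro exI[of _ "{f}"] exI[of _ "\<lambda>_. c"]) (auto simp: trop_scale_def restrict_def)

lemma trop_span_scale:
  assumes "g \<in> trop_span G F" shows "trop_scale G c g \<in> trop_span G F"
proof -
  obtain A a where A: "g = (\<lambda>x\<in>curve G. Max ((\<lambda>f. trop_scale G (a f) f x) ` A))" "finite A" "A \<noteq> {}" "A \<subseteq> F"
    using assms unfolding trop_span_def by blast
  have "trop_scale G c g = (\<lambda>x\<in>curve G. Max ((\<lambda>f. trop_scale G (c + a f) f x) ` A))"
    unfolding trop_scale_def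
  proof (rule restrict_ext)
    fix x assume x: "x \<in> curve G"
    have "c + Max ((\<lambda>f. a f + f x) ` A) = Max ((\<lambda>y. c + y) ` (\<lambda>f. a f + f x) ` A)"
      by (rule mono_Max_commute) (use A in \<open>auto intro: monoI\<close>)
    then show "c + g x = Max ((\<lambda>f. (\<lambda>x\<in>curve G. c + a f + f x) x) ` A)"
      using x A(1) by (simp add: trop_scale_def image_image add.assoc)
  qed
  then show ?thesis unfolding trop_span_def mem_Collect_eq using A(2-4)
    by (intro exI[of _ A] exI[of _ "\<lambda>f. c + a f"]) simp
qed

lemma trop_span_add:
  assumes "g \<in> trop_span G F" "h \<in> trop_span G F" shows "trop_add G g h \<in> trop_span G F"
proof -
  obtain A a where A: "g = (\<lambda>x\<in>curve G. Max ((\<lambda>f. trop_scale G (a f) f x) ` A))" "finite A" "A \<noteq> {}" "A \<subseteq> F"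
    using assms(1) unfolding trop_span_def by blast
  obtain B b where B: "h = (\<lambda>x\<in>curve G. Max ((\<lambda>f. trop_scale G (b f) f x) ` B))" "finite B" "B \<noteq> {}" "B \<subseteq> F"
    using assms(2) unfolding trop_span_def by blast
  \<comment> \<open>A function occurring in both combinations receives the larger of its two
    coefficients.\<close>
  define c where "c f = (if f \<in> A then if f \<in> B then max (a f) (b f) else a f else b f)" for f
  have "trop_add G g h = (\<lambda>x\<in>curve G. Max ((\<lambda>f. trop_scale G (c f) f x) ` (A \<union> B)))"
    unfolding trop_add_def
  proof (rule restrict_ext)
    fix x assume x: "x \<in> curve G"
    have gx: "g x = Max ((\<lambda>f. a f + f x) ` A)" and hx: "h x = Max ((\<lambda>f. b f + f x) ` B)"
      using x A(1) B(1) by (simp_all add: trop_scale_def)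
    have gA: "a f + f x \<le> g x" if "f \<in> A" for f unfolding gx using that A(2) by simp
    have hB: "b f + f x \<le> h x" if "f \<in> B" for f unfolding hx using that B(2) by simp
    have fin: "finite ((\<lambda>f. c f + f x) ` (A \<union> B))" "(\<lambda>f. c f + f x) ` (A \<union> B) \<noteq> {}" using A B by auto
    have cM: "c f + f x \<le> Max ((\<lambda>f. c f + f x) ` (A \<union> B))" if "f \<in> A \<union> B" for f using that fin by simp
    have "max (g x) (h x) = Max ((\<lambda>f. c f + f x) ` (A \<union> B))"
    proof (rule antisym)
      have "g x \<in> (\<lambda>f. a f + f x) ` A" unfolding gx using A by (intro Max_in) auto
      then obtain f where f: "f \<in> A" "g x = a f + f x" by blast
      have "g x \<le> c f + f x" unfolding f(2) c_def using f(1) by simp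
      then have 1: "g x \<le> Max ((\<lambda>f. c f + f x) ` (A \<union> B))" using cM[of f] f(1) by simp
      have "h x \<in> (\<lambda>f. b f + f x) ` B" unfolding hx using B by (intro Max_in) auto
      then obtain f where f: "f \<in> B" "h x = b f + f x" by blast
      have "h x \<le> c f + f x" unfolding f(2) c_def using f(1) by simp
      then have 2: "h x \<le> Max ((\<lambda>f. c f + f x) ` (A \<union> B))" using cM[of f] f(1) by simp
      show "max (g x) (h x) \<le> Max ((\<lambda>f. c f + f x) ` (A \<union> B))" using 1 2 by simp
      have "c f + f x \<le> max (g x) (h x)" if "f \<in> A \<union> B" for f
        using gA[of f] hB[of f] that unfolding c_def by (auto simp: max_def)
      then show "Max ((\<lambda>f. c f + f x) ` (A \<union> B)) \<le> max (g x) (h x)" using fin by simp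
    qed
    then show "max (g x) (h x) = Max ((\<lambda>f. trop_scale G (c f) f x) ` (A \<union> B))"
      using x by (simp add: trop_scale_def)
  qed
  then show ?thesis unfolding trop_span_def mem_Collect_eq using A(2-4) B(2-4)
    by (intro exI[of _ "A \<union> B"] exI[of _ c]) simp
qed

lemma trop_span_mono: "F \<subseteq> F' \<Longrightarrow> trop_span G F \<subseteq> trop_span G F'"
  unfolding trop_span_def by blast

lemma trop_span_closed:
  assumes "F' \<subseteq> trop_span G F" shows "trop_span G F' \<subseteq> trop_span G F"
proof
  fix g assume "g \<in> trop_span G F'"
  then obtain A a where A: "g = (\<lambda>x\<in>curve G. Max ((\<lambda>f. trop_scale G (a f) f x) ` A))" "finite A" "A \<noteq> {}" "A \<subseteq> F'"
    unfolding trop_span_def by blast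
  from A(2-4) have "(\<lambda>x\<in>curve G. Max ((\<lambda>f. trop_scale G (a f) f x) ` A)) \<in> trop_span G F"
  proof (induction rule: finite_ne_induct)
    case (singleton f)
    have "trop_scale G (a f) f \<in> trop_span G F" by (rule trop_span_scale) (use singleton assms in auto)
    moreover have "trop_scale G (a f) f = (\<lambda>x\<in>curve G. Max ((\<lambda>f. trop_scale G (a f) f x) ` {f}))"
      unfolding trop_scale_def by (auto simp: restrict_def)
    ultimately show ?case by (simp only:)
  next
    case (insert f A)
    let ?g = "\<lambda>x\<in>curve G. Max ((\<lambda>f. trop_scale G (a f) f x) ` A)"
    have "trop_add G (trop_scale G (a f) f) ?g \<in> trop_span G F"
      by (intro trop_span_add trop_span_scale insert.IH) (use insert assms in auto)
    moreover have "trop_add G (trop_scale G (a f) f) ?g = (\<lambda>x\<in>curve G. Max ((\<lambda>f. trop_scale G (a f) f x) ` insert f A))"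
      unfolding trop_add_def using insert by (intro restrict_ext) simp
    ultimately show ?case by (simp only:)
  qed
  then show "g \<in> trop_span G F" unfolding A(1) .
qed

lemma (in tcurve) trop_span_self:
  assumes "rational_fun G f" "f \<in> F" shows "f \<in> trop_span G F"
proof -
  have "trop_scale G 0 f = f"
    using assms(1) unfolding rational_iff trop_scale_def by (auto simp: extensional_def fun_eq_iff)
  then show ?thesis using trop_span_generator[OF assms(2), of G 0] by simp
qed

section \<open>Vertices of the linear system\<close>

context tcurve
begin

lemma linear_system_iff: "E \<in> linear_system G D \<longleftrightarrow> (\<exists>f. in_R D f \<and> E = (plus_div D f))"
proof
  assume "E \<in> linear_system G D"
  then obtain f where f: "effective G E" "rational_fun G f" "(\<lambda>x. E x - D x) = ord G f"
    unfolding linear_system_def lin_equiv_def div_fun_def by auto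
  then have "E = (plus_div D f)" by (auto simp: fun_eq_iff algebra_simps)
  then show "\<exists>f. in_R D f \<and> E = (plus_div D f)" using f unfolding in_R_def by auto
next
  assume "\<exists>f. in_R D f \<and> E = (plus_div D f)"
  then show "E \<in> linear_system G D"
    unfolding in_R_def linear_system_def lin_equiv_def div_fun_def by auto
qed

text \<open>If \<open>|D|\<close> were empty, the zero divisor would be a witness of degree 0 and
  the rank would be -1.\<close>

lemma rank_nonneg_nonempty:
  assumes "divisor_rank G D \<ge> 0" obtains f where "in_R D f"
proof -
  have "linear_system G D \<noteq> {}"
  proof
    assume e: "linear_system G D = {}"
    have "\<exists>E. effective G E \<and> deg E = int 0 \<and> linear_system G (\<lambda>x. D x - E x) = {}"
      by (rule exI[of _ "\<lambda>_. 0"]) (simp add: e effective_def is_divisor_def deg_def)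
    then have "(LEAST k. \<exists>E. effective G E \<and> deg E = int k \<and> linear_system G (\<lambda>x. D x - E x) = {}) = 0"
      by (rule Least_eq_0)
    then show False using assms unfolding divisor_rank_def by simp
  qed
  then show thesis using that linear_system_iff by blast
qed

text \<open>The tuple lists the points of \<open>E\<close> with multiplicity; it is read off from a
  list representing \<open>E\<close> as a multiset.\<close>

lemma effective_tuple:
  assumes E: "effective G E" and d: "deg E = int d"
  shows "E \<in> tuple_divisor d ` topspace (curve_power G d)"
proof -
  have fin: "finite {x. E x \<noteq> 0}" and sub: "{x. E x \<noteq> 0} \<subseteq> curve G" and nn: "\<And>x. 0 \<le> E x"
    using E unfolding effective_def is_divisor_def by auto
  have p: "0 < nat (E x) \<longleftrightarrow> E x \<noteq> 0" for x using nn[of x] by auto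
  define M where "M = Abs_multiset (\<lambda>x. nat (E x))"
  have cM: "count M x = nat (E x)" for x unfolding M_def by (subst count_Abs_multiset) (use fin p in auto)
  have sM: "set_mset M = {x. E x \<noteq> 0}" unfolding set_mset_def using cM p by auto
  obtain xs where xs: "mset xs = M" using ex_mset by blast
  have "int (size M) = (\<Sum>x | E x \<noteq> 0. E x)"
    unfolding size_multiset_overloaded_eq sM cM using nn by (simp add: of_nat_sum)
  then have len: "length xs = d" using d xs unfolding deg_def by (metis of_nat_eq_iff size_mset)
  define q where "q = (\<lambda>i\<in>{..<d}. xs ! i)"
  have "set xs \<subseteq> curve G" using sub sM xs by (metis set_mset_mset)
  then have qT: "q \<in> topspace (curve_power G d)"
    unfolding curve_power_def topspace_product_topology q_def using len by (auto simp: PiE_def)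
  have "tuple_divisor d q x = E x" for x
  proof -
    have "{i. i < d \<and> q i = x} = {i. i < length xs \<and> x = xs ! i}" unfolding q_def len by auto
    then have "card {i. i < d \<and> q i = x} = length (filter ((=) x) xs)" unfolding length_filter_conv_card by simp
    also have "\<dots> = count M x" unfolding xs[symmetric] count_mset count_list_eq_length_filter ..
    finally show ?thesis unfolding tuple_divisor_def cM using nn by simp
  qed
  then show ?thesis using qT by (metis ext image_eqI)
qed

lemma topspace_sym_power: "topspace (sym_power G d) = tuple_divisor d ` topspace (curve_power G d)"
  using quotient_map_tuple_divisor[of G d] unfolding quotient_map_def by simp

text \<open>The entries of a tuple representing \<open>E\<close> lie in the finite support of
  \<open>E\<close>. So the fibre over \<open>E\<close> is finite, hence closed in the Hausdorff
  space of tuples, and this transfers to the quotient.\<close>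

lemma closedin_sym_power_singleton:
  assumes E: "effective G E" and d: "deg E = int d"
  shows "closedin (sym_power G d) {E}"
proof -
  let ?X = "curve_power G d" and ?S = "sym_power G d"
  have Etop: "E \<in> topspace ?S" unfolding topspace_sym_power by (rule effective_tuple[OF E d])
  have fin: "finite {x. E x \<noteq> 0}" using E unfolding effective_def is_divisor_def by auto
  let ?P = "{p \<in> topspace ?X. tuple_divisor d p = E}"
  have "?P \<subseteq> PiE {..<d} (\<lambda>_. {x. E x \<noteq> 0})"
  proof
    fix p assume p: "p \<in> ?P"
    have "E (p i) \<noteq> 0" if i: "i < d" for i
    proof -
      have "i \<in> {j. j < d \<and> p j = p i}" using i by simp
      then have "card {j. j < d \<and> p j = p i} \<noteq> 0" by (metis card_0_eq empty_iff finite_Collect_less_nat finite_Collect_conjI)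
      then show ?thesis using p unfolding tuple_divisor_def by auto
    qed
    then show "p \<in> PiE {..<d} (\<lambda>_. {x. E x \<noteq> 0})"
      using p unfolding curve_power_def topspace_product_topology by (auto simp: PiE_def)
  qed
  moreover have "finite (PiE {..<d} (\<lambda>_. {x. E x \<noteq> 0}))" using fin by (intro finite_PiE) auto
  ultimately have "finite ?P" by (rule finite_subset)
  moreover have "Hausdorff_space ?X" unfolding curve_power_def
    by (simp add: Hausdorff_space_product_topology Hausdorff_space_subtopology)
  ultimately have "closedin ?X ?P" using Hausdorff_imp_t1_space unfolding t1_space_closedin_finite by blast
  then have "openin ?X (topspace ?X - ?P)" by blast
  moreover have "{p \<in> topspace ?X. tuple_divisor d p \<in> topspace ?S - {E}} = topspace ?X - ?P"
    unfolding topspace_sym_power by auto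
  ultimately have "openin ?S (topspace ?S - {E})"
    unfolding openin_sym_power topspace_sym_power by auto
  then show ?thesis using Etop unfolding closedin_def by simp
qed

text \<open>Positive coordinates at both ends of \<open>e\<close> force a point of the curve into the interior of \<open>e\<close>.\<close>

definition edge_nbhd :: "'v \<times> 'v \<Rightarrow> real \<Rightarrow> real \<Rightarrow> (real^'v) set" where
  "edge_nbhd e x \<epsilon> = {y \<in> curve G. 0 < y $ fst e \<and> 0 < y $ snd e \<and> \<bar>L e * y $ snd e - x\<bar> < \<epsilon>}"

lemma edge_nbhd_open: "openin (top_of_set (curve G)) (edge_nbhd e x \<epsilon>)"
proof -
  have "open {y. 0 < y $ fst e \<and> 0 < y $ snd e \<and> \<bar>L e * y $ snd e - x\<bar> < \<epsilon>}"
    by (intro open_Collect_conj open_Collect_less continuous_intros)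
  then show ?thesis unfolding edge_nbhd_def openin_open by blast
qed

lemma edge_nbhdD:
  assumes e: "e \<in> edges G" and y: "y \<in> edge_nbhd e x \<epsilon>"
  obtains t where "y = pt e t" "0 < t" "t < L e" "\<bar>t - x\<bar> < \<epsilon>"
proof -
  have yc: "y \<in> curve G" "0 < y $ fst e" "0 < y $ snd e" "\<bar>L e * y $ snd e - x\<bar> < \<epsilon>" using y unfolding edge_nbhd_def by auto
  from yc(1) show thesis
  proof (cases rule: curve_cases)
    case (vertex v)
    then have "fst e = v" "snd e = v" using yc(2,3) by (auto simp: axis_def split: if_splits)
    then show thesis using edge_neq[OF e] by simp
  next
    case (interior e' t)
    have "fst e = fst e' \<or> fst e = snd e'" "snd e = fst e' \<or> snd e = snd e'"
      using yc(2,3) unfolding interior(4) pt_nth[OF interior(1)] by (auto split: if_splits)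
    then have "e = e' \<or> (fst e = snd e' \<and> snd e = fst e')" using edge_neq[OF e] by (metis prod.collapse)
    then have "e = e'" using edge_flip[of "fst e" "snd e"] e interior(1) by (metis prod.collapse)
    then show thesis using that[of t] interior yc(4) pt_param[OF e, of t] by simp
  qed
qed

lemma edge_nbhdI: "e \<in> edges G \<Longrightarrow> 0 < x \<Longrightarrow> x < L e \<Longrightarrow> 0 < \<epsilon> \<Longrightarrow> pt e x \<in> edge_nbhd e x \<epsilon>"
  unfolding edge_nbhd_def using pt_curve[of e x] pt_nth[of e x] pt_param[of e x] edge_neq[of e] by auto

text \<open>The edge sequence of a rigid divisor has at most one entry, so equal sequences determine
  the number of chips on the edge and the multiplicity, leaving only the position free.\<close>

lemma same_type_edge:
  assumes vl: "rigid E" and E': "is_divisor G E'" and st: "same_type G E' E" and e: "e \<in> edges G"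
  shows "(\<forall>t. 0 < t \<longrightarrow> t < L e \<longrightarrow> E (pt e t) = 0 \<and> E' (pt e t) = 0) \<or>
    (\<exists>x x'. (e, x) \<in> chips E \<and> (e, x') \<in> chips E' \<and> E (pt e x) = E' (pt e x') \<and>
      (\<forall>t. 0 < t \<longrightarrow> t < L e \<longrightarrow> t \<noteq> x \<longrightarrow> E (pt e t) = 0) \<and> (\<forall>t. 0 < t \<longrightarrow> t < L e \<longrightarrow> t \<noteq> x' \<longrightarrow> E' (pt e t) = 0))"
proof -
  let ?A = "\<lambda>E. {t. 0 < t \<and> t < L e \<and> E (pt e t) \<noteq> 0}"
  have Ach: "?A E = {t. (e, t) \<in> chips E}" for E unfolding chips_def using e by auto
  have finA': "finite (?A E')" unfolding Ach by (rule cut_fibre_finite[OF chips_finite[OF E']])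
  have seq: "map (\<lambda>t. E' (pt e t)) (sorted_list_of_set (?A E')) = map (\<lambda>t. E (pt e t)) (sorted_list_of_set (?A E))"
    using st e unfolding same_type_def edge_sequence_def by blast
  from rigid_edge[OF vl e] show ?thesis
  proof
    assume z: "\<forall>t. 0 < t \<longrightarrow> t < L e \<longrightarrow> E (pt e t) = 0"
    then have A: "?A E = {}" by auto
    have "sorted_list_of_set (?A E') = []" using seq unfolding A by simp
    then have "?A E' = {}" using finA' by (metis set_sorted_list_of_set empty_set)
    then show ?thesis using z by auto
  next
    assume "\<exists>x. (e, x) \<in> chips E \<and> (\<forall>t. 0 < t \<longrightarrow> t < L e \<longrightarrow> t \<noteq> x \<longrightarrow> E (pt e t) = 0)"
    then obtain x where x: "(e, x) \<in> chips E" "\<forall>t. 0 < t \<longrightarrow> t < L e \<longrightarrow> t \<noteq> x \<longrightarrow> E (pt e t) = 0" by blast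
    then have A: "?A E = {x}" unfolding chips_def by auto
    have s: "map (\<lambda>t. E' (pt e t)) (sorted_list_of_set (?A E')) = [E (pt e x)]" using seq unfolding A by simp
    then obtain x' where x': "sorted_list_of_set (?A E') = [x']" "E' (pt e x') = E (pt e x)" by (auto simp: map_eq_Cons_conv)
    have A': "?A E' = {x'}" using set_sorted_list_of_set[OF finA'] x'(1) by simp
    then have "(e, x') \<in> chips E'" using Ach[of E'] by auto
    moreover have "\<forall>t. 0 < t \<longrightarrow> t < L e \<longrightarrow> t \<noteq> x' \<longrightarrow> E' (pt e t) = 0" using A' by auto
    ultimately show ?thesis using x x'(2) by metis
  qed
qed

section \<open>Rigid divisors are vertices of the linear system\<close>

text \<open>An element of \<open>|D|\<close> of the same type with chips near those of
  \<open>E\<close> equals \<open>E\<close> by the flow argument, so \<open>E\<close> is isolated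
  within its type. Since \<open>{E}\<close> is also closed, it is a connected component and its own
  closure.\<close>

lemma rigid_cell_vertex:
  assumes D: "is_divisor G D" and f: "in_R D f" and vl: "rigid (plus_div D f)"
  shows "(plus_div D f) \<in> cell_vertices G D"
proof -
  define E where "E = (plus_div D f)"
  have E: "effective G E" using f unfolding in_R_def E_def by simp
  have "deg E = deg D" unfolding E_def using deg_add_div[OF D] f unfolding in_R_def by blast
  moreover have "0 \<le> deg E" using E unfolding effective_def deg_def by (simp add: sum_nonneg)
  ultimately have dE: "deg E = int (nat (deg D))" by simp
  define d where "d = nat (deg D)"
  let ?X = "curve_power G d" and ?S = "sym_power G d"
  note dE = dE[folded d_def]
  have Els: "E \<in> linear_system G D" unfolding linear_system_iff E_def using f by blast
  have cl: "closedin ?S {E}" by (rule closedin_sym_power_singleton[OF E dE])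
  then have Etop: "E \<in> topspace ?S" using closedin_subset by blast
  \<comment> \<open>A radius such that multiplicity times radius stays below the length of the edge;
    the summand 1 makes this strict and the denominator positive.\<close>
  define \<epsilon> where "\<epsilon> k = L (fst k) / (of_int (E (pt (fst k) (snd k))) + 1)" for k
  have Enn: "0 \<le> E x" for x using E unfolding effective_def by blast
  have \<epsilon>: "0 < \<epsilon> (e, x)" "of_int (E (pt e x)) * \<epsilon> (e, x) < L e" if "e \<in> edges G" for e x
  proof -
    have "0 < real_of_int (E (pt e x)) + 1" using Enn[of "pt e x"] by linarith
    then show "0 < \<epsilon> (e, x)" "of_int (E (pt e x)) * \<epsilon> (e, x) < L e"
      unfolding \<epsilon>_def using L_pos[OF that] by (auto simp: field_simps)
  qed
  define U where "U k = edge_nbhd (fst k) (snd k) (\<epsilon> k)" for k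
  \<comment> \<open>Divisors with a support point near every chip of \<open>E\<close>. On such an
    edge a divisor of the same type has only one chip, and this locates it.\<close>
  define N where "N = {E' \<in> topspace ?S. \<forall>k\<in>chips E. \<exists>y\<in>U k. E' y \<noteq> 0}"
  have "openin ?S N"
    unfolding openin_sym_power
  proof
    show "N \<subseteq> tuple_divisor d ` topspace ?X" unfolding N_def topspace_sym_power by auto
    have td: "tuple_divisor d p y \<noteq> 0 \<longleftrightarrow> (\<exists>i<d. p i = y)" for p y
    proof -
      have "finite {i. i < d \<and> p i = y}" by simp
      then show ?thesis unfolding tuple_divisor_def by (auto simp: card_eq_0_iff)
    qed
    have "{p \<in> topspace ?X. tuple_divisor d p \<in> N} =
       topspace ?X \<inter> (\<Inter>k\<in>chips E. \<Union>i\<in>{..<d}. {p \<in> topspace ?X. p i \<in> U k})"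
    proof -
      have "(\<exists>y\<in>U k. tuple_divisor d p y \<noteq> 0) \<longleftrightarrow> (\<exists>i<d. p i \<in> U k)" for p k unfolding td by blast
      then show ?thesis unfolding N_def topspace_sym_power by auto
    qed
    moreover have op: "openin ?X {p \<in> topspace ?X. p i \<in> U k}" if "i < d" for i k
      unfolding curve_power_def U_def
      by (rule openin_continuous_map_preimage[OF _ edge_nbhd_open], rule continuous_map_product_projection) (use that in simp)
    have "openin ?X (topspace ?X \<inter> (\<Inter>k\<in>chips E. \<Union>i\<in>{..<d}. {p \<in> topspace ?X. p i \<in> U k}))"
    proof (cases "chips E = {}")
      case False
      have "openin ?X (\<Inter>k\<in>chips E. \<Union>i\<in>{..<d}. {p \<in> topspace ?X. p i \<in> U k})"
        by (rule openin_INT2[OF _ False]) (use chips_finite E op in \<open>auto simp: effective_def intro!: openin_Union\<close>)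
      then show ?thesis by blast
    qed simp
    ultimately show "openin ?X {p \<in> topspace ?X. tuple_divisor d p \<in> N}" by simp
  qed
  moreover have EN: "E \<in> N"
    unfolding N_def U_def using Etop edge_nbhdI \<epsilon>(1) by (force simp: chips_def)
  define Y where "Y = subtopology ?S {E' \<in> linear_system G D. same_type G E' E}"
  have st: "same_type G E E" unfolding same_type_def by simp
  have NE: "E' = E" if E': "E' \<in> N" "E' \<in> linear_system G D" "same_type G E' E" for E'
  proof -
    obtain f' where f': "in_R D f'" "E' = (plus_div D f')" using E'(2) unfolding linear_system_iff by blast
    have E'div: "is_divisor G E'" using f' unfolding in_R_def effective_def by blast
    have "close_on_edge E E' e" if e: "e \<in> edges G" for e
    proof (rule close_on_edgeI[OF _ e])
      from same_type_edge[OF vl[folded E_def] E'div E'(3) e]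
      show "(\<forall>t. 0 < t \<longrightarrow> t < L e \<longrightarrow> E (pt e t) = 0 \<and> E' (pt e t) = 0) \<or>
        (\<exists>x x'. (e, x) \<in> chips E \<and> (e, x') \<in> chips E' \<and> 0 \<le> E (pt e x) \<and> E (pt e x) = E' (pt e x') \<and>
          (\<forall>t. 0 < t \<longrightarrow> t < L e \<longrightarrow> t \<noteq> x \<longrightarrow> E (pt e t) = 0) \<and> (\<forall>t. 0 < t \<longrightarrow> t < L e \<longrightarrow> t \<noteq> x' \<longrightarrow> E' (pt e t) = 0) \<and>
          of_int (E (pt e x)) * \<bar>x - x'\<bar> < L e)"
      proof (elim disjE exE conjE)
        fix x x' assume x: "(e, x) \<in> chips E" "(e, x') \<in> chips E'" "E (pt e x) = E' (pt e x')"
          "\<forall>t. 0 < t \<longrightarrow> t < L e \<longrightarrow> t \<noteq> x \<longrightarrow> E (pt e t) = 0" "\<forall>t. 0 < t \<longrightarrow> t < L e \<longrightarrow> t \<noteq> x' \<longrightarrow> E' (pt e t) = 0"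
        obtain y where y: "y \<in> edge_nbhd e x (\<epsilon> (e,x))" "E' y \<noteq> 0" using E'(1) x(1) unfolding N_def U_def by fastforce
        obtain t where t: "y = pt e t" "0 < t" "t < L e" "\<bar>t - x\<bar> < \<epsilon> (e,x)" by (rule edge_nbhdD[OF e y(1)])
        have "t = x'" using x(5) t y(2) by blast
        then have "of_int (E (pt e x)) * \<bar>x - x'\<bar> \<le> of_int (E (pt e x)) * \<epsilon> (e,x)"
          using t(4) Enn[of "pt e x"] by (intro mult_left_mono) auto
        then have "of_int (E (pt e x)) * \<bar>x - x'\<bar> < L e" using \<epsilon>(2)[OF e, of x] by simp
        then show ?thesis using x Enn[of "pt e x"] by blast
      qed simp
    qed
    moreover have "E (vx v) = E' (vx v)" for v using E'(3) unfolding same_type_def by simp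
    ultimately show ?thesis using in_R_close_on_edge(2)[OF f f'(1) vl] unfolding f'(2) E_def by metis
  qed
  ultimately have "openin Y {E}"
    unfolding Y_def openin_subtopology using Els st EN by (intro exI[of _ N]) auto
  moreover have clY: "closedin Y {E}"
    unfolding Y_def closedin_subtopology using cl Els st by (intro exI[of _ "{E}"]) auto
  moreover have EY: "E \<in> topspace Y" unfolding Y_def using Etop Els st by simp
  then have "E \<in> connected_component_of_set Y E" by (simp add: connected_component_of_refl)
  ultimately have "connected_component_of_set Y E = {E}"
    using connectedin_clopen_cases[OF connectedin_connected_component_of, of Y "{E}" E] by (auto simp: disjnt_iff)
  then have "{E} \<in> connected_components_of Y" unfolding connected_components_of_def using EY by (metis image_eqI)
  then have "{E} \<in> open_cells G D" unfolding open_cells_def Y_def d_def using Els by blast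
  moreover have "?S closure_of {E} = {E}" using cl by (rule closure_of_closedin)
  ultimately have "{E} \<in> cells G D" unfolding cells_def d_def by (metis image_eqI)
  moreover have "subtopology ?S {E} = discrete_topology {E}"
    unfolding subtopology_eq_discrete_topology_sing using Etop by auto
  then have "subtopology ?S {E} dim_le 0" by simp
  ultimately show ?thesis unfolding cell_vertices_def d_def E_def by simp
qed

section \<open>The image of the reduced divisor map\<close>

lemma maximal_shift:
  assumes "maximal D P f" "P \<in> curve G" shows "maximal D P (\<lambda>x\<in>curve G. f x + c)"
  using assms in_R_shift[of D f c] unfolding maximal_def by auto

lemma red_fun_eq:
  assumes D: "is_divisor G D" and P: "P \<in> curve G" and f: "maximal D P f"
  shows "red_fun G D P = (\<lambda>x\<in>curve G. f x - f P)"
  using red_fun_maximal[OF D P maximal_shift[OF f P, of "- f P"]] P by simp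

lemma Red_combination:
  assumes D: "is_divisor G D" and ne: "in_R D f0" and P: "P \<in> curve G"
  obtains "rigid (Red G D P)" |
    Q1 Q2 a b where "Q1 \<in> curve G" "Q2 \<in> curve G" "rigid (Red G D Q1)" "rigid (Red G D Q2)"
      "red_fun G D P = trop_add G (trop_scale G a (red_fun G D Q1)) (trop_scale G b (red_fun G D Q2))"
proof -
  obtain f where f: "maximal D P f" "f P = 0" by (rule maximal_exists[OF D ne P])
  note RP = Red_maximal[OF D P f(1)]
  show thesis
  proof (cases "rigid (plus_div D f)")
    case True
    then show thesis using that(1) RP by simp
  next
    case False
    obtain Q1 Q2 h1 h2 where Q: "Q1 \<in> curve G" "Q2 \<in> curve G" "maximal D Q1 h1" "maximal D Q2 h2"
      "rigid (plus_div D h1)" "rigid (plus_div D h2)" "f = (\<lambda>x\<in>curve G. max (h1 x) (h2 x))"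
      by (rule maximal_decomposition[OF D f(1) P False])
    \<comment> \<open>A maximal function \<open>h\<close> at \<open>Q\<close> is
      \<open>red_fun G D Q\<close> plus the constant \<open>h Q\<close>; these constants are the two
      coefficients.\<close>
    have "red_fun G D P = trop_add G (trop_scale G (h1 Q1) (red_fun G D Q1)) (trop_scale G (h2 Q2) (red_fun G D Q2))"
      unfolding red_fun_maximal[OF D P f] red_fun_eq[OF D Q(1,3)] red_fun_eq[OF D Q(2,4)] trop_add_def trop_scale_def
      by (subst Q(7)) (rule restrict_ext, simp)
    then show thesis using that(2)[OF Q(1,2)] Q(5,6) Red_maximal[OF D Q(1,3)] Red_maximal[OF D Q(2,4)] by simp
  qed
qed

lemma Red_cell_vertex:
  assumes D: "is_divisor G D" and ne: "in_R D f0" and P: "P \<in> curve G" and vl: "rigid (Red G D P)"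
  shows "Red G D P \<in> cell_vertices G D"
proof -
  obtain f where f: "maximal D P f" "f P = 0" by (rule maximal_exists[OF D ne P])
  show ?thesis using rigid_cell_vertex[OF D] f(1) vl unfolding Red_maximal[OF D P f(1)] maximal_def by blast
qed

text \<open>Infinitely many points may share one rigid reduced divisor, so one base point is chosen
  for each of the finitely many divisors. By \<open>rigid_unique\<close>, another base point of the
  same divisor changes the function only by a constant, that is, by a tropical scalar.\<close>

lemma Red_hull_finitely_generated:
  assumes D: "is_divisor G D" and ne: "in_R D f0"
  shows "trop_finitely_generated G (Red_hull G D)"
proof -
  define V where "V = {Q \<in> curve G. rigid (Red G D Q)}"
  define r where "r E = (SOME Q. Q \<in> V \<and> Red G D Q = E)" for E
  define F where "F = (\<lambda>E. red_fun G D (r E)) ` (Red G D ` V)"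
  have max: "\<exists>f. maximal D P f \<and> f P = 0 \<and> red_fun G D P = f \<and> Red G D P = (plus_div D f)"
    if P: "P \<in> curve G" for P
  proof -
    obtain f where f: "maximal D P f" "f P = 0" by (rule maximal_exists[OF D ne P])
    then show ?thesis using red_fun_maximal[OF D P f] Red_maximal[OF D P f(1)] by blast
  qed
  have rV: "r (Red G D Q) \<in> V \<and> Red G D (r (Red G D Q)) = Red G D Q" if "Q \<in> V" for Q
    unfolding r_def by (rule someI[of _ Q]) (use that in simp)
  have "Red G D ` V \<subseteq> rigid_divisors D"
  proof
    fix E assume "E \<in> Red G D ` V"
    then obtain Q where Q: "Q \<in> curve G" "rigid E" "E = Red G D Q" unfolding V_def by auto
    obtain f where "maximal D Q f" "E = (plus_div D f)" using max[OF Q(1)] Q(3) by auto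
    then show "E \<in> rigid_divisors D" using Q(2) unfolding rigid_divisors_def maximal_def by auto
  qed
  then have finF: "finite F" unfolding F_def using finite_subset[OF _ rigid_divisors_finite[OF D]] by blast
  have Fsub: "F \<subseteq> red_fun G D ` curve G" unfolding F_def using rV unfolding V_def by auto
  have rat: "rational_fun G (red_fun G D P)" if "P \<in> curve G" for P
    using max[OF that] unfolding maximal_def in_R_def by auto
  have inF: "red_fun G D Q \<in> trop_span G F" if Q: "Q \<in> V" for Q
  proof -
    let ?Q = "r (Red G D Q)"
    have QG: "Q \<in> curve G" "?Q \<in> curve G" using Q rV[OF Q] unfolding V_def by auto
    obtain f where f: "maximal D Q f" "red_fun G D Q = f" "Red G D Q = (plus_div D f)" using max[OF QG(1)] by blast
    obtain g where g: "maximal D ?Q g" "red_fun G D ?Q = g" "Red G D ?Q = (plus_div D g)" using max[OF QG(2)] by blast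
    have "\<exists>c. f = (\<lambda>x\<in>curve G. g x + c)"
    proof (rule rigid_unique)
      show "in_R D g" "in_R D f" using f(1) g(1) unfolding maximal_def by auto
      show "rigid (plus_div D g)" using rV[OF Q] g(3) unfolding V_def by (metis (no_types, lifting) mem_Collect_eq)
      show "(plus_div D f) = (plus_div D g)" using rV[OF Q] f(3) g(3) by simp
    qed
    then obtain c where c: "f = (\<lambda>x\<in>curve G. g x + c)" by blast
    have "red_fun G D Q = trop_scale G c (red_fun G D ?Q)"
      unfolding f(2) g(2) trop_scale_def by (subst c) (simp add: add.commute)
    moreover have "red_fun G D ?Q \<in> F" unfolding F_def using Q by blast
    ultimately show ?thesis using trop_span_generator by metis
  qed
  have "red_fun G D ` curve G \<subseteq> trop_span G F"
  proof (rule image_subsetI)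
    fix P assume P: "P \<in> curve G"
    from D ne P show "red_fun G D P \<in> trop_span G F"
    proof (cases rule: Red_combination)
      case 1 then show ?thesis using inF P unfolding V_def by blast
    next
      case (2 Q1 Q2 a b)
      then show ?thesis using inF unfolding V_def by (simp add: trop_span_add trop_span_scale)
    qed
  qed
  then have "Red_hull G D = trop_span G F"
    unfolding Red_hull_def using trop_span_closed trop_span_mono[OF Fsub] by blast
  moreover have "F \<subseteq> Red_hull G D"
    unfolding Red_hull_def using Fsub rat trop_span_self by blast
  ultimately show ?thesis unfolding trop_finitely_generated_def using finF by blast
qed

end

theorem theorem24:
  fixes G :: "('v::finite) model" and D :: "'v divisor"
  assumes "tropical_curve G"
    and "is_divisor G D"
    and "divisor_rank G D \<ge> 0"
  shows "(\<forall>P\<in>curve G. Red G D P \<in> cell_vertices G D \<or>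
           (\<exists>Q1\<in>curve G. \<exists>Q2\<in>curve G.
              Red G D Q1 \<in> cell_vertices G D \<and> Red G D Q2 \<in> cell_vertices G D \<and>
              (\<exists>a b::real. red_fun G D P =
                 trop_add G (trop_scale G a (red_fun G D Q1)) (trop_scale G b (red_fun G D Q2)))))
         \<and> trop_finitely_generated G (Red_hull G D)"
proof -
  interpret tcurve G by standard (rule assms(1))
  obtain f0 where ne: "in_R D f0" by (rule rank_nonneg_nonempty[OF assms(3)])
  show ?thesis
  proof (intro conjI ballI)
    fix P assume P: "P \<in> curve G"
    note vert = Red_cell_vertex[OF assms(2) ne]
    from assms(2) ne P show "Red G D P \<in> cell_vertices G D \<or>
           (\<exists>Q1\<in>curve G. \<exists>Q2\<in>curve G.
              Red G D Q1 \<in> cell_vertices G D \<and> Red G D Q2 \<in> cell_vertices G D \<and>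
              (\<exists>a b::real. red_fun G D P =
                 trop_add G (trop_scale G a (red_fun G D Q1)) (trop_scale G b (red_fun G D Q2))))"
    proof (cases rule: Red_combination)
      case 1 then show ?thesis using vert[OF P] by blast
    next
      case (2 Q1 Q2 a b)
      then show ?thesis using vert[OF 2(1)] vert[OF 2(2)] by blast
    qed
  next
    show "trop_finitely_generated G (Red_hull G D)" by (rule Red_hull_finitely_generated[OF assms(2) ne])
  qed
qed

end
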